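(* Let $G$ be a connected, simply connected nilpotent Lie group of real dimension $2n$, let $\Gamma\subset G$ be a lattice, and let $M=\Gamma\backslash G$ be equipped with a left-invariant (integrable) complex structure $J$. Suppose that $(M,J)$ admits a left-invariant $(1,0)$-coframe $\{\varphi^1,\dots,\varphi^n\}$ such that $$d\varphi^j=0\quad (j=1,\dots,n-1),\qquad d\varphi^n\in\Lambda^2\langle \varphi^1,\dots,\varphi^{n-1},\overline{\varphi^{1}},\dots,\overline{\varphi^{n-1}}\rangle .$$ Then either no left-invariant Hermitian metric on $(M,J)$ is SKT, or the fundamental form $\omega$ of every left-invariant Hermitian metric on $(M,J)$ satisfies $$\partial\overline{\partial}\omega=0\quad\text{and}\quad \partial\overline{\partial}\omega^2=0 .$$
   Context: A nilmanifold is a compact quotient $\Gamma\backslash G$ of a connected, simply connected nilpotent Lie group $G$ by a lattice $\Gamma$; a complex structure, form or metric on it is called left-invariant if it is induced by a left-invariant one on $G$. The span $\Lambda^2\langle\cdots\rangle$ is the complex vector space of constant-coefficient $2$-forms in the listed left-invariant $1$-forms. For a Hermitian metric $g$ on $(M,J)$ the fundamental form is $\omega(\cdot,\cdot)=g(J\cdot,\cdot)$. The metric $g$ is called SKT (strong K\"ahler with torsion, or pluriclosed) if $\partial\overline{\partial}\omega=0$. *)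

theory Defs
  imports "HOL-Analysis.Analysis" "HOL-Algebra.Coset" "HOL-Algebra.Generated_Groups"
begin

section \<open>Smooth manifolds and Lie groups\<close>

text \<open>\<open>smooth_upto k S f\<close>: \<open>f\<close> is of class \<open>C\<^sup>k\<close> on the open set \<open>S\<close> of a Euclidean space.\<close>

primrec smooth_upto ::
  "nat \<Rightarrow> 'a::euclidean_space set \<Rightarrow> ('a \<Rightarrow> 'b::real_normed_vector) \<Rightarrow> bool"
where
  "smooth_upto 0 S f = continuous_on S f"
| "smooth_upto (Suc k) S f =
     ((\<forall>x\<in>S. f differentiable (at x)) \<and>
      (\<forall>v. smooth_upto k S (\<lambda>x. frechet_derivative f (at x) v)))"

definition smooth_on :: "'a::euclidean_space set \<Rightarrow> ('a \<Rightarrow> 'b::real_normed_vector) \<Rightarrow> bool" where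
  "smooth_on S f \<longleftrightarrow> (\<forall>k. smooth_upto k S f)"

text \<open>A chart is a pair of its domain and a coordinate map. Outside the domain the values of the
  coordinate map are irrelevant. Any atlas (not necessarily maximal) determines the structure.\<close>

type_synonym ('m, 'e) atlas = "('m set \<times> ('m \<Rightarrow> 'e)) set"

definition smooth_atlas :: "('m::topological_space, 'e::euclidean_space) atlas \<Rightarrow> bool" where
  "smooth_atlas T \<longleftrightarrow>
     (\<Union>(U, c)\<in>T. U) = UNIV \<and>
     (\<forall>(U, c)\<in>T. open U \<and> open (c ` U) \<and> homeomorphism U (c ` U) c (inv_into U c)) \<and>
     (\<forall>(U, c)\<in>T. \<forall>(V, d)\<in>T. smooth_on (c ` (U \<inter> V)) (d \<circ> inv_into U c))"

definition smooth_map ::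
  "('m::topological_space, 'a::euclidean_space) atlas \<Rightarrow>
   ('k::topological_space, 'b::euclidean_space) atlas \<Rightarrow> ('m \<Rightarrow> 'k) \<Rightarrow> bool"
where
  "smooth_map T T' F \<longleftrightarrow>
     continuous_on UNIV F \<and>
     (\<forall>(U, c)\<in>T. \<forall>(V, d)\<in>T'. smooth_on (c ` (U \<inter> F -` V)) (d \<circ> F \<circ> inv_into U c))"

definition prod_atlas :: "('m, 'a) atlas \<Rightarrow> ('k, 'b) atlas \<Rightarrow> ('m \<times> 'k, 'a \<times> 'b) atlas" where
  "prod_atlas T T' = {(U \<times> V, \<lambda>(x, y). (c x, d y)) | U c V d. (U, c) \<in> T \<and> (V, d) \<in> T'}"

text \<open>A Lie group structure on the type \<open>'g\<close>, of real dimension \<open>DIM('e)\<close>. The manifold axioms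
  Hausdorff and second countable are sort constraints on \<open>'g\<close>.\<close>

definition lie_group ::
  "'g::{t2_space,second_countable_topology} monoid \<Rightarrow> ('g, 'e::euclidean_space) atlas \<Rightarrow> bool"
where
  "lie_group G T \<longleftrightarrow>
     group G \<and> carrier G = UNIV \<and> smooth_atlas T \<and>
     smooth_map (prod_atlas T T) T (\<lambda>(x, y). x \<otimes>\<^bsub>G\<^esub> y) \<and>
     smooth_map T T (\<lambda>x. inv\<^bsub>G\<^esub> x)"

primrec lower_central :: "('g, 'z) monoid_scheme \<Rightarrow> nat \<Rightarrow> 'g set" where
  "lower_central G 0 = carrier G"
| "lower_central G (Suc k) =
     generate G {x \<otimes>\<^bsub>G\<^esub> y \<otimes>\<^bsub>G\<^esub> inv\<^bsub>G\<^esub> x \<otimes>\<^bsub>G\<^esub> inv\<^bsub>G\<^esub> y | x y.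
                  x \<in> lower_central G k \<and> y \<in> carrier G}"

definition nilpotent_group :: "('g, 'z) monoid_scheme \<Rightarrow> bool" where
  "nilpotent_group G \<longleftrightarrow> group G \<and> (\<exists>k. lower_central G k = {\<one>\<^bsub>G\<^esub>})"


section \<open>The quotient of a Lie group by a lattice\<close>

text \<open>The points of \<open>\<Gamma>\G\<close> are the cosets \<open>\<Gamma>x\<close>, which HOL-Algebra calls right cosets.\<close>

definition coset_proj :: "('g, 'z) monoid_scheme \<Rightarrow> 'g set \<Rightarrow> 'g \<Rightarrow> 'g set" where
  "coset_proj G \<Gamma> x = \<Gamma> #>\<^bsub>G\<^esub> x"

definition quotient_topology ::
  "('g::topological_space, 'z) monoid_scheme \<Rightarrow> 'g set \<Rightarrow> 'g set topology"
where
  "quotient_topology G \<Gamma> = topology (\<lambda>V. V \<subseteq> rcosets\<^bsub>G\<^esub> \<Gamma> \<and> open (coset_proj G \<Gamma> -` V))"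

lemma openin_quotient_topology:
  "openin (quotient_topology G \<Gamma>) V \<longleftrightarrow> V \<subseteq> rcosets\<^bsub>G\<^esub> \<Gamma> \<and> open (coset_proj G \<Gamma> -` V)"
proof -
  have "istopology (\<lambda>V. V \<subseteq> rcosets\<^bsub>G\<^esub> \<Gamma> \<and> open (coset_proj G \<Gamma> -` V))"
    unfolding istopology_def by (auto simp: vimage_Int vimage_Union intro!: open_Int open_UN)
  then show ?thesis
    by (simp add: quotient_topology_def topology_inverse')
qed

text \<open>In a nilpotent Lie group a discrete subgroup has finite covolume iff it is cocompact.\<close>

definition cocompact_lattice :: "'g::topological_space monoid \<Rightarrow> 'g set \<Rightarrow> bool" where
  "cocompact_lattice G \<Gamma> \<longleftrightarrow>
     subgroup \<Gamma> G \<and> discrete \<Gamma> \<and> compact_space (quotient_topology G \<Gamma>)"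


section \<open>Smooth complex-valued functions\<close>

type_synonym 'm func = "'m \<Rightarrow> complex"

definition smooth_functions :: "('m::topological_space, 'e::euclidean_space) atlas \<Rightarrow> 'm func set" where
  "smooth_functions T = {f. \<forall>(U, c)\<in>T. smooth_on (c ` U) (f \<circ> inv_into U c)}"

text \<open>The projection \<open>G \<rightarrow> \<Gamma>\G\<close> is a covering, and \<open>\<Gamma>\G\<close> carries the smooth structure
  that makes it a local diffeomorphism. A function on \<open>\<Gamma>\G\<close> is encoded as a function
  on all sets, extended by \<open>0\<close> to the sets that are not cosets.\<close>

definition quotient_functions ::
  "'g::topological_space monoid \<Rightarrow> ('g, 'e::euclidean_space) atlas \<Rightarrow> 'g set \<Rightarrow> 'g set func set"
where
  "quotient_functions G T \<Gamma> =
     {f. f \<circ> coset_proj G \<Gamma> \<in> smooth_functions T \<and> (\<forall>p. p \<notin> rcosets\<^bsub>G\<^esub> \<Gamma> \<longrightarrow> f p = 0)}"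


section \<open>Vector fields\<close>

text \<open>From here on, \<open>A\<close> stands for the algebra of smooth complex functions of a manifold (either
  of the two above). The sections of the complexified tangent bundle are the
  \<open>\<complex>\<close>-linear derivations of \<open>A\<close>. As HOL functions they are made unique by
  the value \<open>0\<close> outside \<open>A\<close>.\<close>

type_synonym 'm vf = "'m func \<Rightarrow> 'm func"

definition vector_fields :: "'m func set \<Rightarrow> 'm vf set" where
  "vector_fields A = {X.
     (\<forall>f\<in>A. X f \<in> A) \<and>
     (\<forall>f. f \<notin> A \<longrightarrow> X f = (\<lambda>p. 0)) \<and>
     (\<forall>f\<in>A. \<forall>g\<in>A. X (\<lambda>p. f p + g p) = (\<lambda>p. X f p + X g p)) \<and>
     (\<forall>f\<in>A. \<forall>a. X (\<lambda>p. a * f p) = (\<lambda>p. a * X f p)) \<and>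
     (\<forall>f\<in>A. \<forall>g\<in>A. X (\<lambda>p. f p * g p) = (\<lambda>p. X f p * g p + f p * X g p))}"

definition vf_add :: "'m vf \<Rightarrow> 'm vf \<Rightarrow> 'm vf" where
  "vf_add X Y = (\<lambda>h p. X h p + Y h p)"

definition vf_scale :: "'m func \<Rightarrow> 'm vf \<Rightarrow> 'm vf" where
  "vf_scale f X = (\<lambda>h p. f p * X h p)"

definition vf_bracket :: "'m vf \<Rightarrow> 'm vf \<Rightarrow> 'm vf" where
  "vf_bracket X Y = (\<lambda>h p. X (Y h) p - Y (X h) p)"

definition vf_cnj :: "'m vf \<Rightarrow> 'm vf" where
  "vf_cnj X = (\<lambda>h p. cnj (X (\<lambda>q. cnj (h q)) p))"

definition real_vector_fields :: "'m func set \<Rightarrow> 'm vf set" where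
  "real_vector_fields A = {X \<in> vector_fields A. vf_cnj X = X}"


section \<open>Differential forms\<close>

text \<open>A complex \<open>k\<close>-form is an alternating \<open>A\<close>-multilinear map on lists of \<open>k\<close> vector fields.
  It is made unique as a HOL function by the value \<open>0\<close> on all other lists.\<close>

type_synonym 'm form = "'m vf list \<Rightarrow> 'm func"

definition form_args :: "'m func set \<Rightarrow> nat \<Rightarrow> 'm vf list set" where
  "form_args A k = {Xs. length Xs = k \<and> set Xs \<subseteq> vector_fields A}"

definition forms :: "'m func set \<Rightarrow> nat \<Rightarrow> 'm form set" where
  "forms A k = {\<alpha>.
     (\<forall>Xs\<in>form_args A k. \<alpha> Xs \<in> A) \<and>
     (\<forall>Xs. Xs \<notin> form_args A k \<longrightarrow> \<alpha> Xs = (\<lambda>p. 0)) \<and>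
     (\<forall>Xs\<in>form_args A k. \<forall>i<k. \<forall>X\<in>vector_fields A. \<forall>Y\<in>vector_fields A.
        \<alpha> (Xs[i := vf_add X Y]) = (\<lambda>p. \<alpha> (Xs[i := X]) p + \<alpha> (Xs[i := Y]) p)) \<and>
     (\<forall>Xs\<in>form_args A k. \<forall>i<k. \<forall>X\<in>vector_fields A. \<forall>f\<in>A.
        \<alpha> (Xs[i := vf_scale f X]) = (\<lambda>p. f p * \<alpha> (Xs[i := X]) p)) \<and>
     (\<forall>Xs\<in>form_args A k. \<forall>i<k. \<forall>j<k. i \<noteq> j \<and> Xs ! i = Xs ! j \<longrightarrow> \<alpha> Xs = (\<lambda>p. 0))}"

definition zero_form :: "'m form" where
  "zero_form = (\<lambda>Xs p. 0)"

definition form_cnj :: "'m form \<Rightarrow> 'm form" where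
  "form_cnj \<alpha> = (\<lambda>Xs p. cnj (\<alpha> (map vf_cnj Xs) p))"

text \<open>The wedge product of a \<open>k\<close>-form and an \<open>l\<close>-form, normalised so that
  \<open>(\<alpha> \<and> \<beta>)(X, Y) = \<alpha>(X) \<beta>(Y) - \<alpha>(Y) \<beta>(X)\<close> for \<open>1\<close>-forms.\<close>

definition wedge :: "nat \<Rightarrow> nat \<Rightarrow> 'm form \<Rightarrow> 'm form \<Rightarrow> 'm form" where
  "wedge k l \<alpha> \<beta> = (\<lambda>Xs p.
     if length Xs = k + l then
       (\<Sum>\<sigma> | \<sigma> permutes {..<k + l}.
          of_int (sign \<sigma>) * \<alpha> (map (\<lambda>i. Xs ! \<sigma> i) [0..<k]) p
                          * \<beta> (map (\<lambda>i. Xs ! \<sigma> i) [k..<k + l]) p)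
       / (fact k * fact l)
     else 0)"

definition omit :: "nat \<Rightarrow> 'a list \<Rightarrow> 'a list" where
  "omit i xs = take i xs @ drop (Suc i) xs"

text \<open>The exterior derivative, by the invariant formula
  \<open>d\<alpha>(X\<^sub>0, \<dots>, X\<^sub>k) = \<Sum>\<^sub>i (-1)\<^sup>i X\<^sub>i(\<alpha>(\<dots>, omit X\<^sub>i, \<dots>))
     + \<Sum>\<^sub>i\<^sub><\<^sub>j (-1)\<^sup>i\<^sup>+\<^sup>j \<alpha>([X\<^sub>i, X\<^sub>j], \<dots>, omit X\<^sub>i, \<dots>, omit X\<^sub>j, \<dots>)\<close>.\<close>

definition ext_d :: "'m func set \<Rightarrow> 'm form \<Rightarrow> 'm form" where
  "ext_d A \<alpha> = (\<lambda>Xs p.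
     if set Xs \<subseteq> vector_fields A then
       (\<Sum>i<length Xs. (- 1) ^ i * (Xs ! i) (\<alpha> (omit i Xs)) p)
       + (\<Sum>j<length Xs. \<Sum>i<j. (- 1) ^ (i + j) *
            \<alpha> (vf_bracket (Xs ! i) (Xs ! j) # omit i (omit j Xs)) p)
     else 0)"

text \<open>The constant-coefficient \<open>2\<close>-forms in the \<open>1\<close>-forms of a finite set \<open>S\<close>.\<close>

definition const_two_forms :: "'m form set \<Rightarrow> 'm form set" where
  "const_two_forms S =
     {\<lambda>Xs p. \<Sum>\<alpha>\<in>S. \<Sum>\<beta>\<in>S. a \<alpha> \<beta> * wedge 1 1 \<alpha> \<beta> Xs p | a :: 'm form \<Rightarrow> 'm form \<Rightarrow> complex. True}"


section \<open>Complex structures and Hermitian metrics\<close>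

text \<open>\<open>J\<close> is the complex-linear extension of an almost complex structure. Integrability is the
  vanishing of the Nijenhuis tensor.\<close>

definition complex_structure :: "'m func set \<Rightarrow> ('m vf \<Rightarrow> 'm vf) \<Rightarrow> bool" where
  "complex_structure A J \<longleftrightarrow>
     (\<forall>X\<in>vector_fields A. J X \<in> vector_fields A \<and> J (J X) = (\<lambda>h p. - X h p) \<and>
        J (vf_cnj X) = vf_cnj (J X)) \<and>
     (\<forall>X\<in>vector_fields A. \<forall>Y\<in>vector_fields A. J (vf_add X Y) = vf_add (J X) (J Y)) \<and>
     (\<forall>X\<in>vector_fields A. \<forall>f\<in>A. J (vf_scale f X) = vf_scale f (J X)) \<and>
     (\<forall>X\<in>vector_fields A. \<forall>Y\<in>vector_fields A. \<forall>h p.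
        vf_bracket (J X) (J Y) h p - J (vf_bracket (J X) Y) h p
          - J (vf_bracket X (J Y)) h p - vf_bracket X Y h p = 0)"

definition proj10 :: "('m vf \<Rightarrow> 'm vf) \<Rightarrow> 'm vf \<Rightarrow> 'm vf" where
  "proj10 J X = (\<lambda>h p. (X h p - \<i> * J X h p) / 2)"

definition proj01 :: "('m vf \<Rightarrow> 'm vf) \<Rightarrow> 'm vf \<Rightarrow> 'm vf" where
  "proj01 J X = (\<lambda>h p. (X h p + \<i> * J X h p) / 2)"

text \<open>The \<open>(p, q)\<close>-component of a \<open>(p + q)\<close>-form. The set \<open>S\<close> selects the arguments that are
  projected to type \<open>(1, 0)\<close>.\<close>

definition type_part ::
  "'m func set \<Rightarrow> ('m vf \<Rightarrow> 'm vf) \<Rightarrow> nat \<Rightarrow> nat \<Rightarrow> 'm form \<Rightarrow> 'm form"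
where
  "type_part A J p q \<alpha> = (\<lambda>Xs x.
     if Xs \<in> form_args A (p + q) then
       (\<Sum>S | S \<subseteq> {..<p + q} \<and> card S = p.
          \<alpha> (map (\<lambda>i. if i \<in> S then proj10 J (Xs ! i) else proj01 J (Xs ! i)) [0..<p + q]) x)
     else 0)"

definition del :: "'m func set \<Rightarrow> ('m vf \<Rightarrow> 'm vf) \<Rightarrow> nat \<Rightarrow> 'm form \<Rightarrow> 'm form" where
  "del A J k \<alpha> = (\<lambda>Xs x. \<Sum>p\<le>k.
     type_part A J (Suc p) (k - p) (ext_d A (type_part A J p (k - p) \<alpha>)) Xs x)"

definition delbar :: "'m func set \<Rightarrow> ('m vf \<Rightarrow> 'm vf) \<Rightarrow> nat \<Rightarrow> 'm form \<Rightarrow> 'm form" where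
  "delbar A J k \<alpha> = (\<lambda>Xs x. \<Sum>p\<le>k.
     type_part A J p (Suc (k - p)) (ext_d A (type_part A J p (k - p) \<alpha>)) Xs x)"

definition del_delbar :: "'m func set \<Rightarrow> ('m vf \<Rightarrow> 'm vf) \<Rightarrow> nat \<Rightarrow> 'm form \<Rightarrow> 'm form" where
  "del_delbar A J k \<alpha> = del A J (Suc k) (delbar A J k \<alpha>)"

definition vector_fields10 :: "'m func set \<Rightarrow> ('m vf \<Rightarrow> 'm vf) \<Rightarrow> 'm vf set" where
  "vector_fields10 A J = {X \<in> vector_fields A. J X = (\<lambda>h p. \<i> * X h p)}"

definition forms10 :: "'m func set \<Rightarrow> ('m vf \<Rightarrow> 'm vf) \<Rightarrow> 'm form set" where
  "forms10 A J = {\<alpha> \<in> forms A 1. \<forall>X\<in>vector_fields A. \<alpha> [J X] = (\<lambda>p. \<i> * \<alpha> [X] p)}"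

definition frame10 ::
  "'m func set \<Rightarrow> ('m vf \<Rightarrow> 'm vf) \<Rightarrow> nat \<Rightarrow> (nat \<Rightarrow> 'm vf) \<Rightarrow> bool"
where
  "frame10 A J n Z \<longleftrightarrow>
     (\<forall>j<n. Z j \<in> vector_fields10 A J) \<and>
     (\<forall>X\<in>vector_fields10 A J.
        \<exists>!c. c \<in> {..<n} \<rightarrow>\<^sub>E A \<and> X = (\<lambda>h p. \<Sum>j<n. c j p * Z j h p))"

text \<open>A \<open>(1, 0)\<close>-coframe is the dual of a global frame \<open>Z\<close> of \<open>T\<^sup>1\<^sup>,\<^sup>0\<close>: the functions
  \<open>\<phi>\<^sup>j(X)\<close> are the components of \<open>X\<close> with respect to \<open>Z\<close>.\<close>

definition coframe10 ::
  "'m func set \<Rightarrow> ('m vf \<Rightarrow> 'm vf) \<Rightarrow> nat \<Rightarrow> (nat \<Rightarrow> 'm form) \<Rightarrow> bool"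
where
  "coframe10 A J n \<phi> \<longleftrightarrow>
     (\<forall>j<n. \<phi> j \<in> forms10 A J) \<and>
     (\<exists>Z. frame10 A J n Z \<and>
        (\<forall>X\<in>vector_fields10 A J. X = (\<lambda>h p. \<Sum>j<n. \<phi> j [X] p * Z j h p)))"

text \<open>A metric is given by its complex-bilinear extension. Positivity is pointwise: a vector field
  is nonzero at \<open>p\<close> iff some function has nonzero derivative along it at \<open>p\<close>.\<close>

definition hermitian_metric ::
  "'m func set \<Rightarrow> ('m vf \<Rightarrow> 'm vf) \<Rightarrow> ('m vf \<Rightarrow> 'm vf \<Rightarrow> 'm func) \<Rightarrow> bool"
where
  "hermitian_metric A J g \<longleftrightarrow>
     (\<forall>X\<in>vector_fields A. \<forall>Y\<in>vector_fields A.
        g X Y \<in> A \<and> g X Y = g Y X \<and>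
        g (vf_cnj X) (vf_cnj Y) = (\<lambda>p. cnj (g X Y p)) \<and>
        g (J X) (J Y) = g X Y) \<and>
     (\<forall>X\<in>vector_fields A. \<forall>X'\<in>vector_fields A. \<forall>Y\<in>vector_fields A.
        g (vf_add X X') Y = (\<lambda>p. g X Y p + g X' Y p)) \<and>
     (\<forall>X\<in>vector_fields A. \<forall>Y\<in>vector_fields A. \<forall>f\<in>A.
        g (vf_scale f X) Y = (\<lambda>p. f p * g X Y p)) \<and>
     (\<forall>X\<in>real_vector_fields A. \<forall>p. (\<exists>h\<in>A. X h p \<noteq> 0) \<longrightarrow> 0 < Re (g X X p))"

definition fundamental_form ::
  "'m func set \<Rightarrow> ('m vf \<Rightarrow> 'm vf) \<Rightarrow> ('m vf \<Rightarrow> 'm vf \<Rightarrow> 'm func) \<Rightarrow> 'm form"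
where
  "fundamental_form A J g = (\<lambda>Xs p.
     if Xs \<in> form_args A 2 then g (J (Xs ! 0)) (Xs ! 1) p else 0)"

definition skt ::
  "'m func set \<Rightarrow> ('m vf \<Rightarrow> 'm vf) \<Rightarrow> ('m vf \<Rightarrow> 'm vf \<Rightarrow> 'm func) \<Rightarrow> bool"
where
  "skt A J g \<longleftrightarrow> del_delbar A J 2 (fundamental_form A J g) = zero_form"


section \<open>Left-invariant objects\<close>

text \<open>\<open>left_push G a X\<close> is the push-forward of the vector field \<open>X\<close> on \<open>G\<close> by the left
  translation \<open>y \<mapsto> ay\<close>.\<close>

definition left_push :: "'g monoid \<Rightarrow> 'g \<Rightarrow> 'g vf \<Rightarrow> 'g vf" where
  "left_push G a X = (\<lambda>h x. X (\<lambda>y. h (a \<otimes>\<^bsub>G\<^esub> y)) (inv\<^bsub>G\<^esub> a \<otimes>\<^bsub>G\<^esub> x))"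

definition left_inv_endo :: "'g monoid \<Rightarrow> 'g func set \<Rightarrow> ('g vf \<Rightarrow> 'g vf) \<Rightarrow> bool" where
  "left_inv_endo G A J \<longleftrightarrow>
     (\<forall>a. \<forall>X\<in>vector_fields A. J (left_push G a X) = left_push G a (J X))"

definition left_inv_form :: "'g monoid \<Rightarrow> 'g func set \<Rightarrow> nat \<Rightarrow> 'g form \<Rightarrow> bool" where
  "left_inv_form G A k \<alpha> \<longleftrightarrow>
     (\<forall>a x. \<forall>Xs\<in>form_args A k. \<alpha> (map (left_push G a) Xs) (a \<otimes>\<^bsub>G\<^esub> x) = \<alpha> Xs x)"

definition left_inv_metric ::
  "'g monoid \<Rightarrow> 'g func set \<Rightarrow> ('g vf \<Rightarrow> 'g vf \<Rightarrow> 'g func) \<Rightarrow> bool"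
where
  "left_inv_metric G A g \<longleftrightarrow>
     (\<forall>a x. \<forall>X\<in>vector_fields A. \<forall>Y\<in>vector_fields A.
        g (left_push G a X) (left_push G a Y) (a \<otimes>\<^bsub>G\<^esub> x) = g X Y x)"

text \<open>For a covering \<open>\<pi>\<close> every vector field downstairs has a unique \<open>\<pi>\<close>-related lift upstairs, so
  a tensor upstairs is the pull-back of one downstairs iff the two agree on all
  \<open>\<pi>\<close>-related arguments. This is the meaning of ``induced'' below; primes mark objects
  upstairs.\<close>

definition vf_related :: "'g func set \<Rightarrow> 'm func set \<Rightarrow> ('g \<Rightarrow> 'm) \<Rightarrow> 'g vf \<Rightarrow> 'm vf \<Rightarrow> bool" where
  "vf_related A' A \<pi> X' X \<longleftrightarrow>
     X' \<in> vector_fields A' \<and> X \<in> vector_fields A \<and> (\<forall>h\<in>A. X' (h \<circ> \<pi>) = X h \<circ> \<pi>)"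

definition induces_endo ::
  "'g func set \<Rightarrow> 'm func set \<Rightarrow> ('g \<Rightarrow> 'm) \<Rightarrow> ('g vf \<Rightarrow> 'g vf) \<Rightarrow> ('m vf \<Rightarrow> 'm vf) \<Rightarrow> bool"
where
  "induces_endo A' A \<pi> J' J \<longleftrightarrow>
     (\<forall>X' X. vf_related A' A \<pi> X' X \<longrightarrow> vf_related A' A \<pi> (J' X') (J X))"

definition induces_form ::
  "'g func set \<Rightarrow> 'm func set \<Rightarrow> ('g \<Rightarrow> 'm) \<Rightarrow> 'g form \<Rightarrow> 'm form \<Rightarrow> bool"
where
  "induces_form A' A \<pi> \<alpha>' \<alpha> \<longleftrightarrow>
     (\<forall>Xs' Xs. list_all2 (vf_related A' A \<pi>) Xs' Xs \<longrightarrow> \<alpha>' Xs' = \<alpha> Xs \<circ> \<pi>)"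

definition induces_metric ::
  "'g func set \<Rightarrow> 'm func set \<Rightarrow> ('g \<Rightarrow> 'm) \<Rightarrow>
   ('g vf \<Rightarrow> 'g vf \<Rightarrow> 'g func) \<Rightarrow> ('m vf \<Rightarrow> 'm vf \<Rightarrow> 'm func) \<Rightarrow> bool"
where
  "induces_metric A' A \<pi> g' g \<longleftrightarrow>
     (\<forall>X' X Y' Y. vf_related A' A \<pi> X' X \<and> vf_related A' A \<pi> Y' Y \<longrightarrow> g' X' Y' = g X Y \<circ> \<pi>)"

definition quotient_left_inv_complex_structure ::
  "'g::topological_space monoid \<Rightarrow> ('g, 'e::euclidean_space) atlas \<Rightarrow> 'g set \<Rightarrow>
   ('g vf \<Rightarrow> 'g vf) \<Rightarrow> ('g set vf \<Rightarrow> 'g set vf) \<Rightarrow> bool"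
where
  "quotient_left_inv_complex_structure G T \<Gamma> J' J \<longleftrightarrow>
     (let A' = smooth_functions T; A = quotient_functions G T \<Gamma> in
        complex_structure A' J' \<and> left_inv_endo G A' J' \<and>
        complex_structure A J \<and> induces_endo A' A (coset_proj G \<Gamma>) J' J)"

definition quotient_left_inv_coframe10 ::
  "'g::topological_space monoid \<Rightarrow> ('g, 'e::euclidean_space) atlas \<Rightarrow> 'g set \<Rightarrow>
   ('g vf \<Rightarrow> 'g vf) \<Rightarrow> ('g set vf \<Rightarrow> 'g set vf) \<Rightarrow> nat \<Rightarrow> (nat \<Rightarrow> 'g set form) \<Rightarrow> bool"
where
  "quotient_left_inv_coframe10 G T \<Gamma> J' J n \<phi> \<longleftrightarrow>
     (let A' = smooth_functions T; A = quotient_functions G T \<Gamma> in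
        coframe10 A J n \<phi> \<and>
        (\<exists>\<phi>'. coframe10 A' J' n \<phi>' \<and>
           (\<forall>j<n. left_inv_form G A' 1 (\<phi>' j) \<and>
                  induces_form A' A (coset_proj G \<Gamma>) (\<phi>' j) (\<phi> j))))"

definition quotient_left_inv_hermitian_metric ::
  "'g::topological_space monoid \<Rightarrow> ('g, 'e::euclidean_space) atlas \<Rightarrow> 'g set \<Rightarrow>
   ('g vf \<Rightarrow> 'g vf) \<Rightarrow> ('g set vf \<Rightarrow> 'g set vf) \<Rightarrow>
   ('g set vf \<Rightarrow> 'g set vf \<Rightarrow> 'g set func) \<Rightarrow> bool"
where
  "quotient_left_inv_hermitian_metric G T \<Gamma> J' J g \<longleftrightarrow>
     (let A' = smooth_functions T; A = quotient_functions G T \<Gamma> in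
        hermitian_metric A J g \<and>
        (\<exists>g'. hermitian_metric A' J' g' \<and> left_inv_metric G A' g' \<and>
           induces_metric A' A (coset_proj G \<Gamma>) g' g))"

end

theory Submission
  imports Defs
begin

text \<open>
Let \<open>Z\<^sub>1, \<dots>, Z\<^sub>n\<close> be the frame dual to the coframe, and write \<open>Z = Z\<^sub>n\<close>, \<open>\<eta> = d\<phi>\<^sup>n\<close>. All the forms
\<open>\<phi>\<^sup>j\<close> except the last are closed, so the bracket of two frame fields \<open>U\<close>, \<open>V\<close> is
\<open>- \<eta>(U, V) Z\<close> minus the conjugate expression (\<open>bracket_frame\<close>). The shape of \<open>\<eta>\<close> says moreover
that contraction with \<open>Z\<close> or its conjugate \<open>Z'\<close> kills \<open>\<eta>\<close> and its conjugate \<open>\<eta>'\<close>. On forms with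
constant coefficients in the frame, the exterior derivative is therefore the algebraic operator
\<open>d\<alpha> = \<eta> \<and> \<iota>(Z) \<alpha> + \<eta>' \<and> \<iota>(Z') \<alpha>\<close> (\<open>ext_d_frame\<close>). Let subscripts denote bidegrees. Sorting by type gives
\<open>\<partial>\<alpha> = \<eta>\<^sub>2\<^sub>0 \<and> \<iota>(Z) \<alpha> + \<eta>'\<^sub>1\<^sub>1 \<and> \<iota>(Z') \<alpha>\<close>, while the Dolbeault operator of degree \<open>(0, 1)\<close> sends \<open>\<alpha>\<close> to
\<open>\<eta>\<^sub>1\<^sub>1 \<and> \<iota>(Z) \<alpha> + \<eta>'\<^sub>0\<^sub>2 \<and> \<iota>(Z') \<alpha>\<close>. The contractions pass through these \<open>2\<close>-forms and anticommute with each other, so the composite of the two operators is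
\<open>\<alpha> \<mapsto> \<Psi> \<and> \<iota>(Z) \<iota>(Z') \<alpha>\<close>, where \<open>\<Psi> = \<eta>\<^sub>2\<^sub>0 \<and> \<eta>'\<^sub>0\<^sub>2 - \<eta>'\<^sub>1\<^sub>1 \<and> \<eta>\<^sub>1\<^sub>1\<close> depends on the coframe only
(\<open>del_delbar_invariant\<close>).

For the fundamental form \<open>\<omega>\<close> of an invariant Hermitian metric, \<open>\<iota>(Z) \<iota>(Z') \<omega>\<close> is a constant, and it is
not zero because the metric is positive. Hence one SKT metric forces \<open>\<Psi> = 0\<close>
(\<open>obstruction_eq_zero\<close>), and then the composite operator annihilates every invariant form of any
degree (\<open>del_delbar_eq_zero\<close>), in particular \<open>\<omega>\<close> and \<open>\<omega>\<^sup>2\<close> for every invariant metric.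

Constancy of the coefficients is where left-invariance enters. The frame dual to the
left-invariant coframe on \<open>G\<close> is itself left-invariant (\<open>left_invariant_frame\<close>); it therefore maps
\<open>\<Gamma>\<close>-invariant functions to \<open>\<Gamma>\<close>-invariant functions and descends to \<open>\<Gamma>\G\<close>, where it is the frame
dual to the given coframe (\<open>vf_related_frame\<close>). Coefficients of a metric in this frame pull back to
left-invariant functions on \<open>G\<close>, which are constant because \<open>G\<close> acts transitively on itself
(\<open>metric_constant\<close>). Everything takes place in the algebra of smooth functions and its module of derivations.

Two devices keep the multilinear algebra short. Forms are handled by recursion on the list of
arguments, through contraction with the first one: Cartan's formula becomes the recursion
\<open>ext_d_Cons\<close> for the exterior derivative. The coefficients of invariant forms are cochains, that is,
functions on lists of frame indices, and their exterior product is defined by recursion as a signed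
shuffle product, for which associativity is a short induction.
\<close>

section \<open>Smooth functions form an algebra\<close>

text \<open>Only the values on the open set \<open>S\<close> matter, although the Frechet derivative is taken in the whole
space. This allows the derivative of a sum, product or conjugate to be replaced by its formula.\<close>

lemma smooth_upto_cong:
  assumes "open S" "\<And>x. x \<in> S \<Longrightarrow> f x = g x" "smooth_upto k S f"
  shows "smooth_upto k S g"
  using assms(2,3)
proof (induction k arbitrary: f g)
  case 0
  then show ?case using continuous_on_cong[of S S f g] by simp
next
  case (Suc k)
  have der: "(g has_derivative frechet_derivative f (at x)) (at x)" if "x \<in> S" for x
  proof -
    have "(f has_derivative frechet_derivative f (at x)) (at x)"
      using Suc.prems(2) that by (simp add: frechet_derivative_works[symmetric])
    then show ?thesis
      using Suc.prems(1) by (rule has_derivative_transform_within_open[OF _ \<open>open S\<close> that])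
  qed
  have "frechet_derivative f (at x) = frechet_derivative g (at x)" if "x \<in> S" for x
    using der[OF that] frechet_derivative_at by blast
  then have "smooth_upto k S (\<lambda>x. frechet_derivative g (at x) v)" for v
    using Suc.IH[of "\<lambda>x. frechet_derivative f (at x) v" "\<lambda>x. frechet_derivative g (at x) v"] Suc.prems
    by simp
  then show ?case
    using der by (auto simp: differentiable_def)
qed

lemma smooth_upto_SucD: "smooth_upto (Suc k) S f \<Longrightarrow> smooth_upto k S f"
proof (induction k arbitrary: f)
  case 0
  then show ?case
    by (auto intro!: continuous_at_imp_continuous_on differentiable_imp_continuous_within)
next
  case (Suc k)
  have "smooth_upto k S (\<lambda>x. frechet_derivative f (at x) v)" for v
    using Suc.prems by (intro Suc.IH) simp
  then show ?case using Suc.prems by simp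
qed

lemma smooth_upto_const: "smooth_upto k S (\<lambda>x. c)"
  by (induction k arbitrary: c) auto

lemma smooth_upto_add:
  assumes "open S" "smooth_upto k S f" "smooth_upto k S g"
  shows "smooth_upto k S (\<lambda>x. f x + g x)"
  using assms(2,3)
proof (induction k arbitrary: f g)
  case 0
  then show ?case by (simp add: continuous_on_add)
next
  case (Suc k)
  have der: "((\<lambda>x. f x + g x) has_derivative
      (\<lambda>v. frechet_derivative f (at x) v + frechet_derivative g (at x) v)) (at x)"
    if "x \<in> S" for x
    using Suc.prems that by (auto intro!: has_derivative_add simp: frechet_derivative_works[symmetric])
  have "frechet_derivative f (at x) v + frechet_derivative g (at x) v
      = frechet_derivative (\<lambda>x. f x + g x) (at x) v" if "x \<in> S" for x v
    using frechet_derivative_at[OF der[OF that]] by metis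
  moreover have "smooth_upto k S (\<lambda>x. frechet_derivative f (at x) v + frechet_derivative g (at x) v)" for v
    using Suc.prems by (intro Suc.IH) auto
  ultimately have "smooth_upto k S (\<lambda>x. frechet_derivative (\<lambda>x. f x + g x) (at x) v)" for v
    by (rule smooth_upto_cong[OF \<open>open S\<close>])
  then show ?case using der by (auto simp: differentiable_def)
qed

lemma smooth_upto_mult:
  fixes f g :: "_ \<Rightarrow> complex"
  assumes "open S" "smooth_upto k S f" "smooth_upto k S g"
  shows "smooth_upto k S (\<lambda>x. f x * g x)"
  using assms(2,3)
proof (induction k arbitrary: f g)
  case 0
  then show ?case by (simp add: continuous_on_mult)
next
  case (Suc k)
  have der: "((\<lambda>x. f x * g x) has_derivative
      (\<lambda>v. f x * frechet_derivative g (at x) v + frechet_derivative f (at x) v * g x)) (at x)"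
    if "x \<in> S" for x
    using Suc.prems that by (auto intro!: has_derivative_mult simp: frechet_derivative_works[symmetric])
  have "f x * frechet_derivative g (at x) v + frechet_derivative f (at x) v * g x
      = frechet_derivative (\<lambda>x. f x * g x) (at x) v" if "x \<in> S" for x v
    using frechet_derivative_at[OF der[OF that]] by metis
  moreover have "smooth_upto k S (\<lambda>x. f x * frechet_derivative g (at x) v + frechet_derivative f (at x) v * g x)" for v
  proof -
    have "smooth_upto k S (\<lambda>x. frechet_derivative f (at x) v)"
      "smooth_upto k S (\<lambda>x. frechet_derivative g (at x) v)"
      using Suc.prems by auto
    then show ?thesis
      using Suc.prems[THEN smooth_upto_SucD] by (intro smooth_upto_add[OF \<open>open S\<close>] Suc.IH)
  qed
  ultimately have "smooth_upto k S (\<lambda>x. frechet_derivative (\<lambda>x. f x * g x) (at x) v)" for v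
    by (rule smooth_upto_cong[OF \<open>open S\<close>])
  then show ?case using der by (auto simp: differentiable_def)
qed

lemma smooth_upto_cnj:
  assumes "open S" "smooth_upto k S f"
  shows "smooth_upto k S (\<lambda>x. cnj (f x))"
  using assms(2)
proof (induction k arbitrary: f)
  case 0
  then show ?case by (simp add: continuous_on_cnj)
next
  case (Suc k)
  have der: "((\<lambda>x. cnj (f x)) has_derivative (\<lambda>v. cnj (frechet_derivative f (at x) v))) (at x)"
    if "x \<in> S" for x
    using Suc.prems that by (auto intro!: has_derivative_cnj simp: frechet_derivative_works[symmetric])
  have "cnj (frechet_derivative f (at x) v) = frechet_derivative (\<lambda>x. cnj (f x)) (at x) v" if "x \<in> S" for x v
    using frechet_derivative_at[OF der[OF that]] by metis
  moreover have "smooth_upto k S (\<lambda>x. cnj (frechet_derivative f (at x) v))" for v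
    using Suc.prems by (intro Suc.IH) auto
  ultimately have "smooth_upto k S (\<lambda>x. frechet_derivative (\<lambda>x. cnj (f x)) (at x) v)" for v
    by (rule smooth_upto_cong[OF \<open>open S\<close>])
  then show ?case using der by (auto simp: differentiable_def)
qed

text \<open>The algebraic properties of smooth functions that the calculus of forms uses. The unit is the
indicator function of \<open>M\<close> rather than the constant \<open>1\<close>, because functions on \<open>\<Gamma>\G\<close> are encoded as functions on
all subsets of \<open>G\<close> that vanish off the cosets; for them \<open>M\<close> is the set of cosets.\<close>

locale function_algebra =
  fixes A :: "'m func set" and M :: "'m set"
  assumes zero_outside: "\<And>f p. f \<in> A \<Longrightarrow> p \<notin> M \<Longrightarrow> f p = 0"
    and indicator_in: "(\<lambda>p. of_bool (p \<in> M)) \<in> A"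
    and add_in: "\<And>f g. f \<in> A \<Longrightarrow> g \<in> A \<Longrightarrow> (\<lambda>p. f p + g p) \<in> A"
    and mult_in: "\<And>f g. f \<in> A \<Longrightarrow> g \<in> A \<Longrightarrow> (\<lambda>p. f p * g p) \<in> A"
    and scale_in: "\<And>f c. f \<in> A \<Longrightarrow> (\<lambda>p. c * f p) \<in> A"
    and cnj_in: "\<And>f. f \<in> A \<Longrightarrow> (\<lambda>p. cnj (f p)) \<in> A"

lemma function_algebra_smooth:
  assumes "smooth_atlas T"
  shows "function_algebra (smooth_functions T) UNIV"
proof -
  have op: "open (c ` U)" if "(U, c) \<in> T" for U c
    using assms that unfolding smooth_atlas_def by blast
  note defs = smooth_functions_def smooth_on_def comp_def
  show ?thesis
  proof
    fix f g assume "f \<in> smooth_functions T" "g \<in> smooth_functions T"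
    then show "(\<lambda>p. f p + g p) \<in> smooth_functions T" "(\<lambda>p. f p * g p) \<in> smooth_functions T"
      using op by (fastforce simp: defs intro: smooth_upto_add smooth_upto_mult)+
  next
    fix f c assume "f \<in> smooth_functions T"
    then show "(\<lambda>p. c * f p) \<in> smooth_functions T" "(\<lambda>p. cnj (f p)) \<in> smooth_functions T"
      using op by (fastforce simp: defs intro: smooth_upto_mult smooth_upto_const smooth_upto_cnj)+
  qed (auto simp: defs smooth_upto_const)
qed

section \<open>Derivations of a function algebra\<close>

lemma zero_form_in_forms: "zero_form \<in> forms A k" if "(\<lambda>p. 0) \<in> A"
  using that by (auto simp: forms_def zero_form_def)

definition contract :: "'v \<Rightarrow> ('v list \<Rightarrow> 'b) \<Rightarrow> 'v list \<Rightarrow> 'b" where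
  "contract v a = (\<lambda>I. a (v # I))"

lemma contract_apply [simp]: "contract v a I = a (v # I)"
  by (simp add: contract_def)

lemma form_args_Nil [simp]: "[] \<in> form_args A k \<longleftrightarrow> k = 0"
  by (auto simp: form_args_def)

lemma form_args_Cons [simp]:
  "X # Xs \<in> form_args A k \<longleftrightarrow> (\<exists>l. k = Suc l \<and> X \<in> vector_fields A \<and> Xs \<in> form_args A l)"
  by (auto simp: form_args_def)

lemma form_args_Suc_SucE:
  assumes "Xs \<in> form_args A (Suc (Suc k))"
  obtains X Y Ys where "Xs = X # Y # Ys" "X \<in> vector_fields A" "Y \<in> vector_fields A" "Ys \<in> form_args A k"
  using assms by (auto simp: form_args_def length_Suc_conv)

lemma form_args_update:
  "Xs \<in> form_args A k \<Longrightarrow> X \<in> vector_fields A \<Longrightarrow> Xs[i := X] \<in> form_args A k"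
  using set_update_subset_insert[of Xs i X] by (auto simp: form_args_def)

lemma form_args_nth: "Xs \<in> form_args A k \<Longrightarrow> i < k \<Longrightarrow> Xs ! i \<in> vector_fields A"
  by (auto simp: form_args_def)

context function_algebra
begin

definition const :: "complex \<Rightarrow> 'm func" where
  "const c = (\<lambda>p. c * of_bool (p \<in> M))"

lemma const_in: "const c \<in> A"
  unfolding const_def by (intro scale_in indicator_in)

lemma zero_in: "(\<lambda>p. 0) \<in> A"
  using scale_in[OF indicator_in, of 0] by simp

lemma uminus_in: "f \<in> A \<Longrightarrow> (\<lambda>p. - f p) \<in> A"
  using scale_in[of f "- 1"] by simp

lemma diff_in: "f \<in> A \<Longrightarrow> g \<in> A \<Longrightarrow> (\<lambda>p. f p - g p) \<in> A"
  using add_in[of f "\<lambda>p. - g p"] uminus_in by simp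

lemma sum_in: "(\<And>i. i \<in> I \<Longrightarrow> f i \<in> A) \<Longrightarrow> (\<lambda>p. \<Sum>i\<in>I. f i p) \<in> A"
  by (induction I rule: infinite_finite_induct) (auto intro: zero_in add_in)

lemma const_mult: "f \<in> A \<Longrightarrow> const c p * f p = c * f p"
  using zero_outside by (cases "p \<in> M") (auto simp: const_def)

lemma const_0 [simp]: "const 0 = (\<lambda>p. 0)"
  by (simp add: const_def)

lemma const_eq_iff: "p \<in> M \<Longrightarrow> const c p = c"
  by (simp add: const_def)

abbreviation "VF \<equiv> vector_fields A"

lemma VF_in: "X \<in> VF \<Longrightarrow> X f \<in> A"
  by (cases "f \<in> A") (auto simp: vector_fields_def zero_in)

lemma VF_outside: "X \<in> VF \<Longrightarrow> f \<notin> A \<Longrightarrow> X f = (\<lambda>p. 0)"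
  by (simp add: vector_fields_def)

lemma VF_add: "X \<in> VF \<Longrightarrow> f \<in> A \<Longrightarrow> g \<in> A \<Longrightarrow> X (\<lambda>p. f p + g p) = (\<lambda>p. X f p + X g p)"
  by (simp add: vector_fields_def)

lemma VF_scale: "X \<in> VF \<Longrightarrow> f \<in> A \<Longrightarrow> X (\<lambda>p. c * f p) = (\<lambda>p. c * X f p)"
  by (simp add: vector_fields_def)

lemma VF_mult:
  "X \<in> VF \<Longrightarrow> f \<in> A \<Longrightarrow> g \<in> A \<Longrightarrow> X (\<lambda>p. f p * g p) = (\<lambda>p. X f p * g p + f p * X g p)"
  by (simp add: vector_fields_def)

lemma VF_zero: "X \<in> VF \<Longrightarrow> X (\<lambda>p. 0) = (\<lambda>p. 0)"
  using VF_scale[OF _ zero_in, of X 0] by simp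

lemma VF_uminus: "X \<in> VF \<Longrightarrow> f \<in> A \<Longrightarrow> X (\<lambda>p. - f p) = (\<lambda>p. - X f p)"
  using VF_scale[of X f "- 1"] by simp

text \<open>The unit is idempotent, so the Leibniz rule kills it on its support.\<close>

lemma VF_const:
  assumes X: "X \<in> VF"
  shows "X (const c) = (\<lambda>p. 0)"
proof -
  let ?e = "\<lambda>p. of_bool (p \<in> M) :: complex"
  have "X ?e = (\<lambda>p. 0)"
  proof
    fix p
    have "X ?e p = X (\<lambda>p. ?e p * ?e p) p"
      by (simp flip: of_bool_conj)
    also have "\<dots> = X ?e p * ?e p + ?e p * X ?e p"
      by (simp only: VF_mult[OF X indicator_in indicator_in])
    finally show "X ?e p = 0"
      using zero_outside[OF VF_in[OF X, of ?e], of p] by (cases "p \<in> M") auto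
  qed
  then show ?thesis
    using VF_scale[OF X indicator_in, of c] by (simp add: const_def)
qed

lemma VF_I:
  assumes "\<And>f. f \<in> A \<Longrightarrow> X f \<in> A" "\<And>f. f \<notin> A \<Longrightarrow> X f = (\<lambda>p. 0)"
    "\<And>f g p. f \<in> A \<Longrightarrow> g \<in> A \<Longrightarrow> X (\<lambda>p. f p + g p) p = X f p + X g p"
    "\<And>f c p. f \<in> A \<Longrightarrow> X (\<lambda>p. c * f p) p = c * X f p"
    "\<And>f g p. f \<in> A \<Longrightarrow> g \<in> A \<Longrightarrow> X (\<lambda>p. f p * g p) p = X f p * g p + f p * X g p"
  shows "X \<in> VF"
  using assms unfolding vector_fields_def by auto

lemma vf_add_in: "X \<in> VF \<Longrightarrow> Y \<in> VF \<Longrightarrow> vf_add X Y \<in> VF"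
  by (rule VF_I) (auto simp: vf_add_def VF_in VF_outside VF_add VF_scale VF_mult add_in algebra_simps)

lemma vf_scale_in: "X \<in> VF \<Longrightarrow> f \<in> A \<Longrightarrow> vf_scale f X \<in> VF"
  by (rule VF_I) (auto simp: vf_scale_def VF_in VF_outside VF_add VF_scale VF_mult mult_in algebra_simps)

lemma vf_zero_in: "(\<lambda>h p. 0) \<in> VF"
  by (rule VF_I) (auto simp: zero_in)

lemma vf_cscale_eq: "X \<in> VF \<Longrightarrow> (\<lambda>h p. c * X h p) = vf_scale (const c) X"
  by (auto simp: vf_scale_def const_mult VF_in)

lemma vf_cscale_in: "X \<in> VF \<Longrightarrow> (\<lambda>h p. c * X h p) \<in> VF"
  by (simp add: vf_cscale_eq vf_scale_in const_in)

lemma vf_bracket_in: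
  assumes X: "X \<in> VF" and Y: "Y \<in> VF"
  shows "vf_bracket X Y \<in> VF"
proof (rule VF_I)
  have leibniz: "U (V (\<lambda>p. f p * g p)) p
      = U (V f) p * g p + V f p * U g p + (U f p * V g p + f p * U (V g) p)"
    if "U \<in> VF" "V \<in> VF" "f \<in> A" "g \<in> A" for U V f g p
    using that VF_add[OF that(1), of "\<lambda>p. V f p * g p" "\<lambda>p. f p * V g p"]
    by (simp add: VF_mult VF_in mult_in)
  show "vf_bracket X Y (\<lambda>p. f p * g p) p = vf_bracket X Y f p * g p + f p * vf_bracket X Y g p"
    if "f \<in> A" "g \<in> A" for f g p
    by (simp add: vf_bracket_def leibniz X Y that algebra_simps)
qed (use assms in \<open>auto simp: vf_bracket_def VF_in VF_outside VF_zero VF_add VF_scale diff_in right_diff_distrib\<close>)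

lemma vf_cnj_in:
  assumes "X \<in> VF"
  shows "vf_cnj X \<in> VF"
proof (rule VF_I)
  show "vf_cnj X f = (\<lambda>p. 0)" if "f \<notin> A" for f
  proof -
    have "(\<lambda>p. cnj (f p)) \<notin> A"
      using that cnj_in[of "\<lambda>p. cnj (f p)"] by auto
    then show ?thesis
      using VF_outside[OF assms] by (simp add: vf_cnj_def)
  qed
  show "vf_cnj X f \<in> A" if "f \<in> A" for f
    using cnj_in[OF VF_in[OF assms]] by (simp add: vf_cnj_def)
  show "vf_cnj X (\<lambda>p. f p + g p) p = vf_cnj X f p + vf_cnj X g p"
    "vf_cnj X (\<lambda>p. f p * g p) p = vf_cnj X f p * g p + f p * vf_cnj X g p" if "f \<in> A" "g \<in> A" for f g p
    using VF_add[OF assms cnj_in[OF that(1)] cnj_in[OF that(2)]]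
      VF_mult[OF assms cnj_in[OF that(1)] cnj_in[OF that(2)]] by (simp_all add: vf_cnj_def)
  show "vf_cnj X (\<lambda>p. c * f p) p = c * vf_cnj X f p" if "f \<in> A" for f c p
    using VF_scale[OF assms cnj_in[OF that], of "cnj c"] by (simp add: vf_cnj_def)
qed

lemma vf_sum_in: "(\<And>i. i \<in> I \<Longrightarrow> X i \<in> VF) \<Longrightarrow> (\<lambda>h p. \<Sum>i\<in>I. X i h p) \<in> VF"
proof (induction I rule: infinite_finite_induct)
  case (insert x F)
  then show ?case using vf_add_in[of "X x" "\<lambda>h p. \<Sum>i\<in>F. X i h p"] by (simp add: vf_add_def)
qed (auto simp: vf_zero_in)

section \<open>Alternating forms\<close>

lemma form_outside: "\<alpha> \<in> forms A k \<Longrightarrow> Xs \<notin> form_args A k \<Longrightarrow> \<alpha> Xs = (\<lambda>p. 0)"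
  by (simp add: forms_def)

lemma form_in: "\<alpha> \<in> forms A k \<Longrightarrow> \<alpha> Xs \<in> A"
  by (cases "Xs \<in> form_args A k") (auto simp: forms_def zero_in)

lemma form_add:
  "\<alpha> \<in> forms A k \<Longrightarrow> Xs \<in> form_args A k \<Longrightarrow> i < k \<Longrightarrow> X \<in> VF \<Longrightarrow> Y \<in> VF
    \<Longrightarrow> \<alpha> (Xs[i := vf_add X Y]) p = \<alpha> (Xs[i := X]) p + \<alpha> (Xs[i := Y]) p"
  by (simp add: forms_def)

lemma form_scale:
  "\<alpha> \<in> forms A k \<Longrightarrow> Xs \<in> form_args A k \<Longrightarrow> i < k \<Longrightarrow> X \<in> VF \<Longrightarrow> f \<in> A
    \<Longrightarrow> \<alpha> (Xs[i := vf_scale f X]) p = f p * \<alpha> (Xs[i := X]) p"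
  by (simp add: forms_def)

lemma form_alternating:
  "\<alpha> \<in> forms A k \<Longrightarrow> Xs \<in> form_args A k \<Longrightarrow> i < k \<Longrightarrow> j < k \<Longrightarrow> i \<noteq> j \<Longrightarrow> Xs ! i = Xs ! j
    \<Longrightarrow> \<alpha> Xs p = 0"
  by (simp add: forms_def)

lemma forms_I:
  assumes "\<And>Xs. Xs \<in> form_args A k \<Longrightarrow> \<alpha> Xs \<in> A"
    "\<And>Xs. Xs \<notin> form_args A k \<Longrightarrow> \<alpha> Xs = (\<lambda>p. 0)"
    "\<And>Xs i X Y p. Xs \<in> form_args A k \<Longrightarrow> i < k \<Longrightarrow> X \<in> VF \<Longrightarrow> Y \<in> VF
      \<Longrightarrow> \<alpha> (Xs[i := vf_add X Y]) p = \<alpha> (Xs[i := X]) p + \<alpha> (Xs[i := Y]) p"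
    "\<And>Xs i X f p. Xs \<in> form_args A k \<Longrightarrow> i < k \<Longrightarrow> X \<in> VF \<Longrightarrow> f \<in> A
      \<Longrightarrow> \<alpha> (Xs[i := vf_scale f X]) p = f p * \<alpha> (Xs[i := X]) p"
    "\<And>Xs i j p. Xs \<in> form_args A k \<Longrightarrow> i < k \<Longrightarrow> j < k \<Longrightarrow> i \<noteq> j \<Longrightarrow> Xs ! i = Xs ! j \<Longrightarrow> \<alpha> Xs p = 0"
  shows "\<alpha> \<in> forms A k"
  using assms unfolding forms_def mem_Collect_eq by (intro conjI ballI allI impI ext; (elim conjE)?) (blast | simp)+

lemma form_cscale:
  assumes "\<alpha> \<in> forms A k" "Xs \<in> form_args A k" "i < k" "X \<in> VF"
  shows "\<alpha> (Xs[i := (\<lambda>h p. c * X h p)]) p = c * \<alpha> (Xs[i := X]) p"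
  using form_scale[OF assms const_in, of c p] assms
  by (simp add: vf_cscale_eq const_mult form_in[OF assms(1)])

lemma form_zero_arg:
  assumes "\<alpha> \<in> forms A k" "(\<lambda>h p. 0) \<in> set Xs"
  shows "\<alpha> Xs p = 0"
proof (cases "Xs \<in> form_args A k")
  case True
  then obtain i where i: "i < k" "Xs ! i = (\<lambda>h p. 0)"
    using assms(2) by (auto simp: in_set_conv_nth form_args_def)
  then have "Xs[i := (\<lambda>h p. 0 * (Xs ! i) h p)] = Xs"
    using list_update_id[of Xs i] by simp
  then show ?thesis using form_cscale[OF assms(1) True i(1) form_args_nth[OF True i(1)], of 0 p] by simp
qed (simp add: form_outside[OF assms(1)])

text \<open>Expand \<open>\<alpha>(\<dots>, X + Y, \<dots>, X + Y, \<dots>) = 0\<close>.\<close>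

lemma form_swap:
  assumes \<alpha>: "\<alpha> \<in> forms A k" and Xs: "Xs \<in> form_args A k" and ij: "i < k" "j < k" "i \<noteq> j"
  shows "\<alpha> (Xs[i := Xs ! j, j := Xs ! i]) p = - \<alpha> Xs p"
proof -
  have len: "length Xs = k" using Xs by (simp add: form_args_def)
  define X Y where "X = Xs ! i" and "Y = Xs ! j"
  have XY: "X \<in> VF" "Y \<in> VF" using ij form_args_nth[OF Xs] by (auto simp: X_def Y_def)
  let ?g = "\<lambda>U V. \<alpha> (Xs[i := U, j := V]) p"
  have upd: "Xs[i := U, j := V] \<in> form_args A k" if "U \<in> VF" "V \<in> VF" for U V
    using that Xs by (intro form_args_update)
  have eq: "?g U U = 0" if "U \<in> VF" for U
    using form_alternating[OF \<alpha> upd[OF that that], of i j p] ij len by simp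
  have add2: "?g U (vf_add V W) = ?g U V + ?g U W" if "U \<in> VF" "V \<in> VF" "W \<in> VF" for U V W
    using form_add[OF \<alpha> form_args_update[OF Xs that(1)] ij(2) that(2,3)] by simp
  have add1: "?g (vf_add V W) U = ?g V U + ?g W U" if "U \<in> VF" "V \<in> VF" "W \<in> VF" for U V W
    using form_add[OF \<alpha> form_args_update[OF Xs that(1)] ij(1) that(2,3), of j p] ij(3)
    by (simp add: list_update_swap)
  have "0 = ?g (vf_add X Y) (vf_add X Y)" using eq[OF vf_add_in] XY by simp
  also have "\<dots> = ?g X Y + ?g Y X"
    using XY by (simp add: add1 add2 vf_add_in eq[OF XY(1)] eq[OF XY(2)])
  finally have "?g Y X = - ?g X Y" by (simp add: eq_neg_iff_add_eq_0 add.commute)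
  then show ?thesis unfolding X_def Y_def by simp
qed

lemma form_swap_first:
  assumes "\<alpha> \<in> forms A k"
  shows "\<alpha> (X # Y # Ys) p = - \<alpha> (Y # X # Ys) p"
proof (cases "X # Y # Ys \<in> form_args A k")
  case True
  then show ?thesis using form_swap[OF assms, of "Y # X # Ys" 0 1 p] by auto
next
  case False
  then have "Y # X # Ys \<notin> form_args A k" by auto
  then show ?thesis using False by (simp add: form_outside[OF assms])
qed

lemma form_Cons_add:
  assumes "\<alpha> \<in> forms A k" "X \<in> VF" "Y \<in> VF"
  shows "\<alpha> (vf_add X Y # Xs) p = \<alpha> (X # Xs) p + \<alpha> (Y # Xs) p"
proof (cases "X # Xs \<in> form_args A k")
  case True
  then show ?thesis using form_add[OF assms(1) True _ assms(2,3), of 0 p] by auto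
next
  case False
  then show ?thesis using assms by (simp add: form_outside[OF assms(1)] vf_add_in)
qed

lemma form_Cons_scale:
  assumes "\<alpha> \<in> forms A k" "X \<in> VF" "f \<in> A"
  shows "\<alpha> (vf_scale f X # Xs) p = f p * \<alpha> (X # Xs) p"
proof (cases "X # Xs \<in> form_args A k")
  case True
  then show ?thesis using form_scale[OF assms(1) True _ assms(2,3), of 0 p] by auto
next
  case False
  then show ?thesis using assms by (simp add: form_outside[OF assms(1)] vf_scale_in)
qed

lemma form_Cons_cscale:
  assumes "\<alpha> \<in> forms A k" "X \<in> VF"
  shows "\<alpha> ((\<lambda>h p. c * X h p) # Xs) p = c * \<alpha> (X # Xs) p"
  using form_Cons_scale[OF assms const_in] assms
  by (simp add: vf_cscale_eq const_mult form_in[OF assms(1)])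

lemma form_Cons_sum:
  assumes "\<alpha> \<in> forms A k" "\<And>i. i \<in> I \<Longrightarrow> X i \<in> VF"
  shows "\<alpha> ((\<lambda>h p. \<Sum>i\<in>I. X i h p) # Xs) p = (\<Sum>i\<in>I. \<alpha> (X i # Xs) p)"
  using assms(2)
proof (induction I rule: infinite_finite_induct)
  case (insert x F)
  have "(\<lambda>h p. \<Sum>i\<in>insert x F. X i h p) = vf_add (X x) (\<lambda>h p. \<Sum>i\<in>F. X i h p)"
    using insert by (simp add: vf_add_def)
  then show ?case using insert by (simp add: form_Cons_add[OF assms(1)] vf_sum_in)
qed (auto simp: form_zero_arg[OF assms(1)])

lemma forms_0I: "\<alpha> [] \<in> A \<Longrightarrow> (\<And>Xs. Xs \<noteq> [] \<Longrightarrow> \<alpha> Xs = (\<lambda>p. 0)) \<Longrightarrow> \<alpha> \<in> forms A 0"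
  by (rule forms_I) (auto simp: form_args_def)

lemma forms_1I:
  assumes "\<And>X. X \<in> VF \<Longrightarrow> \<alpha> [X] \<in> A"
    "\<And>Xs. Xs \<notin> form_args A 1 \<Longrightarrow> \<alpha> Xs = (\<lambda>p. 0)"
    "\<And>X Y p. X \<in> VF \<Longrightarrow> Y \<in> VF \<Longrightarrow> \<alpha> [vf_add X Y] p = \<alpha> [X] p + \<alpha> [Y] p"
    "\<And>X f p. X \<in> VF \<Longrightarrow> f \<in> A \<Longrightarrow> \<alpha> [vf_scale f X] p = f p * \<alpha> [X] p"
  shows "\<alpha> \<in> forms A 1"
  using assms by (intro forms_I) (auto simp: form_args_def length_Suc_conv)

lemma contract_forms:
  assumes "\<alpha> \<in> forms A (Suc k)" "X \<in> VF"
  shows "contract X \<alpha> \<in> forms A k"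
proof (rule forms_I)
  fix Xs i Y Z p assume *: "Xs \<in> form_args A k" "i < k" "Y \<in> VF" "Z \<in> VF"
  show "contract X \<alpha> (Xs[i := vf_add Y Z]) p = contract X \<alpha> (Xs[i := Y]) p + contract X \<alpha> (Xs[i := Z]) p"
    using form_add[OF assms(1), of "X # Xs" "Suc i" Y Z p] * assms by simp
next
  fix Xs i Y f p assume *: "Xs \<in> form_args A k" "i < k" "Y \<in> VF" "f \<in> A"
  show "contract X \<alpha> (Xs[i := vf_scale f Y]) p = f p * contract X \<alpha> (Xs[i := Y]) p"
    using form_scale[OF assms(1), of "X # Xs" "Suc i" Y f p] * assms by simp
next
  fix Xs i j p assume *: "Xs \<in> form_args A k" "i < k" "j < k" "i \<noteq> j" "Xs ! i = Xs ! j"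
  show "contract X \<alpha> Xs p = 0"
    using form_alternating[OF assms(1), of "X # Xs" "Suc i" "Suc j" p] * assms by simp
qed (use assms in \<open>auto simp: form_in form_outside\<close>)

lemma contract_forms_0: "\<alpha> \<in> forms A 0 \<Longrightarrow> contract X \<alpha> = zero_form"
  by (auto simp: contract_def zero_form_def form_outside)

lemma contract_forms_pred: "\<alpha> \<in> forms A k \<Longrightarrow> X \<in> VF \<Longrightarrow> contract X \<alpha> \<in> forms A (k - 1)"
  by (cases k) (auto simp: contract_forms contract_forms_0 zero_form_in_forms zero_in)

text \<open>The rule by which forms are recognised recursively. Antisymmetry in the first two arguments is
enough: it carries linearity from the second slot to the first, and it moves a repeated argument
from the first slot to the second, where the alternating property of the contractions applies.\<close>

lemma forms_SucI:
  assumes out: "\<And>Xs. Xs \<notin> form_args A (Suc (Suc k)) \<Longrightarrow> \<alpha> Xs = (\<lambda>p. 0)"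
    and contr: "\<And>X. X \<in> VF \<Longrightarrow> contract X \<alpha> \<in> forms A (Suc k)"
    and anti: "\<And>X Y Ys p. X \<in> VF \<Longrightarrow> Y \<in> VF \<Longrightarrow> Ys \<in> form_args A k \<Longrightarrow> \<alpha> (X # Y # Ys) p = - \<alpha> (Y # X # Ys) p"
  shows "\<alpha> \<in> forms A (Suc (Suc k))"
proof (rule forms_I)
  fix Xs assume "Xs \<in> form_args A (Suc (Suc k))"
  then show "\<alpha> Xs \<in> A" using form_in[OF contr] by (cases Xs) auto
next
  fix Xs i X Y p
  assume *: "Xs \<in> form_args A (Suc (Suc k))" "i < Suc (Suc k)" "X \<in> VF" "Y \<in> VF"
  obtain U V Ys where Xs: "Xs = U # V # Ys" "U \<in> VF" "V \<in> VF" "Ys \<in> form_args A k"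
    by (rule form_args_Suc_SucE[OF *(1)])
  show "\<alpha> (Xs[i := vf_add X Y]) p = \<alpha> (Xs[i := X]) p + \<alpha> (Xs[i := Y]) p"
  proof (cases i)
    case 0
    then show ?thesis
      using form_Cons_add[OF contr[OF \<open>V \<in> VF\<close>] \<open>X \<in> VF\<close> \<open>Y \<in> VF\<close>, of Ys p] Xs *
      by (simp add: anti[of _ V Ys] vf_add_in)
  next
    case (Suc j)
    then show ?thesis using form_add[OF contr[OF \<open>U \<in> VF\<close>], of "V # Ys" j X Y p] Xs * by simp
  qed
next
  fix Xs i X f p
  assume *: "Xs \<in> form_args A (Suc (Suc k))" "i < Suc (Suc k)" "X \<in> VF" "f \<in> A"
  obtain U V Ys where Xs: "Xs = U # V # Ys" "U \<in> VF" "V \<in> VF" "Ys \<in> form_args A k"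
    by (rule form_args_Suc_SucE[OF *(1)])
  show "\<alpha> (Xs[i := vf_scale f X]) p = f p * \<alpha> (Xs[i := X]) p"
  proof (cases i)
    case 0
    then show ?thesis
      using form_Cons_scale[OF contr[OF \<open>V \<in> VF\<close>] \<open>X \<in> VF\<close> \<open>f \<in> A\<close>, of Ys p] Xs *
      by (simp add: anti[of _ V Ys] vf_scale_in)
  next
    case (Suc j)
    then show ?thesis using form_scale[OF contr[OF \<open>U \<in> VF\<close>], of "V # Ys" j X f p] Xs * by simp
  qed
next
  have *: "\<alpha> Xs p = 0"
    if "Xs \<in> form_args A (Suc (Suc k))" "i < j" "j < Suc (Suc k)" "Xs ! i = Xs ! j" for Xs i j p
  proof -
    note args = that(1)
    obtain U V Ys where Xs: "Xs = U # V # Ys" "U \<in> VF" "V \<in> VF" "Ys \<in> form_args A k"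
      by (rule form_args_Suc_SucE[OF args])
    show ?thesis
    proof (cases i)
      case (Suc i')
      then show ?thesis
        using form_alternating[OF contr[OF \<open>U \<in> VF\<close>], of "V # Ys" i' "j - 1" p] that Xs
        by (cases j) auto
    next
      case i: 0
      show ?thesis
      proof (cases "j = 1")
        case True
        then show ?thesis using anti[of U V Ys p] that Xs i by simp
      next
        case False
        then have "Suc (Suc (j - 2)) = j" using \<open>i < j\<close> i by simp
        then obtain j' where j: "j = Suc (Suc j')" by metis
        then have "\<alpha> (V # U # Ys) p = 0"
          using form_alternating[OF contr[OF \<open>V \<in> VF\<close>], of "U # Ys" 0 "Suc j'" p] that Xs i by auto
        then show ?thesis using anti[of U V Ys p] Xs by simp
      qed
    qed
  qed
  fix Xs i j p
  assume "Xs \<in> form_args A (Suc (Suc k))" "i < Suc (Suc k)" "j < Suc (Suc k)" "i \<noteq> j" "Xs ! i = Xs ! j"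
  then show "\<alpha> Xs p = 0" using *[of Xs i j p] *[of Xs j i p] by (cases "i < j") auto
qed (rule out)

lemma forms_add: "\<alpha> \<in> forms A k \<Longrightarrow> \<beta> \<in> forms A k \<Longrightarrow> (\<lambda>Xs p. \<alpha> Xs p + \<beta> Xs p) \<in> forms A k"
  by (rule forms_I)
    (auto simp: form_in form_outside add_in form_add form_scale form_alternating algebra_simps)

lemma forms_uminus: "\<alpha> \<in> forms A k \<Longrightarrow> (\<lambda>Xs p. - \<alpha> Xs p) \<in> forms A k"
  by (rule forms_I)
    (auto simp: form_in form_outside uminus_in form_add form_scale form_alternating algebra_simps)

lemma forms_diff: "\<alpha> \<in> forms A k \<Longrightarrow> \<beta> \<in> forms A k \<Longrightarrow> (\<lambda>Xs p. \<alpha> Xs p - \<beta> Xs p) \<in> forms A k"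
  using forms_add[of \<alpha> k "\<lambda>Xs p. - \<beta> Xs p"] forms_uminus by simp

lemma forms_sum: "(\<And>i. i \<in> I \<Longrightarrow> \<alpha> i \<in> forms A k) \<Longrightarrow> (\<lambda>Xs p. \<Sum>i\<in>I. \<alpha> i Xs p) \<in> forms A k"
proof (induction I rule: infinite_finite_induct)
  case (insert x F)
  then show ?case using forms_add[of "\<alpha> x" k "\<lambda>Xs p. \<Sum>i\<in>F. \<alpha> i Xs p"] by simp
qed (use zero_form_in_forms[OF zero_in] in \<open>auto simp: zero_form_def\<close>)

end

section \<open>The exterior derivative\<close>

text \<open>The Lie derivative of \<open>\<alpha>\<close> along \<open>X\<close>, evaluated on a list of fields. The recursion expresses
that contraction with \<open>Y\<close> commutes with it up to contraction with \<open>[X, Y]\<close>, and makes an explicit sum over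
the slots unnecessary. The list precedes the form because the form changes in the recursion.\<close>

primrec lie_derivative :: "'m func set \<Rightarrow> 'm vf \<Rightarrow> 'm vf list \<Rightarrow> 'm form \<Rightarrow> 'm func" where
  "lie_derivative A X [] \<alpha> = X (\<alpha> [])"
| "lie_derivative A X (Y # Ys) \<alpha> =
     (\<lambda>p. if Y \<in> vector_fields A
           then lie_derivative A X Ys (contract Y \<alpha>) p - \<alpha> (vf_bracket X Y # Ys) p else 0)"

lemma omit_0 [simp]: "omit 0 (X # Xs) = Xs"
  by (simp add: omit_def)

lemma omit_Suc [simp]: "omit (Suc i) (X # Xs) = X # omit i Xs"
  by (simp add: omit_def)

lemma length_omit: "i < length Xs \<Longrightarrow> length (omit i Xs) = length Xs - 1"
  by (simp add: omit_def)

context function_algebra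
begin

lemma lie_derivative_in: "\<alpha> \<in> forms A k \<Longrightarrow> X \<in> VF \<Longrightarrow> lie_derivative A X Xs \<alpha> \<in> A"
proof (induction Xs arbitrary: \<alpha> k)
  case (Cons Y Ys)
  then have "(\<lambda>p. lie_derivative A X Ys (contract Y \<alpha>) p - \<alpha> (vf_bracket X Y # Ys) p) \<in> A" if "Y \<in> VF"
    using that by (intro diff_in Cons.IH[of _ "k - 1"] contract_forms_pred form_in[of _ k])
  then show ?case by (cases "Y \<in> VF") (simp_all add: zero_in)
qed (auto simp: VF_in)

lemma lie_derivative_uminus:
  "\<alpha> \<in> forms A k \<Longrightarrow> X \<in> VF
    \<Longrightarrow> lie_derivative A X Xs (\<lambda>Ys p. - \<alpha> Ys p) p = - lie_derivative A X Xs \<alpha> p"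
proof (induction Xs arbitrary: \<alpha> k)
  case (Cons Y Ys)
  then show ?case
    using contract_forms_pred[of \<alpha> k Y] by (auto simp: contract_def)
qed (auto simp: VF_uminus form_in)

lemma lie_derivative_outside:
  "\<alpha> \<in> forms A k \<Longrightarrow> X \<in> VF \<Longrightarrow> Xs \<notin> form_args A k \<Longrightarrow> lie_derivative A X Xs \<alpha> p = 0"
proof (induction Xs arbitrary: \<alpha> k)
  case Nil
  then show ?case by (simp add: form_outside VF_zero)
next
  case (Cons Y Ys)
  show ?case
  proof (cases "Y \<in> VF")
    case True
    have "lie_derivative A X Ys (contract Y \<alpha>) p = 0"
    proof (cases k)
      case (Suc l)
      then have "Ys \<notin> form_args A l" using Cons.prems True by simp
      then show ?thesis
        using Cons.prems Suc True by (intro Cons.IH[of _ l] contract_forms) auto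
    next
      case 0
      then have "contract Y \<alpha> = zero_form" using Cons by (simp add: contract_forms_0)
      then have "lie_derivative A X Ys (contract Y \<alpha>) p = lie_derivative A X Ys (\<lambda>Xs p. - contract Y \<alpha> Xs p) p"
        by (simp add: zero_form_def)
      then show ?thesis
        using lie_derivative_uminus[OF contract_forms_pred[OF Cons.prems(1) True] Cons.prems(2), of Ys p] by simp
    qed
    moreover have "vf_bracket X Y # Ys \<notin> form_args A k"
      using Cons.prems True by auto
    ultimately show ?thesis by (simp add: form_outside[OF Cons.prems(1)])
  qed simp
qed

lemma lie_derivative_forms:
  "\<alpha> \<in> forms A k \<Longrightarrow> X \<in> VF \<Longrightarrow> (\<lambda>Xs. lie_derivative A X Xs \<alpha>) \<in> forms A k"
proof (induction k arbitrary: \<alpha> rule: induct_nat_012)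
  case 0
  then show ?case
    using lie_derivative_outside[OF 0] by (intro forms_0I) (auto simp: VF_in fun_eq_iff form_args_def)
next
  case 1
  then have \<alpha>: "\<alpha> \<in> forms A (Suc 0)" by simp
  have br_add: "vf_bracket X (vf_add Y Z) = vf_add (vf_bracket X Y) (vf_bracket X Z)" if "Y \<in> VF" "Z \<in> VF" for Y Z
    using that 1 by (auto simp: vf_bracket_def vf_add_def VF_in VF_add fun_eq_iff)
  have br_scale: "vf_bracket X (vf_scale f Y) = vf_add (vf_scale f (vf_bracket X Y)) (vf_scale (X f) Y)"
    if "Y \<in> VF" "f \<in> A" for Y f
    using that 1 by (auto simp: vf_bracket_def vf_add_def vf_scale_def VF_in VF_mult fun_eq_iff algebra_simps)
  have arg_add: "\<alpha> [vf_add Y Z] = (\<lambda>p. \<alpha> [Y] p + \<alpha> [Z] p)" if "Y \<in> VF" "Z \<in> VF" for Y Z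
    using form_Cons_add[OF \<alpha> that] by auto
  have arg_scale: "\<alpha> [vf_scale f Y] = (\<lambda>p. f p * \<alpha> [Y] p)" if "Y \<in> VF" "f \<in> A" for f Y
    using form_Cons_scale[OF \<alpha> that] by auto
  have "(\<lambda>Xs. lie_derivative A X Xs \<alpha>) \<in> forms A 1"
  proof (rule forms_1I)
    show "lie_derivative A X [Y] \<alpha> \<in> A" for Y
      using lie_derivative_in[OF \<alpha>] 1 by blast
    show "lie_derivative A X Xs \<alpha> = (\<lambda>p. 0)" if "Xs \<notin> form_args A 1" for Xs
      using lie_derivative_outside[OF \<alpha>, of X Xs] 1 that by auto
    show "lie_derivative A X [vf_add Y Z] \<alpha> p = lie_derivative A X [Y] \<alpha> p + lie_derivative A X [Z] \<alpha> p"
      if "Y \<in> VF" "Z \<in> VF" for Y Z p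
      using that 1
      by (simp add: br_add arg_add vf_add_in vf_bracket_in VF_add[of X "\<alpha> [Y]" "\<alpha> [Z]"] form_in[OF \<alpha>])
    show "lie_derivative A X [vf_scale f Y] \<alpha> p = f p * lie_derivative A X [Y] \<alpha> p"
      if "Y \<in> VF" "f \<in> A" for Y f p
      using that 1
      by (simp add: br_scale arg_add arg_scale vf_scale_in vf_bracket_in VF_in VF_mult[of X f "\<alpha> [Y]"] form_in[OF \<alpha>]
          algebra_simps)
  qed
  then show ?case by simp
next
  case (ge2 k)
  show ?case
  proof (rule forms_SucI)
    fix Y assume Y: "Y \<in> VF"
    have "contract Y (\<lambda>Xs. lie_derivative A X Xs \<alpha>)
        = (\<lambda>Xs p. lie_derivative A X Xs (contract Y \<alpha>) p - contract (vf_bracket X Y) \<alpha> Xs p)"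
      using Y by (simp add: contract_def)
    also have "\<dots> \<in> forms A (Suc k)"
      by (intro forms_diff ge2.IH(2) contract_forms vf_bracket_in ge2.prems Y)
    finally show "contract Y (\<lambda>Xs. lie_derivative A X Xs \<alpha>) \<in> forms A (Suc k)" .
  next
    fix Y Z Ys p assume *: "Y \<in> VF" "Z \<in> VF" "Ys \<in> form_args A k"
    have "contract Z (contract Y \<alpha>) = (\<lambda>Xs p. - contract Y (contract Z \<alpha>) Xs p)"
      by (intro ext) (simp add: form_swap_first[OF ge2.prems(1), of Y Z])
    then show "lie_derivative A X (Y # Z # Ys) \<alpha> p = - lie_derivative A X (Z # Y # Ys) \<alpha> p"
      using lie_derivative_uminus[OF contract_forms[OF contract_forms[OF ge2.prems(1) *(2)] *(1)] ge2.prems(2), of Ys p]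
        form_swap_first[OF ge2.prems(1), of Y "vf_bracket X Z" Ys p]
        form_swap_first[OF ge2.prems(1), of Z "vf_bracket X Y" Ys p] *
      by simp
  qed (use lie_derivative_outside[OF ge2.prems] in \<open>simp add: fun_eq_iff\<close>)
qed

text \<open>Moving each bracket to the front costs the sign \<open>(- 1)\<^sup>j\<close>; in this shape the Lie derivative occurs
inside the exterior derivative.\<close>

lemma lie_derivative_omit:
  "\<alpha> \<in> forms A k \<Longrightarrow> X \<in> VF \<Longrightarrow> set Xs \<subseteq> VF
    \<Longrightarrow> lie_derivative A X Xs \<alpha> p
        = X (\<alpha> Xs) p - (\<Sum>j<length Xs. (- 1) ^ j * \<alpha> (vf_bracket X (Xs ! j) # omit j Xs) p)"
proof (induction Xs arbitrary: \<alpha> k)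
  case (Cons Y Ys)
  have IH: "lie_derivative A X Ys (contract Y \<alpha>) p
      = X (\<alpha> (Y # Ys)) p - (\<Sum>j<length Ys. (- 1) ^ j * \<alpha> (Y # vf_bracket X (Ys ! j) # omit j Ys) p)"
    using Cons.IH[OF contract_forms_pred[OF Cons.prems(1), of Y]] Cons.prems by (simp add: contract_def)
  show ?case
    using Cons.prems(3)
    by (simp add: IH sum.lessThan_Suc_shift sum_negf del: sum.lessThan_Suc
        add: form_swap_first[OF Cons.prems(1), of Y])
qed auto

text \<open>Cartan's formula \<open>\<iota>(X) d = L(X) - d \<iota>(X)\<close>, read as a recursion on the arguments: the terms of the
invariant formula that involve the first argument make up the Lie derivative, and the others are
those of the contraction, with the opposite sign.\<close>

lemma ext_d_Cons:
  assumes \<alpha>: "\<alpha> \<in> forms A k" and X: "X \<in> VF" and Xs: "set Xs \<subseteq> VF"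
  shows "ext_d A \<alpha> (X # Xs) p = lie_derivative A X Xs \<alpha> p - ext_d A (contract X \<alpha>) Xs p"
proof -
  have "(\<Sum>j<length (X # Xs). \<Sum>i<j. (- 1) ^ (i + j) *
            \<alpha> (vf_bracket ((X # Xs) ! i) ((X # Xs) ! j) # omit i (omit j (X # Xs))) p)
      = (\<Sum>j<length Xs. - ((- 1) ^ j * \<alpha> (vf_bracket X (Xs ! j) # omit j Xs) p)
          + (\<Sum>i<j. (- 1) ^ (i + j) * \<alpha> (vf_bracket (Xs ! i) (Xs ! j) # X # omit i (omit j Xs)) p))"
    by (simp add: sum.lessThan_Suc_shift del: sum.lessThan_Suc)
  also have "\<dots> = - (\<Sum>j<length Xs. (- 1) ^ j * \<alpha> (vf_bracket X (Xs ! j) # omit j Xs) p)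
          - (\<Sum>j<length Xs. \<Sum>i<j. (- 1) ^ (i + j) * \<alpha> (X # vf_bracket (Xs ! i) (Xs ! j) # omit i (omit j Xs)) p)"
    by (simp add: sum.distrib sum_negf sum_subtractf form_swap_first[OF \<alpha>, of _ X])
  finally show ?thesis
    using X Xs lie_derivative_omit[OF \<alpha> X Xs, of p]
    by (simp add: ext_d_def sum.lessThan_Suc_shift sum_negf del: sum.lessThan_Suc)
qed

lemma ext_d_uminus: "\<alpha> \<in> forms A k \<Longrightarrow> ext_d A (\<lambda>Ys p. - \<alpha> Ys p) Xs p = - ext_d A \<alpha> Xs p"
  by (auto simp: ext_d_def VF_uminus form_in sum_negf subset_iff)

lemma ext_d_outside:
  assumes \<alpha>: "\<alpha> \<in> forms A k" and Xs: "Xs \<notin> form_args A (Suc k)"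
  shows "ext_d A \<alpha> Xs = (\<lambda>p. 0)"
proof (cases "set Xs \<subseteq> VF")
  case True
  then have len: "length Xs \<noteq> Suc k" using Xs by (auto simp: form_args_def)
  have 1: "\<alpha> (omit i Xs) = (\<lambda>p. 0)" if "i < length Xs" for i
    using that len by (intro form_outside[OF \<alpha>]) (auto simp: form_args_def length_omit)
  have 2: "\<alpha> (U # omit i (omit j Xs)) = (\<lambda>p. 0)" if "j < length Xs" "i < j" for U i j
    using that len by (intro form_outside[OF \<alpha>]) (auto simp: form_args_def length_omit)
  show ?thesis
    using True by (auto simp: ext_d_def fun_eq_iff 1 2 VF_zero subset_iff)
qed (simp add: ext_d_def)

text \<open>By Cartan's formula the contractions of \<open>d\<alpha>\<close> are forms. Antisymmetry in the first two arguments
follows from applying the formula twice: the Lie derivatives along \<open>X\<close> and \<open>Y\<close> cancel in pairs, and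
what remains is antisymmetric since \<open>[Y, X] = - [X, Y]\<close> and contractions anticommute.\<close>

lemma ext_d_forms: "\<alpha> \<in> forms A k \<Longrightarrow> ext_d A \<alpha> \<in> forms A (Suc k)"
proof (induction k arbitrary: \<alpha>)
  case 0
  have "ext_d A \<alpha> \<in> forms A 1"
    by (rule forms_1I)
      (use 0 ext_d_outside[OF 0] in \<open>auto simp: fun_eq_iff ext_d_def VF_in vf_add_in vf_scale_in\<close>,
       auto simp: vf_add_def vf_scale_def)
  then show ?case by simp
next
  case (Suc k)
  have eq: "contract X (ext_d A \<alpha>) = (\<lambda>Xs p. lie_derivative A X Xs \<alpha> p - ext_d A (contract X \<alpha>) Xs p)"
    if X: "X \<in> VF" for X
  proof (intro ext)
    fix Xs p
    show "contract X (ext_d A \<alpha>) Xs p = lie_derivative A X Xs \<alpha> p - ext_d A (contract X \<alpha>) Xs p"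
    proof (cases "Xs \<in> form_args A (Suc k)")
      case True
      then show ?thesis using ext_d_Cons[OF Suc.prems X, of Xs p] by (simp add: form_args_def)
    next
      case False
      then show ?thesis
        using ext_d_outside[OF Suc.prems, of "X # Xs"] ext_d_outside[OF contract_forms[OF Suc.prems X] False]
          lie_derivative_outside[OF Suc.prems X False] by simp
    qed
  qed
  show ?case
  proof (rule forms_SucI)
    fix X assume X: "X \<in> VF"
    then show "contract X (ext_d A \<alpha>) \<in> forms A (Suc k)"
      unfolding eq[OF X] by (intro forms_diff lie_derivative_forms Suc contract_forms)
  next
    fix X Y Ys p assume *: "X \<in> VF" "Y \<in> VF" "Ys \<in> form_args A k"
    then have Ys: "set Ys \<subseteq> VF" by (simp add: form_args_def)
    have contr: "contract X \<alpha> \<in> forms A k" "contract Y \<alpha> \<in> forms A k"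
      using Suc.prems * contract_forms by auto
    have swap: "contract Y (contract X \<alpha>) = (\<lambda>Xs p. - contract X (contract Y \<alpha>) Xs p)"
      by (intro ext) (simp add: form_swap_first[OF Suc.prems, of X Y])
    have "\<alpha> (vf_bracket Y X # Ys) p = - \<alpha> (vf_bracket X Y # Ys) p"
      using form_Cons_cscale[OF Suc.prems vf_bracket_in[OF *(1,2)], of "- 1" Ys p]
      by (simp add: vf_bracket_def)
    moreover have "ext_d A \<alpha> (U # V # Ys) p
        = lie_derivative A U Ys (contract V \<alpha>) p - \<alpha> (vf_bracket U V # Ys) p
          - lie_derivative A V Ys (contract U \<alpha>) p + ext_d A (contract V (contract U \<alpha>)) Ys p"
      if "U \<in> VF" "V \<in> VF" for U V
      using that Ys by (simp add: ext_d_Cons[OF Suc.prems] ext_d_Cons[OF contract_forms[OF Suc.prems]])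
    moreover have "ext_d A (contract Y (contract X \<alpha>)) Ys p = - ext_d A (contract X (contract Y \<alpha>)) Ys p"
      unfolding swap by (rule ext_d_uminus[OF contract_forms_pred[OF contr(2) *(1)]])
    ultimately show "ext_d A \<alpha> (X # Y # Ys) p = - ext_d A \<alpha> (Y # X # Ys) p"
      using * by simp
  qed (rule ext_d_outside[OF Suc.prems])
qed

end

section \<open>Exterior algebra of cochains\<close>

(* Contractions of cochains are mostly unevaluated factors of products, so they stay folded. *)
declare contract_apply [simp del]

type_synonym 'v cochain = "'v list \<Rightarrow> complex"

text \<open>The grading automorphism: the sign \<open>(- 1)\<^sup>k\<close> that an element picks up when it passes a cochain of
degree \<open>k\<close>. It allows cochains of mixed degree to be multiplied.\<close>

definition alternate :: "'v cochain \<Rightarrow> 'v cochain" where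
  "alternate a = (\<lambda>I. (- 1) ^ length I * a I)"

text \<open>The exterior product as a signed shuffle product. It is characterised by contraction being an
antiderivation; this is the recursion. On alternating cochains it is
the wedge product.\<close>

fun ext_prod :: "'v cochain \<Rightarrow> 'v cochain \<Rightarrow> 'v cochain" (infixr "\<odot>" 70) where
  "(a \<odot> b) [] = a [] * b []"
| "(a \<odot> b) (v # I) = (contract v a \<odot> b) I + (alternate a \<odot> contract v b) I"

lemma contract_ext_prod:
  "contract v (a \<odot> b) = (\<lambda>I. (contract v a \<odot> b) I + (alternate a \<odot> contract v b) I)"
  by (simp add: contract_def)

lemma contract_alternate: "contract v (alternate a) = (\<lambda>I. - alternate (contract v a) I)"
  by (simp add: contract_def alternate_def)

lemma ext_prod_add_left: "((\<lambda>I. a I + a' I) \<odot> b) I = (a \<odot> b) I + (a' \<odot> b) I"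
proof (induction I arbitrary: a a' b)
  case (Cons v I)
  have "contract v (\<lambda>I. a I + a' I) = (\<lambda>I. contract v a I + contract v a' I)"
    "alternate (\<lambda>I. a I + a' I) = (\<lambda>I. alternate a I + alternate a' I)"
    by (auto simp: alternate_def contract_apply algebra_simps)
  then show ?case by (simp only: ext_prod.simps Cons.IH) simp
qed (simp add: algebra_simps)

lemma ext_prod_add_right: "(a \<odot> (\<lambda>I. b I + b' I)) I = (a \<odot> b) I + (a \<odot> b') I"
proof (induction I arbitrary: a b b')
  case (Cons v I)
  have "contract v (\<lambda>I. b I + b' I) = (\<lambda>I. contract v b I + contract v b' I)" by (auto simp: contract_apply)
  then show ?case by (simp only: ext_prod.simps Cons.IH) simp
qed (simp add: algebra_simps)

lemma ext_prod_scale_left: "((\<lambda>I. c * a I) \<odot> b) I = c * (a \<odot> b) I"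
proof (induction I arbitrary: a b)
  case (Cons v I)
  have "contract v (\<lambda>I. c * a I) = (\<lambda>I. c * contract v a I)"
    "alternate (\<lambda>I. c * a I) = (\<lambda>I. c * alternate a I)"
    by (auto simp: alternate_def contract_apply algebra_simps)
  then show ?case by (simp only: ext_prod.simps Cons.IH) (simp add: algebra_simps)
qed simp

lemma ext_prod_scale_right: "(a \<odot> (\<lambda>I. c * b I)) I = c * (a \<odot> b) I"
proof (induction I arbitrary: a b)
  case (Cons v I)
  have "contract v (\<lambda>I. c * b I) = (\<lambda>I. c * contract v b I)" by (auto simp: contract_apply)
  then show ?case by (simp only: ext_prod.simps Cons.IH) (simp add: algebra_simps)
qed simp

lemmas ext_prod_zero_left = ext_prod_scale_left[of 0, simplified]
  and ext_prod_zero_right = ext_prod_scale_right[of _ 0, simplified]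
  and ext_prod_uminus_left = ext_prod_scale_left[of "- 1", simplified]
  and ext_prod_uminus_right = ext_prod_scale_right[of _ "- 1", simplified]

lemma alternate_ext_prod: "alternate (a \<odot> b) = alternate a \<odot> alternate b"
proof
  show "alternate (a \<odot> b) I = (alternate a \<odot> alternate b) I" for I
  proof (induction I arbitrary: a b)
    case Nil
    then show ?case by (simp add: alternate_def)
  next
    case (Cons v I)
    have "alternate (a \<odot> b) (v # I) = - alternate (contract v a \<odot> b) I - alternate (alternate a \<odot> contract v b) I"
      by (simp add: alternate_def algebra_simps)
    then show ?case
      by (simp add: Cons contract_alternate ext_prod_uminus_left ext_prod_uminus_right)
  qed
qed

text \<open>Both sides satisfy the same recursion, since contraction is an antiderivation and
\<open>alternate\<close> is multiplicative.\<close>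

lemma ext_prod_assoc: "(a \<odot> b) \<odot> c = a \<odot> b \<odot> c"
proof
  show "((a \<odot> b) \<odot> c) I = (a \<odot> b \<odot> c) I" for I
    by (induction I arbitrary: a b c)
      (simp_all add: contract_ext_prod alternate_ext_prod ext_prod_add_left ext_prod_add_right)
qed

lemma ext_prod_supported_Nil_left:
  assumes "\<And>v I. a (v # I) = 0"
  shows "(a \<odot> b) I = a [] * b I"
proof (induction I arbitrary: b)
  case (Cons v I)
  have "contract v a = (\<lambda>I. 0)" "alternate a = a"
    using assms by (auto simp: alternate_def contract_apply fun_eq_iff neq_Nil_conv) (metis list.exhaust list.size(3) mult_cancel_right2 power_0)
  then show ?case by (simp add: ext_prod_zero_left Cons contract_apply)
qed simp

lemma ext_prod_supported_Nil_right:
  assumes "\<And>v I. b (v # I) = 0"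
  shows "(a \<odot> b) I = a I * b []"
proof (induction I arbitrary: a)
  case (Cons v I)
  have "contract v b = (\<lambda>I. 0)" using assms by (auto simp: contract_apply)
  then show ?case by (simp add: ext_prod_zero_right Cons contract_apply)
qed simp

text \<open>An index \<open>(True, j)\<close> stands for the frame field \<open>Z\<^sub>j\<close> and \<open>(False, j)\<close> for its conjugate.\<close>

type_synonym index = "bool \<times> nat"

text \<open>The number \<open>p\<close> in the bidegree \<open>(p, q)\<close> of a list of indices. It is an integer so that contracting
an element of degree \<open>p = 0\<close> with a holomorphic index needs no special treatment: degree \<open>- 1\<close> is empty.\<close>

primrec holo_degree :: "index list \<Rightarrow> int" where
  "holo_degree [] = 0"
| "holo_degree (v # I) = of_bool (fst v) + holo_degree I"

definition restrict_degree :: "int \<Rightarrow> index cochain \<Rightarrow> index cochain" where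
  "restrict_degree p a = (\<lambda>I. if holo_degree I = p then a I else 0)"

lemma restrict_degree_apply: "restrict_degree p a I = (if holo_degree I = p then a I else 0)"
  by (simp add: restrict_degree_def)

lemma contract_restrict_degree:
  "contract v (restrict_degree p a) = restrict_degree (p - of_bool (fst v)) (contract v a)"
  by (auto simp: restrict_degree_def contract_def algebra_simps)

lemma alternate_restrict_degree: "alternate (restrict_degree p a) = restrict_degree p (alternate a)"
  by (auto simp: restrict_degree_def alternate_def)

lemma restrict_degree_idem: "restrict_degree p (restrict_degree p a) = restrict_degree p a"
  by (auto simp: restrict_degree_def)

text \<open>In a shuffle of \<open>I\<close> the degrees of the two parts add up to that of \<open>I\<close>, so prescribing one of
them prescribes the other.\<close>

lemma ext_prod_restrict_swap:
  "holo_degree I = p + q \<Longrightarrow> (restrict_degree p a \<odot> b) I = (a \<odot> restrict_degree q b) I"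
proof (induction I arbitrary: a b p q)
  case (Cons v I)
  show ?case
    using Cons.prems Cons.IH[of "p - of_bool (fst v)" q "contract v a" b]
      Cons.IH[of p "q - of_bool (fst v)" "alternate a" "contract v b"]
    by (simp add: contract_restrict_degree alternate_restrict_degree)
qed (auto simp: restrict_degree_def)

lemma ext_prod_restrict_zero:
  "holo_degree I \<noteq> p + q \<Longrightarrow> (restrict_degree p a \<odot> restrict_degree q b) I = 0"
proof (induction I arbitrary: a b p q)
  case (Cons v I)
  show ?case
    using Cons.prems Cons.IH[of "p - of_bool (fst v)" q "contract v a" b]
      Cons.IH[of p "q - of_bool (fst v)" "alternate a" "contract v b"]
    by (simp add: contract_restrict_degree alternate_restrict_degree)
qed (auto simp: restrict_degree_def)

lemma restrict_degree_ext_prod: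
  "restrict_degree (p + q) (a \<odot> restrict_degree q b) = restrict_degree (p + q) (restrict_degree p a \<odot> b)"
  by (auto simp: restrict_degree_def[of "p + q"] ext_prod_restrict_swap)

section \<open>Wedge products and types\<close>

text \<open>Changing one entry of a list changes at most one entry of a segment of the permuted list; this makes
each summand of a wedge product linear in each argument.\<close>

lemma map_nth_permuted_update:
  assumes "\<sigma> permutes {..<length Xs}" "m < length Xs"
  shows "map (\<lambda>i. Xs[m := W] ! \<sigma> i) [a..<b] =
    (if a \<le> inv_into UNIV \<sigma> m \<and> inv_into UNIV \<sigma> m < b then (map (\<lambda>i. Xs ! \<sigma> i) [a..<b])[inv_into UNIV \<sigma> m - a := W]
     else map (\<lambda>i. Xs ! \<sigma> i) [a..<b])"
proof -
  define j where "j = inv_into UNIV \<sigma> m"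
  have j: "m = \<sigma> i \<longleftrightarrow> i = j" for i
    unfolding j_def using permutes_inverses[OF assms(1)] by metis
  show ?thesis
    unfolding j_def[symmetric] using assms(2)
    by (auto intro!: nth_equalityI simp: nth_list_update j)
qed

lemma map_nth_update:
  assumes "m < k" "length Xs = k"
  shows "map (\<lambda>i. f i (Xs[m := W] ! i)) [0..<k] = (map (\<lambda>i. f i (Xs ! i)) [0..<k])[m := f m W]"
  using assms by (auto intro!: nth_equalityI simp: nth_list_update)

context function_algebra
begin

text \<open>Each summand is linear in each argument, since every argument occurs in exactly one factor. If two
arguments agree, composing with their transposition preserves the summands but for the sign of the
permutation, so the sum is its own negative.\<close>

lemma wedge_forms:
  assumes \<alpha>: "\<alpha> \<in> forms A k" and \<beta>: "\<beta> \<in> forms A l"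
  shows "wedge k l \<alpha> \<beta> \<in> forms A (k + l)"
proof -
  let ?N = "k + l"
  let ?L = "\<lambda>\<sigma> Xs. map (\<lambda>i. Xs ! \<sigma> i) [0..<k]" and ?R = "\<lambda>\<sigma> Xs. map (\<lambda>i. Xs ! \<sigma> i) [k..<k + l]"
  define t where "t \<sigma> Xs p = \<alpha> (?L \<sigma> Xs) p * \<beta> (?R \<sigma> Xs) p" for \<sigma> Xs p
  define w where "w Xs p = (\<Sum>\<sigma> | \<sigma> permutes {..<?N}. of_int (sign \<sigma>) * t \<sigma> Xs p)" for Xs p
  have wedge: "wedge k l \<alpha> \<beta> Xs p = w Xs p / (fact k * fact l)" if "length Xs = ?N" for Xs p
    using that by (simp add: wedge_def w_def t_def mult.assoc)
  have inv_less: "inv_into UNIV \<sigma> m < ?N" if "\<sigma> permutes {..<?N}" "m < ?N" for \<sigma> m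
    using permutes_in_image[OF permutes_inv[OF that(1)], of m] that by simp
  have args: "?L \<sigma> Xs \<in> form_args A k" "?R \<sigma> Xs \<in> form_args A l"
    if "Xs \<in> form_args A ?N" "\<sigma> permutes {..<?N}" for \<sigma> Xs
  proof -
    have "\<sigma> i < ?N" if "i < ?N" for i
      using permutes_in_image[OF \<open>\<sigma> permutes _\<close>, of i] that by simp
    then show "?L \<sigma> Xs \<in> form_args A k" "?R \<sigma> Xs \<in> form_args A l"
      using form_args_nth[OF that(1)] by (auto simp: form_args_def)
  qed
  \<comment> \<open>An argument enters through only one of the two factors, at position \<open>j\<close>; the other factor is \<open>c\<close>.\<close>
  have update: "\<exists>c. \<exists>\<gamma> j r Ys. (\<gamma> = \<alpha> \<and> r = k \<or> \<gamma> = \<beta> \<and> r = l) \<and> Ys \<in> form_args A r \<and> j < r \<and>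
      (\<forall>W. t \<sigma> (Xs[m := W]) p = c * \<gamma> (Ys[j := W]) p)"
    if "Xs \<in> form_args A ?N" "\<sigma> permutes {..<?N}" "m < ?N" for \<sigma> Xs m p
  proof -
    have len: "length Xs = ?N" using that(1) by (simp add: form_args_def)
    note upd = map_nth_permuted_update[of \<sigma> Xs m, unfolded len, OF that(2,3)]
    show ?thesis
    proof (cases "inv_into UNIV \<sigma> m < k")
      case True
      then show ?thesis
        using args[OF that(1,2)]
        by (intro exI[of _ "\<beta> (?R \<sigma> Xs) p"] exI[of _ \<alpha>] exI[of _ "inv_into UNIV \<sigma> m"] exI[of _ k] exI[of _ "?L \<sigma> Xs"])
          (auto simp: t_def upd)
    next
      case False
      then show ?thesis
        using args[OF that(1,2)] inv_less[OF that(2,3)]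
        by (intro exI[of _ "\<alpha> (?L \<sigma> Xs) p"] exI[of _ \<beta>] exI[of _ "inv_into UNIV \<sigma> m - k"] exI[of _ l] exI[of _ "?R \<sigma> Xs"])
          (auto simp: t_def upd)
    qed
  qed
  show ?thesis
  proof (rule forms_I)
    fix Xs assume Xs: "Xs \<in> form_args A ?N"
    have "(\<lambda>p. (1 / (fact k * fact l)) * (\<Sum>\<sigma> | \<sigma> permutes {..<?N}.
        of_int (sign \<sigma>) * (\<alpha> (?L \<sigma> Xs) p * \<beta> (?R \<sigma> Xs) p))) \<in> A"
      by (intro scale_in sum_in mult_in form_in[OF \<alpha>] form_in[OF \<beta>])
    moreover have "wedge k l \<alpha> \<beta> Xs = (\<lambda>p. (1 / (fact k * fact l)) * (\<Sum>\<sigma> | \<sigma> permutes {..<?N}.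
        of_int (sign \<sigma>) * (\<alpha> (?L \<sigma> Xs) p * \<beta> (?R \<sigma> Xs) p)))"
      using Xs by (intro ext) (simp add: form_args_def wedge w_def t_def)
    ultimately show "wedge k l \<alpha> \<beta> Xs \<in> A" by simp
  next
    fix Xs assume Xs: "Xs \<notin> form_args A ?N"
    show "wedge k l \<alpha> \<beta> Xs = (\<lambda>p. 0)"
    proof (cases "length Xs = ?N")
      case True
      then have "\<not> set Xs \<subseteq> VF" using Xs by (simp add: form_args_def)
      then obtain m where m: "m < ?N" "Xs ! m \<notin> VF"
        using True by (metis in_set_conv_nth subsetI)
      have "t \<sigma> Xs p = 0" if \<sigma>: "\<sigma> permutes {..<?N}" for \<sigma> p
      proof -
        let ?i = "inv_into UNIV \<sigma> m"
        have i: "\<sigma> ?i = m" "?i < ?N" using permutes_inverses[OF \<sigma>] inv_less[OF \<sigma> m(1)] by auto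
        show ?thesis
        proof (cases "?i < k")
          case True
          then have "Xs ! m \<in> set (?L \<sigma> Xs)" using i by (auto intro!: image_eqI[of _ _ ?i])
          then have "?L \<sigma> Xs \<notin> form_args A k" using m by (auto simp: form_args_def)
          then show ?thesis by (simp add: t_def form_outside[OF \<alpha>])
        next
          case False
          then have "Xs ! m \<in> set (?R \<sigma> Xs)" using i by (auto intro!: image_eqI[of _ _ ?i])
          then have "?R \<sigma> Xs \<notin> form_args A l" using m by (auto simp: form_args_def)
          then show ?thesis by (simp add: t_def form_outside[OF \<beta>])
        qed
      qed
      then show ?thesis using wedge[OF True] by (auto simp: w_def)
    qed (simp add: wedge_def)
  next
    fix Xs m X Y p assume *: "Xs \<in> form_args A ?N" "m < ?N" "X \<in> VF" "Y \<in> VF"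
    have "t \<sigma> (Xs[m := vf_add X Y]) p = t \<sigma> (Xs[m := X]) p + t \<sigma> (Xs[m := Y]) p" if \<sigma>: "\<sigma> permutes {..<?N}" for \<sigma>
      using update[OF *(1) \<sigma> *(2), of p] form_add[OF \<alpha> _ _ *(3,4)] form_add[OF \<beta> _ _ *(3,4)]
      by (auto simp: algebra_simps)
    then have "w (Xs[m := vf_add X Y]) p = w (Xs[m := X]) p + w (Xs[m := Y]) p"
      by (simp add: w_def sum.distrib[symmetric] algebra_simps)
    then show "wedge k l \<alpha> \<beta> (Xs[m := vf_add X Y]) p = wedge k l \<alpha> \<beta> (Xs[m := X]) p + wedge k l \<alpha> \<beta> (Xs[m := Y]) p"
      using *(1) by (simp add: wedge form_args_def add_divide_distrib)
  next
    fix Xs m X f p assume *: "Xs \<in> form_args A ?N" "m < ?N" "X \<in> VF" "f \<in> A"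
    have "t \<sigma> (Xs[m := vf_scale f X]) p = f p * t \<sigma> (Xs[m := X]) p" if \<sigma>: "\<sigma> permutes {..<?N}" for \<sigma>
      using update[OF *(1) \<sigma> *(2), of p] form_scale[OF \<alpha> _ _ *(3,4)] form_scale[OF \<beta> _ _ *(3,4)]
      by (auto simp: algebra_simps)
    then have "w (Xs[m := vf_scale f X]) p = f p * w (Xs[m := X]) p"
      by (simp add: w_def sum_distrib_left algebra_simps)
    then show "wedge k l \<alpha> \<beta> (Xs[m := vf_scale f X]) p = f p * wedge k l \<alpha> \<beta> (Xs[m := X]) p"
      using *(1) by (simp add: wedge form_args_def)
  next
    fix Xs i j p assume *: "Xs \<in> form_args A ?N" "i < ?N" "j < ?N" "i \<noteq> j" "Xs ! i = Xs ! j"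
    let ?\<tau> = "Transposition.transpose i j"
    have \<tau>: "?\<tau> permutes {..<?N}" using * by (intro permutes_swap_id) auto
    have "Xs ! (?\<tau> m) = Xs ! m" for m
      using * by (auto simp: Transposition.transpose_def)
    then have "t (?\<tau> \<circ> \<sigma>) Xs p = t \<sigma> Xs p" for \<sigma> by (simp add: t_def)
    moreover have "sign (?\<tau> \<circ> \<sigma>) = - sign \<sigma>" if "\<sigma> permutes {..<?N}" for \<sigma>
      using * sign_compose[OF permutes_imp_permutation[OF _ \<tau>] permutes_imp_permutation[OF _ that]]
      by (simp add: sign_swap_id)
    ultimately have "(\<Sum>\<sigma> | \<sigma> permutes {..<?N}. of_int (sign (?\<tau> \<circ> \<sigma>)) * t (?\<tau> \<circ> \<sigma>) Xs p) = - w Xs p"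
      by (simp add: w_def sum_negf)
    moreover have "w Xs p = (\<Sum>\<sigma> | \<sigma> permutes {..<?N}. of_int (sign (?\<tau> \<circ> \<sigma>)) * t (?\<tau> \<circ> \<sigma>) Xs p)"
      unfolding w_def by (rule setum_permutations_compose_left[OF \<tau>])
    ultimately have "w Xs p = 0" by simp
    then show "wedge k l \<alpha> \<beta> Xs p = 0"
      using *(1) by (simp add: wedge form_args_def)
  qed
qed

end

locale complex_algebra = function_algebra A M for A :: "'m func set" and M +
  fixes J :: "'m vf \<Rightarrow> 'm vf"
  assumes complex_structure: "complex_structure A J"
begin

lemma J_in: "X \<in> VF \<Longrightarrow> J X \<in> VF"
  and J_J: "X \<in> VF \<Longrightarrow> J (J X) = (\<lambda>h p. - X h p)"
  and J_cnj: "X \<in> VF \<Longrightarrow> J (vf_cnj X) = vf_cnj (J X)"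
  and J_add: "X \<in> VF \<Longrightarrow> Y \<in> VF \<Longrightarrow> J (vf_add X Y) = vf_add (J X) (J Y)"
  and J_scale: "X \<in> VF \<Longrightarrow> f \<in> A \<Longrightarrow> J (vf_scale f X) = vf_scale f (J X)"
  using complex_structure unfolding complex_structure_def by blast+

lemma J_cscale: "X \<in> VF \<Longrightarrow> J (\<lambda>h p. c * X h p) = (\<lambda>h p. c * J X h p)"
  by (simp add: vf_cscale_eq J_in J_scale const_in)

lemma J_zero: "J (\<lambda>h p. 0) = (\<lambda>h p. 0)"
  using J_cscale[OF vf_zero_in, of 0] by simp

lemma proj10_eq: "proj10 J X = vf_add (\<lambda>h p. 1/2 * X h p) (\<lambda>h p. - \<i>/2 * J X h p)"
  and proj01_eq: "proj01 J X = vf_add (\<lambda>h p. 1/2 * X h p) (\<lambda>h p. \<i>/2 * J X h p)"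
  by (simp_all add: proj10_def proj01_def vf_add_def field_simps)

lemma proj10_in: "X \<in> VF \<Longrightarrow> proj10 J X \<in> VF"
  and proj01_in: "X \<in> VF \<Longrightarrow> proj01 J X \<in> VF"
  unfolding proj10_eq proj01_eq by (intro vf_add_in vf_cscale_in J_in; assumption)+

lemma proj_add:
  assumes "X \<in> VF" "Y \<in> VF"
  shows "proj10 J (vf_add X Y) = vf_add (proj10 J X) (proj10 J Y)"
    "proj01 J (vf_add X Y) = vf_add (proj01 J X) (proj01 J Y)"
  unfolding proj10_def proj01_def J_add[OF assms] by (simp_all add: vf_add_def fun_eq_iff field_simps)

lemma proj_scale:
  assumes "X \<in> VF" "f \<in> A"
  shows "proj10 J (vf_scale f X) = vf_scale f (proj10 J X)"
    "proj01 J (vf_scale f X) = vf_scale f (proj01 J X)"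
  unfolding proj10_def proj01_def J_scale[OF assms] by (simp_all add: vf_scale_def fun_eq_iff field_simps)

text \<open>If the arguments \<open>i\<close> and \<open>j\<close> agree, transposing \<open>i\<close> and \<open>j\<close> in the set of positions of type \<open>(1, 0)\<close> swaps two
arguments of \<open>\<alpha>\<close>, so the sum over all such sets is its own negative.\<close>

lemma type_part_forms:
  assumes \<alpha>: "\<alpha> \<in> forms A (p + q)"
  shows "type_part A J p q \<alpha> \<in> forms A (p + q)"
proof -
  let ?k = "p + q" and ?C = "{S. S \<subseteq> {..<p + q} \<and> card S = p}"
  define P where "P S i = (if i \<in> S then proj10 J else proj01 J)" for S :: "nat set" and i
  let ?L = "\<lambda>S Xs. map (\<lambda>i. P S i (Xs ! i)) [0..<?k]"
  have tp: "type_part A J p q \<alpha> Xs x = (\<Sum>S\<in>?C. \<alpha> (?L S Xs) x)" if "Xs \<in> form_args A ?k" for Xs x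
    using that by (simp add: type_part_def P_def if_distrib[of "\<lambda>f. f _"] cong: if_cong)
  have P: "P S i X \<in> VF" if "X \<in> VF" for S i X
    using that by (simp add: P_def proj10_in proj01_in)
  have L: "?L S Xs \<in> form_args A ?k" if "Xs \<in> form_args A ?k" for S Xs
    using form_args_nth[OF that] P by (auto simp: form_args_def)
  have fin: "finite ?C" by (rule finite_subset[of _ "Pow {..<p + q}"]) auto
  show ?thesis
  proof (rule forms_I)
    fix Xs assume "Xs \<in> form_args A ?k"
    then have "type_part A J p q \<alpha> Xs = (\<lambda>x. \<Sum>S\<in>?C. \<alpha> (?L S Xs) x)"
      using tp by auto
    also have "\<dots> \<in> A" by (intro sum_in form_in[OF \<alpha>])
    finally show "type_part A J p q \<alpha> Xs \<in> A" .
  next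
    fix Xs m X Y x assume *: "Xs \<in> form_args A ?k" "m < ?k" "X \<in> VF" "Y \<in> VF"
    have len: "length Xs = ?k" using *(1) by (simp add: form_args_def)
    have "P S m (vf_add X Y) = vf_add (P S m X) (P S m Y)" for S
      using * by (simp add: P_def proj_add)
    then show "type_part A J p q \<alpha> (Xs[m := vf_add X Y]) x
        = type_part A J p q \<alpha> (Xs[m := X]) x + type_part A J p q \<alpha> (Xs[m := Y]) x"
      using * by (simp add: tp form_args_update vf_add_in map_nth_update[OF *(2) len]
          form_add[OF \<alpha> L] P sum.distrib)
  next
    fix Xs m X f x assume *: "Xs \<in> form_args A ?k" "m < ?k" "X \<in> VF" "f \<in> A"
    have len: "length Xs = ?k" using *(1) by (simp add: form_args_def)
    have "P S m (vf_scale f X) = vf_scale f (P S m X)" for S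
      using * by (simp add: P_def proj_scale)
    then show "type_part A J p q \<alpha> (Xs[m := vf_scale f X]) x = f x * type_part A J p q \<alpha> (Xs[m := X]) x"
      using * by (simp add: tp form_args_update vf_scale_in map_nth_update[OF *(2) len]
          form_scale[OF \<alpha> L] P sum_distrib_left)
  next
    fix Xs i j x assume *: "Xs \<in> form_args A ?k" "i < ?k" "j < ?k" "i \<noteq> j" "Xs ! i = Xs ! j"
    let ?\<tau> = "Transposition.transpose i j"
    have \<tau>: "?\<tau> ` S \<subseteq> {..<?k}" if "S \<subseteq> {..<?k}" for S
      using that * by (auto simp: Transposition.transpose_def)
    have invol: "?\<tau> ` ?\<tau> ` S = S" for S by (simp add: image_image)
    have bij: "bij_betw ((`) ?\<tau>) ?C ?C"
      by (rule bij_betw_byWitness[of _ "(`) ?\<tau>"]) (use \<tau> in \<open>auto simp: invol card_image\<close>)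
    have "?L (?\<tau> ` S) Xs = (?L S Xs)[i := ?L S Xs ! j, j := ?L S Xs ! i]" for S
    proof (rule nth_equalityI)
      fix m assume m: "m < length (?L (?\<tau> ` S) Xs)"
      have "m \<in> ?\<tau> ` S \<longleftrightarrow> ?\<tau> m \<in> S" by (metis image_iff transpose_involutory)
      then show "?L (?\<tau> ` S) Xs ! m = (?L S Xs)[i := ?L S Xs ! j, j := ?L S Xs ! i] ! m"
        using m * by (auto simp: nth_list_update P_def Transposition.transpose_def)
    qed simp
    then have "\<alpha> (?L (?\<tau> ` S) Xs) x = - \<alpha> (?L S Xs) x" for S
      using form_swap[OF \<alpha> L[OF *(1)] *(2-4)] by simp
    then have "(\<Sum>S\<in>?C. \<alpha> (?L (?\<tau> ` S) Xs) x) = - (\<Sum>S\<in>?C. \<alpha> (?L S Xs) x)"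
      by (simp add: sum_negf)
    then show "type_part A J p q \<alpha> Xs x = 0"
      using sum.reindex_bij_betw[OF bij, of "\<lambda>S. \<alpha> (?L S Xs) x"] by (simp add: tp[OF *(1)])
  qed (simp add: type_part_def)
qed

lemma type_part_forms': "\<alpha> \<in> forms A k \<Longrightarrow> p \<le> k \<Longrightarrow> type_part A J p (k - p) \<alpha> \<in> forms A k"
  using type_part_forms[of \<alpha> p "k - p"] by simp

lemma del_forms:
  assumes "\<alpha> \<in> forms A k"
  shows "del A J k \<alpha> \<in> forms A (Suc k)" "delbar A J k \<alpha> \<in> forms A (Suc k)"
proof -
  have "ext_d A (type_part A J p (k - p) \<alpha>) \<in> forms A (Suc k)" if "p \<le> k" for p
    using that assms by (intro ext_d_forms type_part_forms')
  then have "type_part A J (Suc p) (k - p) (ext_d A (type_part A J p (k - p) \<alpha>)) \<in> forms A (Suc k)"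
    "type_part A J p (Suc (k - p)) (ext_d A (type_part A J p (k - p) \<alpha>)) \<in> forms A (Suc k)" if "p \<le> k" for p
    using that type_part_forms[of _ "Suc p" "k - p"] type_part_forms[of _ p "Suc (k - p)"] by simp_all
  then show "del A J k \<alpha> \<in> forms A (Suc k)" "delbar A J k \<alpha> \<in> forms A (Suc k)"
    unfolding del_def delbar_def by (intro forms_sum; simp)+
qed

text \<open>Skew symmetry comes from \<open>g(J X, Y) = g(J\<^sup>2 X, J Y) = - g(X, J Y)\<close>.\<close>

lemma fundamental_form_forms:
  assumes g: "hermitian_metric A J g"
  shows "fundamental_form A J g \<in> forms A 2"
proof -
  note g' = g[unfolded hermitian_metric_def]
  have g_in: "g X Y \<in> A" and g_sym: "g X Y = g Y X" and g_J: "g (J X) (J Y) = g X Y" if "X \<in> VF" "Y \<in> VF" for X Y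
    using g' that by blast+
  have g_add: "g (vf_add X X') Y = (\<lambda>p. g X Y p + g X' Y p)" if "X \<in> VF" "X' \<in> VF" "Y \<in> VF" for X X' Y
    using g' that by blast
  have g_scale: "g (vf_scale f X) Y = (\<lambda>p. f p * g X Y p)" if "X \<in> VF" "Y \<in> VF" "f \<in> A" for X Y f
    using g' that by blast
  have g_uminus: "g (\<lambda>h p. - X h p) Y = (\<lambda>p. - g X Y p)" if "X \<in> VF" "Y \<in> VF" for X Y
    using g_scale[OF that const_in[of "- 1"]] vf_cscale_eq[OF that(1), of "- 1"] const_mult[OF g_in[OF that], of "- 1"]
    by simp
  have skew: "g (J X) Y p = - g (J Y) X p" if "X \<in> VF" "Y \<in> VF" for X Y p
    using g_J[OF that(1) J_in[OF that(2)]] g_uminus[of Y "J X"] g_sym[of "J X" Y] that g_sym[of X "J Y"]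
      g_J[of "J X" Y]
    by (simp add: J_in J_J g_sym[of _ "\<lambda>h p. - _ h p"]) (metis J_J J_in g_J g_sym g_uminus minus_minus)
  have \<omega>: "fundamental_form A J g [X, Y] = g (J X) Y" if "X \<in> VF" "Y \<in> VF" for X Y
    using that by (auto simp: fundamental_form_def form_args_def)
  have "fundamental_form A J g \<in> forms A (Suc (Suc 0))"
  proof (rule forms_SucI)
    fix X assume X: "X \<in> VF"
    have "contract X (fundamental_form A J g) \<in> forms A 1"
    proof (rule forms_1I)
      fix Y Z p assume "Y \<in> VF" "Z \<in> VF"
      then show "contract X (fundamental_form A J g) [vf_add Y Z] p
          = contract X (fundamental_form A J g) [Y] p + contract X (fundamental_form A J g) [Z] p"
        using X by (simp add: \<omega> vf_add_in contract_apply skew[of X] J_add g_add J_in)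
    next
      fix Y f p assume "Y \<in> VF" "f \<in> A"
      then show "contract X (fundamental_form A J g) [vf_scale f Y] p = f p * contract X (fundamental_form A J g) [Y] p"
        using X by (simp add: \<omega> vf_scale_in contract_apply skew[of X] J_scale g_scale J_in)
    qed (use X in \<open>auto simp: contract_apply \<omega> g_in J_in fundamental_form_def numeral_2_eq_2\<close>)
    then show "contract X (fundamental_form A J g) \<in> forms A (Suc 0)" by simp
  next
    fix X Y Ys p assume "X \<in> VF" "Y \<in> VF" "Ys \<in> form_args A 0"
    then show "fundamental_form A J g (X # Y # Ys) p = - fundamental_form A J g (Y # X # Ys) p"
      using skew[of X Y p] by (simp add: form_args_def \<omega>)
  qed (simp add: fundamental_form_def numeral_2_eq_2)
  then show ?thesis by (simp add: numeral_2_eq_2)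
qed

end

section \<open>Coframes and forms with constant coefficients\<close>

locale global_coframe = complex_algebra A M J for A :: "'m func set" and M J +
  fixes n :: nat and \<phi> :: "nat \<Rightarrow> 'm form" and Z :: "nat \<Rightarrow> 'm vf"
  assumes frame10: "frame10 A J n Z"
    and coframe_forms10: "\<And>j. j < n \<Longrightarrow> \<phi> j \<in> forms10 A J"
    and expand10: "\<And>X. X \<in> vector_fields10 A J \<Longrightarrow> X = (\<lambda>h p. \<Sum>j<n. \<phi> j [X] p * Z j h p)"
begin

lemma Z_in: "j < n \<Longrightarrow> Z j \<in> VF"
  and J_Z: "j < n \<Longrightarrow> J (Z j) = (\<lambda>h p. \<i> * Z j h p)"
  and Z_in10: "j < n \<Longrightarrow> Z j \<in> vector_fields10 A J"
  using frame10 by (auto simp: frame10_def vector_fields10_def)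

lemma coframe_forms: "j < n \<Longrightarrow> \<phi> j \<in> forms A 1"
  and coframe_J: "j < n \<Longrightarrow> X \<in> VF \<Longrightarrow> \<phi> j [J X] = (\<lambda>p. \<i> * \<phi> j [X] p)"
  using coframe_forms10 by (auto simp: forms10_def)

text \<open>The coframe is only required to give the components of a field of type \<open>(1, 0)\<close>. It is dual to the
frame because the components of \<open>Z\<^sub>k\<close> are unique.\<close>

lemma coframe_Z:
  assumes "j < n" "k < n"
  shows "\<phi> j [Z k] = const (of_bool (j = k))"
proof -
  let ?c = "\<lambda>i. if i < n then \<phi> i [Z k] else undefined"
  let ?d = "\<lambda>i. if i < n then const (of_bool (i = k)) else undefined"
  have ex1: "\<exists>!c. c \<in> {..<n} \<rightarrow>\<^sub>E A \<and> Z k = (\<lambda>h p. \<Sum>j<n. c j p * Z j h p)"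
    using frame10 Z_in10[OF assms(2)] by (simp add: frame10_def)
  have "?c \<in> {..<n} \<rightarrow>\<^sub>E A" "?d \<in> {..<n} \<rightarrow>\<^sub>E A"
    using form_in[OF coframe_forms] const_in by (auto simp: PiE_def extensional_def)
  moreover have "Z k = (\<lambda>h p. \<Sum>j<n. ?c j p * Z j h p)"
    using expand10[OF Z_in10[OF assms(2)]] by simp
  moreover have "Z k = (\<lambda>h p. \<Sum>j<n. ?d j p * Z j h p)"
  proof (intro ext)
    fix h p
    have "(\<Sum>j<n. ?d j p * Z j h p) = (\<Sum>j<n. of_bool (j = k) * Z j h p)"
      by (intro sum.cong refl) (simp add: const_mult VF_in[OF Z_in])
    also have "\<dots> = Z k h p"
      using assms(2) by (simp add: of_bool_def if_distrib[of "\<lambda>x. x * _"] sum.delta cong: if_cong)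
    finally show "Z k h p = (\<Sum>j<n. ?d j p * Z j h p)" by simp
  qed
  ultimately have "?c = ?d" using ex1 by blast
  then show ?thesis using assms(1) by (metis (full_types))
qed

end

locale invariant_coframe = global_coframe A M J n \<phi> Z
  for A :: "'m func set" and M J n \<phi> Z +
  fixes p0 :: 'm
  assumes p0: "p0 \<in> M" and n_pos: "0 < n"
    and closed: "\<And>j. j < n - 1 \<Longrightarrow> ext_d A (\<phi> j) = zero_form"
    and last_d: "ext_d A (\<phi> (n - 1)) \<in> const_two_forms (\<phi> ` {..<n - 1} \<union> (form_cnj \<circ> \<phi>) ` {..<n - 1})"
begin

text \<open>Indices out of range stand for the zero field. Identities between frame fields and between
cochains then hold for all indices, without range conditions.\<close>

definition frame :: "index \<Rightarrow> 'm vf" where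
  "frame v = (if snd v < n then if fst v then Z (snd v) else vf_cnj (Z (snd v)) else (\<lambda>h p. 0))"

definition bar :: "index \<Rightarrow> index" where
  "bar v = (\<not> fst v, snd v)"

text \<open>The coefficients of a form in the frame, taken at the point \<open>p0\<close>; for invariant forms the point
does not matter.\<close>

definition symbol :: "'m form \<Rightarrow> index cochain" where
  "symbol \<alpha> = (\<lambda>I. \<alpha> (map frame I) p0)"

definition invariant_forms :: "nat \<Rightarrow> 'm form set" where
  "invariant_forms k = {\<alpha> \<in> forms A k. \<forall>I p. \<alpha> (map frame I) p = const (symbol \<alpha> I) p}"

lemma vf_cnj_cnj [simp]: "vf_cnj (vf_cnj X) = X"
  by (simp add: vf_cnj_def)

lemma frame_in: "frame v \<in> VF"
  by (simp add: frame_def Z_in vf_cnj_in vf_zero_in)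

lemma frame_args: "map frame I \<in> form_args A k \<longleftrightarrow> length I = k"
  using frame_in by (auto simp: form_args_def)

lemma vf_cnj_zero: "vf_cnj (\<lambda>h p. 0) = (\<lambda>h p. 0)"
  by (simp add: vf_cnj_def)

lemma vf_cnj_frame: "vf_cnj (frame v) = frame (bar v)"
  by (simp add: frame_def bar_def vf_cnj_zero)

lemma J_frame: "J (frame v) = (\<lambda>h p. (if fst v then \<i> else - \<i>) * frame v h p)"
  by (auto simp: frame_def J_Z J_cnj Z_in J_zero fun_eq_iff) (simp add: vf_cnj_def)

lemma proj_frame:
  "proj10 J (frame v) = (if fst v then frame v else (\<lambda>h p. 0))"
  "proj01 J (frame v) = (if fst v then (\<lambda>h p. 0) else frame v)"
  unfolding proj10_def proj01_def J_frame by (simp_all add: fun_eq_iff)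

lemma coframe_frame:
  assumes "j < n"
  shows "\<phi> j [frame v] = const (of_bool (v = (True, j)))"
proof (cases v)
  case (Pair b k)
  consider "n \<le> k" | "k < n" "b" | "k < n" "\<not> b" by linarith
  then show ?thesis
  proof cases
    case 1
    then show ?thesis
      using Pair assms form_zero_arg[OF coframe_forms[OF assms], of "[frame v]"]
      by (auto simp: frame_def fun_eq_iff)
  next
    case 2
    then show ?thesis using coframe_Z[OF assms] Pair by (auto simp: frame_def)
  next
    case 3
    have "\<i> * \<phi> j [frame v] p = - \<i> * \<phi> j [frame v] p" for p
      using coframe_J[OF assms frame_in, of v] form_Cons_cscale[OF coframe_forms[OF assms] frame_in, of "- \<i>" v "[]" p] 3 Pair
      by (simp add: J_frame fun_eq_iff)
    then show ?thesis using 3 Pair by (auto simp: fun_eq_iff)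
  qed
qed

text \<open>Split \<open>X\<close> by type. The components of type \<open>(1, 0)\<close> are \<open>\<phi>\<^sup>j(X)\<close>, because \<open>\<phi>\<^sup>j\<close> vanishes on type \<open>(0, 1)\<close>;
those of type \<open>(0, 1)\<close> are found by conjugating.\<close>

lemma expand:
  assumes X: "X \<in> VF"
  shows "X h p = (\<Sum>j<n. \<phi> j [X] p * Z j h p) + (\<Sum>j<n. cnj (\<phi> j [vf_cnj X] p) * vf_cnj (Z j) h p)"
proof -
  have holo: "proj10 J Y h p = (\<Sum>j<n. \<phi> j [Y] p * Z j h p)" if Y: "Y \<in> VF" for Y h p
  proof -
    have "J (proj10 J Y) = (\<lambda>h p. \<i> * proj10 J Y h p)"
    proof -
      have "J (proj10 J Y) = vf_add (\<lambda>h p. 1/2 * J Y h p) (\<lambda>h p. - \<i>/2 * J (J Y) h p)"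
        unfolding proj10_eq J_add[OF vf_cscale_in[OF Y] vf_cscale_in[OF J_in[OF Y]]]
          J_cscale[OF Y] J_cscale[OF J_in[OF Y]] ..
      then show ?thesis
        by (simp add: J_J[OF Y] proj10_def vf_add_def fun_eq_iff field_simps)
    qed
    then have "proj10 J Y \<in> vector_fields10 A J"
      using proj10_in[OF Y] by (simp add: vector_fields10_def)
    then have "proj10 J Y h p = (\<Sum>j<n. \<phi> j [proj10 J Y] p * Z j h p)"
      by (metis expand10)
    moreover have "\<phi> j [proj10 J Y] p = \<phi> j [Y] p" if "j < n" for j
    proof -
      note f = coframe_forms[OF that]
      show ?thesis
        unfolding proj10_eq form_Cons_add[OF f vf_cscale_in[OF Y] vf_cscale_in[OF J_in[OF Y]]]
          form_Cons_cscale[OF f Y] form_Cons_cscale[OF f J_in[OF Y]]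
        by (simp add: coframe_J[OF that Y])
    qed
    ultimately show ?thesis by simp
  qed
  have "X h p = proj10 J X h p + proj01 J X h p"
    by (simp add: proj10_def proj01_def field_simps)
  also have "proj01 J X h p = vf_cnj (proj10 J (vf_cnj X)) h p"
    by (simp add: proj10_def proj01_def J_cnj[OF X]) (simp add: vf_cnj_def)
  also have "\<dots> = (\<Sum>j<n. cnj (\<phi> j [vf_cnj X] p) * vf_cnj (Z j) h p)"
    by (simp add: vf_cnj_def[of "proj10 J (vf_cnj X)"] holo[OF vf_cnj_in[OF X]])
      (simp add: vf_cnj_def)
  finally show ?thesis by (simp add: holo[OF X])
qed

text \<open>Expand the first argument in the frame and apply induction to the contractions.\<close>

lemma form_eq_zero:
  assumes "\<alpha> \<in> forms A k" "\<And>I p. \<alpha> (map frame I) p = 0"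
  shows "\<alpha> Xs p = 0"
  using assms
proof (induction k arbitrary: \<alpha> Xs)
  case 0
  then show ?case using "0.prems"(2)[of "[]"] by (cases Xs) (auto simp: form_outside)
next
  case (Suc k)
  show ?case
  proof (cases "Xs \<in> form_args A (Suc k)")
    case True
    then obtain X Ys where Xs: "Xs = X # Ys" "X \<in> VF" by (cases Xs) auto
    have frame: "\<alpha> (frame v # Ys) p = 0" for v
      using Suc.IH[OF contract_forms[OF Suc.prems(1) frame_in], of v Ys] Suc.prems(2)[of "v # _"]
      by (simp add: contract_apply)
    let ?S = "\<lambda>h p. \<Sum>j<n. \<phi> j [X] p * Z j h p"
    let ?T = "\<lambda>h p. \<Sum>j<n. cnj (\<phi> j [vf_cnj X] p) * vf_cnj (Z j) h p"
    have Z: "vf_scale (\<phi> j [X]) (Z j) \<in> VF" "vf_scale (\<lambda>p. cnj (\<phi> j [vf_cnj X] p)) (vf_cnj (Z j)) \<in> VF"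
      if "j < n" for j
      using that by (intro vf_scale_in vf_cnj_in Z_in form_in[OF coframe_forms] cnj_in; simp)+
    have "X = vf_add ?S ?T" using expand[OF Xs(2)] by (auto simp: vf_add_def)
    moreover have "?S \<in> VF" "?T \<in> VF"
      using vf_sum_in[of "{..<n}", OF Z(1)] vf_sum_in[of "{..<n}", OF Z(2)] by (simp_all add: vf_scale_def)
    ultimately have "\<alpha> Xs p = \<alpha> (?S # Ys) p + \<alpha> (?T # Ys) p"
      using form_Cons_add[OF Suc.prems(1), of ?S ?T Ys p] Xs(1) by simp
    also have "\<alpha> (?S # Ys) p = (\<Sum>j<n. \<alpha> (vf_scale (\<phi> j [X]) (Z j) # Ys) p)"
      using form_Cons_sum[OF Suc.prems(1), of "{..<n}" "\<lambda>j. vf_scale (\<phi> j [X]) (Z j)" Ys p] Z(1)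
      by (simp add: vf_scale_def)
    also have "\<dots> = 0"
    proof (intro sum.neutral ballI)
      fix j assume "j \<in> {..<n}"
      then show "\<alpha> (vf_scale (\<phi> j [X]) (Z j) # Ys) p = 0"
        using frame[of "(True, j)"]
        by (simp add: form_Cons_scale[OF Suc.prems(1) Z_in form_in[OF coframe_forms]] frame_def)
    qed
    also have "\<alpha> (?T # Ys) p = (\<Sum>j<n. \<alpha> (vf_scale (\<lambda>p. cnj (\<phi> j [vf_cnj X] p)) (vf_cnj (Z j)) # Ys) p)"
      using form_Cons_sum[OF Suc.prems(1), of "{..<n}" "\<lambda>j. vf_scale (\<lambda>p. cnj (\<phi> j [vf_cnj X] p)) (vf_cnj (Z j))" Ys p] Z(2)
      by (simp add: vf_scale_def)
    also have "\<dots> = 0"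
    proof (intro sum.neutral ballI)
      fix j assume "j \<in> {..<n}"
      then show "\<alpha> (vf_scale (\<lambda>p. cnj (\<phi> j [vf_cnj X] p)) (vf_cnj (Z j)) # Ys) p = 0"
        using frame[of "(False, j)"]
        by (simp add: form_Cons_scale[OF Suc.prems(1) vf_cnj_in[OF Z_in] cnj_in[OF form_in[OF coframe_forms]]] frame_def)
    qed
    finally show ?thesis by simp
  qed (simp add: form_outside[OF Suc.prems(1)])
qed

section \<open>Structure equations\<close>

text \<open>The index of \<open>Z\<^sub>n\<close>, the only frame field, with its conjugate, that brackets produce.\<close>

definition z :: index where "z = (True, n - 1)"

definition \<eta> :: "index cochain" where
  "\<eta> = symbol (ext_d A (\<phi> (n - 1)))"

definition \<eta>' :: "index cochain" where
  "\<eta>' I = cnj (\<eta> (map bar I))"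

lemma last_forms: "\<phi> (n - 1) \<in> forms A 1"
  using n_pos by (intro coframe_forms) simp

text \<open>The generators of the \<open>2\<close>-forms that \<open>d\<phi>\<^sup>n\<close> is built from are dual to frame fields other than \<open>Z\<^sub>n\<close> and its
conjugate.\<close>

lemma generator_frame:
  assumes "\<alpha> \<in> \<phi> ` {..<n - 1} \<union> (form_cnj \<circ> \<phi>) ` {..<n - 1}"
  shows "\<exists>c. \<alpha> [frame v] = const c" "\<alpha> [frame z] p = 0" "\<alpha> [frame (bar z)] p = 0"
proof -
  consider j where "\<alpha> = \<phi> j" "j < n - 1" | j where "\<alpha> = form_cnj (\<phi> j)" "j < n - 1"
    using assms by auto
  then have "(\<exists>c. \<alpha> [frame v] = const c) \<and> \<alpha> [frame z] p = 0 \<and> \<alpha> [frame (bar z)] p = 0"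
  proof cases
    case 1
    then have "\<phi> j [frame v] = const (of_bool (v = (True, j)))" for v
      by (intro coframe_frame) simp
    with 1 show ?thesis by (auto simp: z_def bar_def simp del: const_0; simp)
  next
    case 2
    then have "\<phi> j [frame v] = const (of_bool (v = (True, j)))" for v
      by (intro coframe_frame) simp
    moreover have "(\<lambda>p. cnj (const c p)) = const (cnj c)" for c by (auto simp: const_def)
    ultimately have "\<alpha> [frame v] = const (cnj (of_bool (bar v = (True, j))))" for v
      using 2 by (simp add: form_cnj_def vf_cnj_frame del: const_0)
    with 2 show ?thesis by (auto simp: z_def bar_def simp del: const_0; simp)
  qed
  then show "\<exists>c. \<alpha> [frame v] = const c" "\<alpha> [frame z] p = 0" "\<alpha> [frame (bar z)] p = 0" by auto
qed

lemma const_times: "const a p * const b p = const (a * b) p"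
  and const_scale: "c * const a p = const (c * a) p"
  and const_cnj: "cnj (const a p) = const (cnj a) p"
  by (auto simp: const_def algebra_simps)

lemma const_sum: "(\<Sum>i\<in>I. const (a i) p) = const (\<Sum>i\<in>I. a i) p"
  by (simp add: const_def sum_distrib_right)

text \<open>Each summand of \<open>\<eta>\<close> is a product of two generators, one of which receives the first argument.\<close>

lemma \<eta>_const: "ext_d A (\<phi> (n - 1)) (map frame I) p = const (\<eta> I) p"
  and \<eta>_contract_z: "\<eta> (z # I) = 0" "\<eta> (bar z # I) = 0"
proof -
  define S where "S = \<phi> ` {..<n - 1} \<union> (form_cnj \<circ> \<phi>) ` {..<n - 1}"
  obtain a where a: "ext_d A (\<phi> (n - 1)) = (\<lambda>Xs p. \<Sum>\<alpha>\<in>S. \<Sum>\<beta>\<in>S. a \<alpha> \<beta> * wedge 1 1 \<alpha> \<beta> Xs p)"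
    using last_d unfolding S_def[symmetric] by (auto simp: const_two_forms_def)
  note generator = generator_frame[folded S_def]
  have perm_less: "\<sigma> i < 2" if "\<sigma> permutes {..<2}" "i < 2" for \<sigma> :: "nat \<Rightarrow> nat" and i
    using permutes_in_image[OF that(1), of i] that(2) by simp
  have wedge_const: "\<exists>c. \<forall>p. wedge 1 1 \<alpha> \<beta> (map frame I) p = const c p"
    if mem: "\<alpha> \<in> S" "\<beta> \<in> S" for \<alpha> \<beta> I
  proof (cases "length I = 2")
    case True
    have "\<exists>c. \<forall>v p. \<alpha> [frame v] p = const (c v) p" "\<exists>c. \<forall>v p. \<beta> [frame v] p = const (c v) p"
      using generator(1) mem by metis+
    then obtain f g where "\<And>v p. \<alpha> [frame v] p = const (f v) p" "\<And>v p. \<beta> [frame v] p = const (g v) p"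
      by metis
    then have "wedge 1 1 \<alpha> \<beta> (map frame I) p
        = const (\<Sum>\<sigma> | \<sigma> permutes {..<2}. of_int (sign \<sigma>) * f (I ! \<sigma> 0) * g (I ! \<sigma> 1)) p" for p
      using True perm_less
      by (simp add: wedge_def numeral_2_eq_2 const_times const_scale[of "of_int k" for k] const_sum)
    then show ?thesis by blast
  next
    case False
    then show ?thesis by (intro exI[of _ 0]) (simp add: wedge_def)
  qed
  then obtain w where w: "wedge 1 1 \<alpha> \<beta> (map frame I) p = const (w \<alpha> \<beta> I) p"
    if "\<alpha> \<in> S" "\<beta> \<in> S" for \<alpha> \<beta> I p
    by metis
  have d: "ext_d A (\<phi> (n - 1)) (map frame I) p = const (\<Sum>\<alpha>\<in>S. \<Sum>\<beta>\<in>S. a \<alpha> \<beta> * w \<alpha> \<beta> I) p" for I p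
  proof -
    have "ext_d A (\<phi> (n - 1)) (map frame I) p = (\<Sum>\<alpha>\<in>S. \<Sum>\<beta>\<in>S. a \<alpha> \<beta> * const (w \<alpha> \<beta> I) p)"
      unfolding a by (intro sum.cong refl) (simp only: w)
    then show ?thesis by (simp only: const_scale const_sum)
  qed
  then have "\<eta> I = (\<Sum>\<alpha>\<in>S. \<Sum>\<beta>\<in>S. a \<alpha> \<beta> * w \<alpha> \<beta> I)" for I
    using const_eq_iff[OF p0] by (simp add: \<eta>_def symbol_def)
  then show "ext_d A (\<phi> (n - 1)) (map frame I) p = const (\<eta> I) p" by (simp only: d)
  have zero: "wedge 1 1 \<alpha> \<beta> (map frame (u # I)) p = 0"
    if mem: "\<alpha> \<in> S" "\<beta> \<in> S" and u: "u = z \<or> u = bar z" for \<alpha> \<beta> u I p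
  proof (cases "length I = 1")
    case True
    have "\<alpha> [map frame (u # I) ! \<sigma> 0] p * \<beta> [map frame (u # I) ! \<sigma> 1] p = 0"
      if \<sigma>: "\<sigma> permutes {..<2}" for \<sigma>
    proof -
      have "\<sigma> 0 < 2" "\<sigma> 1 < 2" "\<sigma> 0 \<noteq> \<sigma> 1"
        using perm_less[OF \<sigma>] permutes_inj[OF \<sigma>] by (auto simp: inj_def)
      then have "\<sigma> 0 = 0 \<or> \<sigma> 1 = 0" by linarith
      then show ?thesis using u generator(2,3)[OF mem(1)] generator(2,3)[OF mem(2)] by auto
    qed
    then show ?thesis using True by (auto simp: wedge_def numeral_2_eq_2 mult.assoc intro!: sum.neutral)
  next
    case False
    then show ?thesis by (simp add: wedge_def)
  qed
  show "\<eta> (z # I) = 0" "\<eta> (bar z # I) = 0"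
    unfolding \<eta>_def symbol_def a by (auto intro!: sum.neutral simp: zero simp del: list.map One_nat_def)
qed

lemma \<eta>_length: "length I \<noteq> 2 \<Longrightarrow> \<eta> I = 0"
  unfolding \<eta>_def symbol_def using ext_d_forms[OF last_forms]
  by (subst form_outside) (auto simp: frame_args numeral_2_eq_2)

lemma bar_bar [simp]: "bar (bar v) = v"
  by (simp add: bar_def)

lemma ext_d_one_form:
  assumes \<alpha>: "\<alpha> \<in> forms A 1" and X: "X \<in> VF" and Y: "Y \<in> VF"
  shows "ext_d A \<alpha> [X, Y] p = X (\<alpha> [Y]) p - Y (\<alpha> [X]) p - \<alpha> [vf_bracket X Y] p"
  using X Y by (simp add: ext_d_def lessThan_Suc omit_def)

text \<open>Since \<open>\<phi>\<^sup>j\<close> is constant on the frame, \<open>\<phi>\<^sup>j([U, V]) = - d\<phi>\<^sup>j(U, V)\<close>; this vanishes unless \<open>j\<close> is the last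
index. The components along the conjugate frame follow from \<open>[U, V]\<close> and its conjugate.\<close>

lemma bracket_frame:
  "vf_bracket (frame u) (frame v)
    = vf_add (\<lambda>h p. - \<eta> [u, v] * frame z h p) (\<lambda>h p. - \<eta>' [u, v] * frame (bar z) h p)"
proof (intro ext)
  fix h p
  have br: "\<phi> j [vf_bracket (frame u) (frame v)] p = (if j = n - 1 then - const (\<eta> [u, v]) p else 0)"
    if "j < n" for j u v
  proof -
    have "ext_d A (\<phi> j) [frame u, frame v] p = - \<phi> j [vf_bracket (frame u) (frame v)] p"
      using ext_d_one_form[OF coframe_forms[OF that] frame_in frame_in, of u v p]
      by (simp add: coframe_frame[OF that] VF_const[OF frame_in])
    moreover have "ext_d A (\<phi> j) [frame u, frame v] p = (if j = n - 1 then const (\<eta> [u, v]) p else 0)"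
      using \<eta>_const[of "[u, v]" p] closed[of j] that by (auto simp: zero_form_def)
    ultimately show ?thesis by (auto split: if_splits)
  qed
  have cnj_bracket: "vf_cnj (vf_bracket (frame u) (frame v)) = vf_bracket (frame (bar u)) (frame (bar v))"
    unfolding vf_cnj_frame[symmetric] by (simp add: vf_bracket_def vf_cnj_def)
  have "vf_bracket (frame u) (frame v) h p
      = (\<Sum>j<n. if j = n - 1 then - const (\<eta> [u, v]) p * Z j h p else 0)
        + (\<Sum>j<n. if j = n - 1 then - const (\<eta>' [u, v]) p * vf_cnj (Z j) h p else 0)"
    unfolding expand[OF vf_bracket_in[OF frame_in frame_in], of u v h p] cnj_bracket
    by (intro arg_cong2[of _ _ _ _ "(+)"] sum.cong refl) (auto simp: br const_cnj \<eta>'_def)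
  also have "\<dots> = - const (\<eta> [u, v]) p * frame z h p - const (\<eta>' [u, v]) p * frame (bar z) h p"
    using n_pos by (simp add: frame_def z_def bar_def)
  also have "\<dots> = - \<eta> [u, v] * frame z h p - \<eta>' [u, v] * frame (bar z) h p"
    by (simp add: const_mult[OF VF_in[OF frame_in]])
  finally show "vf_bracket (frame u) (frame v) h p
    = vf_add (\<lambda>h p. - \<eta> [u, v] * frame z h p) (\<lambda>h p. - \<eta>' [u, v] * frame (bar z) h p) h p"
    by (simp add: vf_add_def)
qed

lemma form_bracket_frame:
  assumes "\<alpha> \<in> forms A k"
  shows "\<alpha> (vf_bracket (frame u) (frame v) # Xs) p
    = - \<eta> [u, v] * \<alpha> (frame z # Xs) p - \<eta>' [u, v] * \<alpha> (frame (bar z) # Xs) p"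
  unfolding bracket_frame form_Cons_add[OF assms vf_cscale_in[OF frame_in] vf_cscale_in[OF frame_in]]
    form_Cons_cscale[OF assms frame_in] by simp

end

section \<open>The second-order operator on invariant forms\<close>

lemma holo_degree_card: "holo_degree I = int (card {i. i < length I \<and> fst (I ! i)})"
proof -
  have "holo_degree I = int (length (filter fst I))" by (induction I) auto
  then show ?thesis by (simp add: length_filter_conv_card)
qed

definition homogeneous :: "nat \<Rightarrow> 'v cochain \<Rightarrow> bool" where
  "homogeneous k a \<longleftrightarrow> (\<forall>I. length I \<noteq> k \<longrightarrow> a I = 0)"

lemma homogeneousD: "homogeneous k a \<Longrightarrow> length I \<noteq> k \<Longrightarrow> a I = 0"
  by (simp add: homogeneous_def)

context invariant_coframe
begin

lemma invariant_formsI: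
  assumes "\<alpha> \<in> forms A k" "\<And>I p. \<alpha> (map frame I) p = const (c I) p"
  shows "\<alpha> \<in> invariant_forms k" "symbol \<alpha> = c"
proof -
  show sym: "symbol \<alpha> = c"
    using assms(2) const_eq_iff[OF p0] by (auto simp: symbol_def)
  show "\<alpha> \<in> invariant_forms k"
    using assms by (simp add: invariant_forms_def sym)
qed

lemma invariant_formsD:
  assumes "\<alpha> \<in> invariant_forms k"
  shows "\<alpha> \<in> forms A k" "\<alpha> (map frame I) = const (symbol \<alpha> I)"
  using assms by (auto simp: invariant_forms_def)

lemma symbol_contract: "symbol (contract (frame v) \<alpha>) = contract v (symbol \<alpha>)"
  by (simp add: symbol_def contract_def)

lemma contract_invariant:
  assumes "\<alpha> \<in> invariant_forms k"
  shows "contract (frame v) \<alpha> \<in> invariant_forms (k - 1)"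
proof -
  have "contract (frame v) \<alpha> (map frame I) p = const (contract v (symbol \<alpha>) I) p" for I p
    using invariant_formsD(2)[OF assms, of "v # I"] by (simp add: contract_apply)
  then show ?thesis
    by (rule invariant_formsI[OF contract_forms_pred[OF invariant_formsD(1)[OF assms] frame_in]])
qed

lemma symbol_swap: "\<alpha> \<in> forms A k \<Longrightarrow> symbol \<alpha> (u # v # I) = - symbol \<alpha> (v # u # I)"
  by (simp add: symbol_def form_swap_first[of \<alpha> k "frame u"])

lemma symbol_twice: "\<alpha> \<in> forms A k \<Longrightarrow> symbol \<alpha> (u # u # I) = 0"
  using symbol_swap[of \<alpha> k u u I] by simp

lemma symbol_length: "\<alpha> \<in> forms A k \<Longrightarrow> length I \<noteq> k \<Longrightarrow> symbol \<alpha> I = 0"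
  by (simp add: symbol_def form_outside frame_args)

text \<open>A contraction of a \<open>2\<close>-cochain has degree one, so it changes sign under \<open>alternate\<close> and reduces to a
number after a second contraction.\<close>

lemma ext_prod_contract_two:
  assumes "homogeneous 2 a"
  shows "(contract u a \<odot> b) (v # I) = a [u, v] * b I - (contract u a \<odot> contract v b) I"
proof -
  have "(contract v (contract u a) \<odot> b) I = a [u, v] * b I"
    using homogeneousD[OF assms] by (subst ext_prod_supported_Nil_left) (auto simp: contract_apply)
  moreover have "alternate (contract u a) = (\<lambda>I. - contract u a I)"
  proof
    show "alternate (contract u a) I = - contract u a I" for I
      using homogeneousD[OF assms, of "u # I"] by (cases "length I = 1") (auto simp: alternate_def contract_apply)
  qed
  ultimately show ?thesis by (simp add: ext_prod_uminus_left)
qed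

lemma \<eta>'_length: "length I \<noteq> 2 \<Longrightarrow> \<eta>' I = 0"
  by (simp add: \<eta>'_def \<eta>_length)

lemma homogeneous_\<eta>: "homogeneous 2 \<eta>" "homogeneous 2 \<eta>'"
  by (simp_all add: homogeneous_def \<eta>_length \<eta>'_length)

lemma contract_contract_symbol:
  "\<alpha> \<in> forms A k \<Longrightarrow> contract v (contract u (symbol \<alpha>)) = (\<lambda>I. - contract u (contract v (symbol \<alpha>)) I)"
  by (intro ext) (simp add: contract_apply symbol_swap[of \<alpha> k u v])

text \<open>Replacing an argument \<open>V\<close> by \<open>[U, V]\<close> amounts to removing \<open>V\<close>, multiplying by \<open>- \<eta>(U, V)\<close> and inserting
\<open>Z\<^sub>n\<close>, plus the conjugate term. Summed over the slots, this is multiplication by the \<open>1\<close>-cochain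
\<open>\<eta>(U, _)\<close> after contraction with \<open>Z\<^sub>n\<close>; the two minus signs cancel. The derivative along \<open>U\<close> of the
constant coefficient vanishes.\<close>

lemma lie_derivative_frame:
  "\<alpha> \<in> invariant_forms k \<Longrightarrow> lie_derivative A (frame u) (map frame I) \<alpha> p
    = const ((contract u \<eta> \<odot> contract z (symbol \<alpha>)) I + (contract u \<eta>' \<odot> contract (bar z) (symbol \<alpha>)) I) p"
proof (induction I arbitrary: \<alpha> k)
  case Nil
  have "\<alpha> [] = const (symbol \<alpha> [])" using invariant_formsD(2)[OF Nil, of "[]"] by simp
  then show ?case
    by (simp add: VF_const[OF frame_in] contract_apply \<eta>_length \<eta>'_length)
next
  case (Cons v I)
  note \<alpha> = invariant_formsD[OF Cons.prems]
  have "\<alpha> (vf_bracket (frame u) (frame v) # map frame I) p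
      = const (- \<eta> [u, v] * symbol \<alpha> (z # I) - \<eta>' [u, v] * symbol \<alpha> (bar z # I)) p"
    using \<alpha>(2)[of "z # I"] \<alpha>(2)[of "bar z # I"]
    by (simp add: form_bracket_frame[OF \<alpha>(1)]) (simp add: const_def algebra_simps)
  moreover have "lie_derivative A (frame u) (map frame I) (contract (frame v) \<alpha>) p
      = const (- (contract u \<eta> \<odot> contract v (contract z (symbol \<alpha>))) I
          - (contract u \<eta>' \<odot> contract v (contract (bar z) (symbol \<alpha>))) I) p"
    unfolding Cons.IH[OF contract_invariant[OF Cons.prems]] symbol_contract
      contract_contract_symbol[OF \<alpha>(1), of v] ext_prod_uminus_right by simp
  moreover have "(contract u \<eta> \<odot> contract z (symbol \<alpha>)) (v # I)
      = \<eta> [u, v] * symbol \<alpha> (z # I) - (contract u \<eta> \<odot> contract v (contract z (symbol \<alpha>))) I"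
    "(contract u \<eta>' \<odot> contract (bar z) (symbol \<alpha>)) (v # I)
      = \<eta>' [u, v] * symbol \<alpha> (bar z # I) - (contract u \<eta>' \<odot> contract v (contract (bar z) (symbol \<alpha>))) I"
    using ext_prod_contract_two[OF homogeneous_\<eta>(1), of u "contract z (symbol \<alpha>)" v I]
      ext_prod_contract_two[OF homogeneous_\<eta>(2), of u "contract (bar z) (symbol \<alpha>)" v I]
      contract_apply[of z "symbol \<alpha>" I] contract_apply[of "bar z" "symbol \<alpha>" I] by simp_all
  moreover have "lie_derivative A (frame u) (map frame (v # I)) \<alpha> p
      = lie_derivative A (frame u) (map frame I) (contract (frame v) \<alpha>) p
        - \<alpha> (vf_bracket (frame u) (frame v) # map frame I) p"
    by (simp add: frame_in)
  ultimately show ?case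
    by (simp only:) (simp add: const_def algebra_simps)
qed

text \<open>The exterior derivative of the Lie algebra spanned by the frame, in terms of coefficients.\<close>

definition d_symbol :: "index cochain \<Rightarrow> index cochain" where
  "d_symbol a = (\<lambda>I. (\<eta> \<odot> contract z a) I + (\<eta>' \<odot> contract (bar z) a) I)"

lemma alternate_even:
  assumes "homogeneous 2 a"
  shows "alternate a = a"
proof
  show "alternate a I = a I" for I
    using homogeneousD[OF assms, of I] by (cases "length I = 2") (auto simp: alternate_def)
qed

lemma ext_d_frame:
  "\<alpha> \<in> invariant_forms k \<Longrightarrow> ext_d A \<alpha> (map frame I) p = const (d_symbol (symbol \<alpha>) I) p"
proof (induction I arbitrary: \<alpha> k)
  case Nil
  then show ?case by (simp add: ext_d_def d_symbol_def \<eta>_length \<eta>'_length)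
next
  case (Cons u I)
  note \<alpha> = invariant_formsD[OF Cons.prems]
  have "ext_d A \<alpha> (map frame (u # I)) p
      = lie_derivative A (frame u) (map frame I) \<alpha> p - const (d_symbol (contract u (symbol \<alpha>)) I) p"
  proof -
    have "set (map frame I) \<subseteq> VF" using frame_in by auto
    then show ?thesis
      using ext_d_Cons[OF \<alpha>(1) frame_in, of "map frame I" u p] Cons.IH[OF contract_invariant[OF Cons.prems, of u]]
      by (simp add: symbol_contract)
  qed
  also have "\<dots> = const (d_symbol (symbol \<alpha>) (u # I)) p"
    unfolding lie_derivative_frame[OF Cons.prems] d_symbol_def ext_prod.simps alternate_even[OF homogeneous_\<eta>(1)]
      alternate_even[OF homogeneous_\<eta>(2)] contract_contract_symbol[OF \<alpha>(1), of u] ext_prod_uminus_right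
    by (simp add: const_def algebra_simps)
  finally show ?case .
qed

text \<open>On frame fields the projections are the identity or zero, so the only set of positions that
contributes is the set of all positions with a field of type \<open>(1, 0)\<close>.\<close>

lemma type_part_frame:
  assumes "\<alpha> \<in> invariant_forms (p + q)"
  shows "type_part A J p q \<alpha> (map frame I) x = const (restrict_degree p (symbol \<alpha>) I) x"
proof (cases "length I = p + q")
  case True
  note \<alpha> = invariant_formsD[OF assms]
  let ?C = "{S. S \<subseteq> {..<p + q} \<and> card S = p}"
  \<comment> \<open>The positions of the fields of type \<open>(1, 0)\<close>.\<close>
  let ?H = "{i. i < length I \<and> fst (I ! i)}"
  let ?L = "\<lambda>S. map (\<lambda>i. if i \<in> S then proj10 J (map frame I ! i) else proj01 J (map frame I ! i)) [0..<p + q]"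
  have fin: "finite ?C" by (rule finite_subset[of _ "Pow {..<p + q}"]) auto
  have "\<alpha> (?L S) x = (if S = ?H then \<alpha> (map frame I) x else 0)" if S: "S \<in> ?C" for S
  proof (cases "S = ?H")
    case H: True
    have LS: "?L S = map frame I"
      by (rule nth_equalityI) (use True in \<open>auto simp: H proj_frame\<close>)
    show ?thesis unfolding LS using H by (rule if_P[symmetric])
  next
    case False
    then obtain i where i: "i < p + q" "i \<in> S \<longleftrightarrow> \<not> fst (I ! i)"
    proof -
      have "\<not> (\<forall>i<p + q. i \<in> S \<longleftrightarrow> fst (I ! i))"
        using False S True by auto
      then show ?thesis using that by blast
    qed
    then have "?L S ! i = (\<lambda>h p. 0)" using True by (auto simp: proj_frame)
    then have "(\<lambda>h p. 0) \<in> set (?L S)" using i by (metis (no_types, lifting) diff_zero length_map length_upt nth_mem)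
    then have "\<alpha> (?L S) x = 0" by (rule form_zero_arg[OF \<alpha>(1)])
    with False show ?thesis by simp
  qed
  then have "(\<Sum>S\<in>?C. \<alpha> (?L S) x) = (\<Sum>S\<in>?C. if S = ?H then \<alpha> (map frame I) x else 0)"
    by (intro sum.cong) auto
  also have "\<dots> = (if ?H \<in> ?C then \<alpha> (map frame I) x else 0)"
    by (rule sum.delta[OF fin])
  also have "?H \<in> ?C \<longleftrightarrow> holo_degree I = int p"
    using True by (auto simp: holo_degree_card)
  finally show ?thesis
    using True by (simp add: type_part_def \<alpha>(2) restrict_degree_apply frame_args)
next
  case False
  then show ?thesis
    by (simp add: type_part_def frame_args restrict_degree_apply symbol_length[OF invariant_formsD(1)[OF assms]])
qed

lemma ext_d_invariant:
  assumes "\<alpha> \<in> invariant_forms k"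
  shows "ext_d A \<alpha> \<in> invariant_forms (Suc k)" "symbol (ext_d A \<alpha>) = d_symbol (symbol \<alpha>)"
  by (fact invariant_formsI[OF ext_d_forms[OF invariant_formsD(1)[OF assms]] ext_d_frame[OF assms]])+

lemma type_part_invariant:
  assumes "\<alpha> \<in> invariant_forms (p + q)"
  shows "type_part A J p q \<alpha> \<in> invariant_forms (p + q)"
    "symbol (type_part A J p q \<alpha>) = restrict_degree p (symbol \<alpha>)"
  by (fact invariant_formsI[OF type_part_forms[OF invariant_formsD(1)[OF assms]] type_part_frame[OF assms]])+

text \<open>The part of the exterior derivative that raises the holomorphic degree by \<open>s\<close>: contraction with
\<open>Z\<^sub>n\<close> lowers it by one, contraction with the conjugate of \<open>Z\<^sub>n\<close> preserves it. The cases \<open>s = 1\<close>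
and \<open>s = 0\<close> are the two Dolbeault operators.\<close>

definition shift_symbol :: "int \<Rightarrow> index cochain \<Rightarrow> index cochain" where
  "shift_symbol s a = (\<lambda>I. (restrict_degree (s + 1) \<eta> \<odot> contract z a) I
                          + (restrict_degree s \<eta>' \<odot> contract (bar z) a) I)"

lemma restrict_degree_add:
  "restrict_degree p (\<lambda>I. a I + b I) = (\<lambda>I. restrict_degree p a I + restrict_degree p b I)"
  by (auto simp: restrict_degree_def)

lemma restrict_d_symbol:
  "restrict_degree (p + s) (d_symbol (restrict_degree p a)) = restrict_degree (p + s) (shift_symbol s a)"
proof -
  have "contract z (restrict_degree p a) = restrict_degree (p - 1) (contract z a)"
    "contract (bar z) (restrict_degree p a) = restrict_degree p (contract (bar z) a)"
    by (simp_all add: contract_restrict_degree z_def bar_def)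
  then show ?thesis
    using restrict_degree_ext_prod[of "s + 1" "p - 1" \<eta> "contract z a"]
      restrict_degree_ext_prod[of s p \<eta>' "contract (bar z) a"]
    by (simp add: d_symbol_def shift_symbol_def restrict_degree_add add.commute)
qed

lemma restrict_shift_symbol:
  "restrict_degree (p + s) (shift_symbol s (restrict_degree p a)) = restrict_degree (p + s) (shift_symbol s a)"
  by (metis restrict_d_symbol restrict_degree_idem)

text \<open>The types are processed one at a time, as in the definition of the two operators. Identifying the sum
over \<open>p\<close> with the whole cochain would require bounds on the types that occur.\<close>

lemma del_invariant:
  assumes "\<alpha> \<in> invariant_forms k"
  shows "del A J k \<alpha> \<in> invariant_forms (Suc k)"
    "symbol (del A J k \<alpha>) = (\<lambda>I. \<Sum>p\<le>k. restrict_degree (int p + 1) (shift_symbol 1 (symbol \<alpha>)) I)"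
    "delbar A J k \<alpha> \<in> invariant_forms (Suc k)"
    "symbol (delbar A J k \<alpha>) = (\<lambda>I. \<Sum>p\<le>k. restrict_degree (int p) (shift_symbol 0 (symbol \<alpha>)) I)"
proof -
  have d: "ext_d A (type_part A J p (k - p) \<alpha>) \<in> invariant_forms (Suc k)"
    "symbol (ext_d A (type_part A J p (k - p) \<alpha>)) = d_symbol (restrict_degree p (symbol \<alpha>))" if "p \<le> k" for p
    using that assms type_part_invariant[of \<alpha> p "k - p"] ext_d_invariant[of "type_part A J p (k - p) \<alpha>" k] by simp_all
  have 1: "type_part A J (Suc p) (k - p) (ext_d A (type_part A J p (k - p) \<alpha>)) (map frame I) x
      = const (restrict_degree (int p + 1) (shift_symbol 1 (symbol \<alpha>)) I) x" if "p \<le> k" for p I x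
    using that d[OF that] type_part_frame[of _ "Suc p" "k - p"] restrict_d_symbol[of "int p" 1]
    by (simp add: add.commute)
  have 2: "type_part A J p (Suc (k - p)) (ext_d A (type_part A J p (k - p) \<alpha>)) (map frame I) x
      = const (restrict_degree p (shift_symbol 0 (symbol \<alpha>)) I) x" if "p \<le> k" for p I x
    using that d[OF that] type_part_frame[of _ p "Suc (k - p)"] restrict_d_symbol[of "int p" 0]
    by simp
  have del: "del A J k \<alpha> (map frame I) x
      = const (\<Sum>p\<le>k. restrict_degree (int p + 1) (shift_symbol 1 (symbol \<alpha>)) I) x" for I x
    by (simp add: del_def 1 const_sum)
  show "del A J k \<alpha> \<in> invariant_forms (Suc k)"
    "symbol (del A J k \<alpha>) = (\<lambda>I. \<Sum>p\<le>k. restrict_degree (int p + 1) (shift_symbol 1 (symbol \<alpha>)) I)"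
    by (fact invariant_formsI[OF del_forms(1)[OF invariant_formsD(1)[OF assms]] del])+
  have delbar: "delbar A J k \<alpha> (map frame I) x
      = const (\<Sum>p\<le>k. restrict_degree (int p) (shift_symbol 0 (symbol \<alpha>)) I) x" for I x
    by (simp add: delbar_def 2 const_sum)
  show "delbar A J k \<alpha> \<in> invariant_forms (Suc k)"
    "symbol (delbar A J k \<alpha>) = (\<lambda>I. \<Sum>p\<le>k. restrict_degree (int p) (shift_symbol 0 (symbol \<alpha>)) I)"
    by (fact invariant_formsI[OF del_forms(2)[OF invariant_formsD(1)[OF assms]] delbar])+
qed

text \<open>The \<open>(2, 2)\<close>-form \<open>\<Psi>\<close> on which the SKT condition depends.\<close>

definition obstruction :: "index cochain" where
  "obstruction = (\<lambda>I. (restrict_degree 2 \<eta> \<odot> restrict_degree 0 \<eta>') I - (restrict_degree 1 \<eta>' \<odot> restrict_degree 1 \<eta>) I)"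

lemma contract_restrict_ext_prod:
  assumes "homogeneous 2 a" "\<And>I. a (v # I) = 0"
  shows "contract v (restrict_degree s a \<odot> b) = restrict_degree s a \<odot> contract v b"
proof -
  have "contract v (restrict_degree s a) = (\<lambda>I. 0)" "alternate (restrict_degree s a) = restrict_degree s a"
    using assms by (auto intro!: alternate_even simp: restrict_degree_def contract_def homogeneous_def)
  then show ?thesis by (simp add: contract_ext_prod ext_prod_zero_left)
qed

text \<open>Contractions with \<open>Z\<^sub>n\<close> and its conjugate pass through the even cochains that they annihilate. The
two terms with a repeated contraction vanish; the two mixed terms have opposite contractions, which
is the minus sign in the obstruction.\<close>

lemma shift_shift_symbol:
  assumes "\<alpha> \<in> forms A k"
  shows "shift_symbol 1 (shift_symbol 0 (symbol \<alpha>)) = obstruction \<odot> contract z (contract (bar z) (symbol \<alpha>))"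
proof
  fix I
  let ?a = "symbol \<alpha>" and ?c = "contract z (contract (bar z) (symbol \<alpha>))"
  have tw: "contract u (contract u ?a) = (\<lambda>I. 0)" for u
    by (intro ext) (simp add: contract_apply symbol_twice[OF assms])
  have \<eta>'_z: "\<eta>' (z # I) = 0" "\<eta>' (bar z # I) = 0" for I
    by (simp_all add: \<eta>'_def \<eta>_contract_z)
  have push: "contract u (restrict_degree s \<eta> \<odot> b) = restrict_degree s \<eta> \<odot> contract u b"
    "contract u (restrict_degree s \<eta>' \<odot> b) = restrict_degree s \<eta>' \<odot> contract u b"
    if "u = z \<or> u = bar z" for u s b
    using that by (auto intro!: contract_restrict_ext_prod homogeneous_\<eta> \<eta>_contract_z \<eta>'_z)
  have contr: "contract u (shift_symbol 0 ?a) = (\<lambda>I. (restrict_degree 1 \<eta> \<odot> contract u (contract z ?a)) I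
      + (restrict_degree 0 \<eta>' \<odot> contract u (contract (bar z) ?a)) I)" if "u = z \<or> u = bar z" for u
  proof -
    have "contract u (shift_symbol 0 ?a) = (\<lambda>I. contract u (restrict_degree 1 \<eta> \<odot> contract z ?a) I
        + contract u (restrict_degree 0 \<eta>' \<odot> contract (bar z) ?a) I)"
      by (simp add: shift_symbol_def contract_def[of u] del: ext_prod.simps)
    then show ?thesis by (simp only: push[OF that])
  qed
  have "shift_symbol 1 (shift_symbol 0 ?a) I
      = (restrict_degree 2 \<eta> \<odot> restrict_degree 0 \<eta>' \<odot> ?c) I
        + (restrict_degree 1 \<eta>' \<odot> restrict_degree 1 \<eta> \<odot> (\<lambda>I. - ?c I)) I"
    using contr[of z] contr[of "bar z"] contract_contract_symbol[OF assms, of "bar z" z]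
    by (simp add: shift_symbol_def[of 1] tw ext_prod_zero_right)
  also have "\<dots> = (obstruction \<odot> ?c) I"
    unfolding obstruction_def ext_prod_assoc[symmetric]
    using ext_prod_add_left[of "restrict_degree 2 \<eta> \<odot> restrict_degree 0 \<eta>'"
        "\<lambda>I. - (restrict_degree 1 \<eta>' \<odot> restrict_degree 1 \<eta>) I" ?c I]
    by (simp add: ext_prod_uminus_left ext_prod_uminus_right)
  finally show "shift_symbol 1 (shift_symbol 0 ?a) I = (obstruction \<odot> ?c) I" .
qed

lemma del_delbar_invariant:
  assumes "\<alpha> \<in> invariant_forms k"
  shows "del_delbar A J k \<alpha> \<in> invariant_forms (Suc (Suc k))"
    "symbol (del_delbar A J k \<alpha>) = (\<lambda>I. \<Sum>p\<le>k. restrict_degree (int p + 1)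
       (obstruction \<odot> contract z (contract (bar z) (symbol \<alpha>))) I)"
proof -
  note delbar = del_invariant(3,4)[OF assms]
  show "del_delbar A J k \<alpha> \<in> invariant_forms (Suc (Suc k))"
    unfolding del_delbar_def by (rule del_invariant(1)[OF delbar(1)])
  let ?b = "shift_symbol 0 (symbol \<alpha>)"
  let ?s = "\<lambda>I. \<Sum>q\<le>k. restrict_degree (int q) ?b I"
  \<comment> \<open>The outer operator sees only one type at a time of the inner result.\<close>
  have restr: "restrict_degree (int p) ?s = (if p \<le> k then restrict_degree (int p) ?b else (\<lambda>I. 0))" for p
  proof
    fix I
    have "restrict_degree (int p) ?s I = (\<Sum>q\<le>k. if q = p then restrict_degree (int p) ?b I else 0)"
      by (auto simp: restrict_degree_def intro!: sum.cong)
    then show "restrict_degree (int p) ?s I = (if p \<le> k then restrict_degree (int p) ?b else (\<lambda>I. 0)) I"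
      by (simp add: sum.delta)
  qed
  have zero: "shift_symbol 1 (\<lambda>I. 0) = (\<lambda>I. 0)"
    by (simp add: shift_symbol_def contract_def ext_prod_zero_right)
  have step: "restrict_degree (int p + 1) (shift_symbol 1 ?s)
      = (if p \<le> k then restrict_degree (int p + 1) (shift_symbol 1 ?b) else (\<lambda>I. 0))" for p
    using restrict_shift_symbol[of "int p" 1 ?s] restrict_shift_symbol[of "int p" 1 ?b]
    by (auto simp: restr zero) (auto simp: restrict_degree_def)
  show "symbol (del_delbar A J k \<alpha>) = (\<lambda>I. \<Sum>p\<le>k. restrict_degree (int p + 1)
       (obstruction \<odot> contract z (contract (bar z) (symbol \<alpha>))) I)"
    unfolding del_delbar_def del_invariant(2)[OF delbar(1)] delbar(2)
    by (simp add: step shift_shift_symbol[OF invariant_formsD(1)[OF assms]])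
qed

lemma del_delbar_eq_zero:
  assumes "\<alpha> \<in> invariant_forms k" "obstruction = (\<lambda>I. 0)"
  shows "del_delbar A J k \<alpha> = zero_form"
proof -
  note inv = del_delbar_invariant[OF assms(1)]
  have "symbol (del_delbar A J k \<alpha>) = (\<lambda>I. 0)"
  proof -
    have "(\<lambda>I. 0) \<odot> b = (\<lambda>I. 0)" for b :: "index cochain"
      by (intro ext ext_prod_zero_left)
    then show ?thesis using assms(2) by (simp add: inv(2) restrict_degree_apply)
  qed
  then have "del_delbar A J k \<alpha> (map frame I) p = 0" for I p
    using invariant_formsD(2)[OF inv(1), of I] by simp
  then show ?thesis
    using form_eq_zero[OF invariant_formsD(1)[OF inv(1)]] by (auto simp: zero_form_def)
qed

text \<open>For a \<open>2\<close>-form the double contraction is a number, so the obstruction itself is the coefficient of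
type \<open>(2, 2)\<close>, up to this nonzero factor. It has no coefficients of other types.\<close>

lemma obstruction_eq_zero:
  assumes \<omega>: "\<omega> \<in> invariant_forms 2" and nonzero: "symbol \<omega> [bar z, z] \<noteq> 0"
    and skt: "del_delbar A J 2 \<omega> = zero_form"
  shows "obstruction = (\<lambda>I. 0)"
proof
  fix I
  let ?c = "contract z (contract (bar z) (symbol \<omega>))"
  have Nil: "?c (v # J) = 0" for v J
    by (simp add: contract_apply symbol_length[OF invariant_formsD(1)[OF \<omega>]])
  show "obstruction I = 0"
  proof (cases "holo_degree I = 2")
    case True
    have "0 = symbol (del_delbar A J 2 \<omega>) I" by (simp add: skt symbol_def zero_form_def)
    also have "\<dots> = (\<Sum>p\<le>(2::nat). if p = 1 then (obstruction \<odot> ?c) I else 0)"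
      unfolding del_delbar_invariant(2)[OF \<omega>] using True
      by (intro sum.cong) (auto simp: restrict_degree_apply)
    also have "\<dots> = obstruction I * symbol \<omega> [bar z, z]"
      by (simp add: ext_prod_supported_Nil_right[where b = ?c, OF Nil] contract_apply)
    finally show ?thesis using nonzero by simp
  next
    case False
    then show ?thesis by (simp add: obstruction_def ext_prod_restrict_zero)
  qed
qed

section \<open>Invariant Hermitian metrics\<close>

lemma wedge_invariant:
  assumes "\<alpha> \<in> invariant_forms k" "\<beta> \<in> invariant_forms l"
  shows "wedge k l \<alpha> \<beta> \<in> invariant_forms (k + l)"
proof (rule invariant_formsI(1)[OF wedge_forms])
  fix I p
  let ?w = "(\<Sum>\<sigma> | \<sigma> permutes {..<k + l}. of_int (sign \<sigma>) * symbol \<alpha> (map (\<lambda>i. I ! \<sigma> i) [0..<k])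
      * symbol \<beta> (map (\<lambda>i. I ! \<sigma> i) [k..<k + l])) / (fact k * fact l)"
  show "wedge k l \<alpha> \<beta> (map frame I) p = const (if length I = k + l then ?w else 0) p"
  proof (cases "length I = k + l")
    case True
    have "map (\<lambda>i. map frame I ! \<sigma> i) [a..<b] = map frame (map (\<lambda>i. I ! \<sigma> i) [a..<b])"
      if "\<sigma> permutes {..<k + l}" "b \<le> k + l" for \<sigma> a b
      using that True permutes_in_image[OF that(1)] by auto
    then have "wedge k l \<alpha> \<beta> (map frame I) p = (\<Sum>\<sigma> | \<sigma> permutes {..<k + l}.
        of_int (sign \<sigma>) * const (symbol \<alpha> (map (\<lambda>i. I ! \<sigma> i) [0..<k])) p
          * const (symbol \<beta> (map (\<lambda>i. I ! \<sigma> i) [k..<k + l])) p) / (fact k * fact l)"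
      using True by (simp add: wedge_def invariant_formsD(2)[OF assms(1)] invariant_formsD(2)[OF assms(2)] del: map_map)
    then show ?thesis using True by (auto simp: const_def)
  qed (simp add: wedge_def)
qed (use assms invariant_formsD(1) in auto)

text \<open>Fields of the same type are orthogonal for the bilinear extension of the metric, so for
\<open>X = Z\<^sub>n + Z'\<close>, with \<open>Z'\<close> the conjugate of \<open>Z\<^sub>n\<close>, the value
\<open>g(X, X)\<close> is twice \<open>g(Z', Z\<^sub>n)\<close>. If this constant were zero, positivity would make the real field \<open>X\<close> vanish
everywhere, contradicting \<open>\<phi>\<^sup>n(X) = 1\<close>.\<close>

lemma fundamental_form_invariant:
  assumes g: "hermitian_metric A J g" and inv: "\<And>u v. \<exists>c. g (frame u) (frame v) = const c"
  shows "fundamental_form A J g \<in> invariant_forms 2" "symbol (fundamental_form A J g) [bar z, z] \<noteq> 0"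
proof -
  note g' = g[unfolded hermitian_metric_def]
  have g_sym: "g X Y = g Y X" and g_J: "g (J X) (J Y) = g X Y" if "X \<in> VF" "Y \<in> VF" for X Y
    using g' that by blast+
  have g_add: "g (vf_add X X') Y = (\<lambda>p. g X Y p + g X' Y p)" if "X \<in> VF" "X' \<in> VF" "Y \<in> VF" for X X' Y
    using g' that by blast
  have g_scale: "g (\<lambda>h p. c * X h p) Y = (\<lambda>p. c * g X Y p)" if "X \<in> VF" "Y \<in> VF" for X Y c
  proof -
    have "g X Y \<in> A" "g (vf_scale (const c) X) Y = (\<lambda>p. const c p * g X Y p)"
      using g' that const_in by blast+
    then show ?thesis by (simp add: vf_cscale_eq[OF that(1)] const_mult)
  qed
  obtain c where c: "g (frame u) (frame v) = const (c u v)" for u v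
    using inv by metis
  let ?s = "\<lambda>u. if fst u then \<i> else - \<i>"
  have "fundamental_form A J g (map frame I) p
      = const (if length I = 2 then ?s (I ! 0) * c (I ! 0) (I ! 1) else 0) p" for I p
  proof (cases "length I = 2")
    case True
    then show ?thesis
      by (simp add: fundamental_form_def frame_args J_frame g_scale[OF frame_in frame_in] c const_scale)
  qed (simp add: fundamental_form_def frame_args)
  note sym = invariant_formsI[OF fundamental_form_forms[OF g] this]
  show "fundamental_form A J g \<in> invariant_forms 2" by (rule sym(1))
  have "c (bar z) z \<noteq> 0"
  proof
    assume zero: "c (bar z) z = 0"
    let ?X = "vf_add (frame z) (frame (bar z))"
    have X: "?X \<in> VF" by (intro vf_add_in frame_in)
    have self: "g (frame u) (frame u) = (\<lambda>p. 0)" for u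
    proof -
      have "g (frame u) (frame u) = g (J (frame u)) (J (frame u))" by (simp add: g_J frame_in)
      also have "\<dots> = (\<lambda>p. - g (frame u) (frame u) p)"
        unfolding J_frame g_scale[OF frame_in vf_cscale_in[OF frame_in]]
          g_sym[OF frame_in vf_cscale_in[OF frame_in]] g_scale[OF frame_in frame_in] by auto
      finally show ?thesis by (simp add: fun_eq_iff)
    qed
    have mixed: "g (frame (bar z)) (frame z) = (\<lambda>p. 0)" "g (frame z) (frame (bar z)) = (\<lambda>p. 0)"
      using c[of "bar z" z] zero g_sym[OF frame_in frame_in, of z "bar z"] by auto
    have "g ?X ?X = (\<lambda>p. 0)"
      unfolding g_add[OF frame_in frame_in X] g_sym[OF frame_in X] g_add[OF frame_in frame_in frame_in]
      by (simp add: self mixed)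
    moreover have "?X \<in> real_vector_fields A"
      using X vf_cnj_frame[of z] vf_cnj_frame[of "bar z"]
      by (simp add: real_vector_fields_def) (simp add: vf_add_def vf_cnj_def fun_eq_iff)
    ultimately have "?X h p = 0" if "h \<in> A" for h p
      using g' that by fastforce
    moreover have "?X h p = 0" if "h \<notin> A" for h p
      using VF_outside[OF X that] by simp
    ultimately have "?X = (\<lambda>h p. 0)" by (intro ext) metis
    then have "\<phi> (n - 1) [?X] p0 = 0"
      using form_zero_arg[OF last_forms, of "[?X]" p0] by simp
    moreover have "\<phi> (n - 1) [?X] p0 = 1"
      unfolding form_Cons_add[OF last_forms frame_in frame_in]
      using n_pos const_eq_iff[OF p0] by (simp add: coframe_frame) (simp add: z_def bar_def const_eq_iff[OF p0])
    ultimately show False by simp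
  qed
  then show "symbol (fundamental_form A J g) [bar z, z] \<noteq> 0"
    by (simp add: sym(2))
qed

theorem skt_dichotomy:
  assumes "hermitian_metric A J g" "\<And>u v. \<exists>c. g (frame u) (frame v) = const c" "skt A J g"
    and "hermitian_metric A J g'" "\<And>u v. \<exists>c. g' (frame u) (frame v) = const c"
  shows "del_delbar A J 2 (fundamental_form A J g') = zero_form"
    "del_delbar A J 4 (wedge 2 2 (fundamental_form A J g') (fundamental_form A J g')) = zero_form"
proof -
  have obs: "obstruction = (\<lambda>I. 0)"
    using obstruction_eq_zero[OF fundamental_form_invariant[OF assms(1,2)]] assms(3) by (simp add: skt_def)
  note \<omega> = fundamental_form_invariant(1)[OF assms(4,5)]
  show "del_delbar A J 2 (fundamental_form A J g') = zero_form"
    by (rule del_delbar_eq_zero[OF \<omega> obs])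
  show "del_delbar A J 4 (wedge 2 2 (fundamental_form A J g') (fundamental_form A J g')) = zero_form"
    using del_delbar_eq_zero[OF wedge_invariant[OF \<omega> \<omega>] obs] by simp
qed

end

section \<open>Descent of left-invariant frames\<close>

locale lattice_quotient =
  fixes G :: "'g::topological_space monoid" and T :: "('g, 'e::euclidean_space) atlas" and \<Gamma> :: "'g set"
  assumes group: "group G" and carrier: "carrier G = UNIV" and smooth_atlas: "smooth_atlas T"
    and subgroup: "subgroup \<Gamma> G"
begin

abbreviation "A' \<equiv> smooth_functions T"
abbreviation "A \<equiv> quotient_functions G T \<Gamma>"
abbreviation "M \<equiv> rcosets\<^bsub>G\<^esub> \<Gamma>"
abbreviation "\<pi> \<equiv> coset_proj G \<Gamma>"

sublocale up: function_algebra A' UNIV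
  by (rule function_algebra_smooth[OF smooth_atlas])

lemma proj_in: "\<pi> x \<in> M"
  using group.rcosetsI[OF group, of \<Gamma> x] by (simp add: coset_proj_def carrier)

lemma proj_surj:
  assumes "p \<in> M" obtains x where "p = \<pi> x"
  using assms by (auto simp: RCOSETS_def coset_proj_def)

lemma proj_mult:
  assumes "\<gamma> \<in> \<Gamma>"
  shows "\<pi> (\<gamma> \<otimes>\<^bsub>G\<^esub> x) = \<pi> x"
  using group.coset_mult_assoc[OF group, of \<Gamma> \<gamma> x] group.coset_join2[OF group _ subgroup assms]
  by (simp add: coset_proj_def carrier)

lemma proj_eqD:
  assumes "\<pi> x = \<pi> y" obtains \<gamma> where "\<gamma> \<in> \<Gamma>" "y = \<gamma> \<otimes>\<^bsub>G\<^esub> x"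
  using group.rcos_self[OF group _ subgroup, of y] assms
  by (auto simp: coset_proj_def carrier r_coset_def)

lemma quotient_functions_iff:
  "f \<in> A \<longleftrightarrow> (\<lambda>x. f (\<pi> x)) \<in> A' \<and> (\<forall>p. p \<notin> M \<longrightarrow> f p = 0)"
  by (simp add: quotient_functions_def comp_def)

sublocale down: function_algebra A M
proof
  show "(\<lambda>p. of_bool (p \<in> M)) \<in> A"
    using up.indicator_in by (simp add: quotient_functions_iff proj_in)
qed (auto simp: quotient_functions_iff intro: up.add_in up.mult_in up.scale_in up.cnj_in)

lemma quotient_function_eqI:
  assumes "f \<in> A" "g \<in> A" "\<And>x. f (\<pi> x) = g (\<pi> x)"
  shows "f = g"
proof
  fix p
  show "f p = g p"
  proof (cases "p \<in> M")
    case True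
    then obtain x where "p = \<pi> x" by (rule proj_surj)
    then show ?thesis using assms(3) by simp
  next
    case False
    then show ?thesis using assms by (simp add: quotient_functions_iff)
  qed
qed

lemma down_const_proj: "down.const c (\<pi> x) = c"
  by (simp add: down.const_def proj_in)

lemma inv_mult: "a \<otimes>\<^bsub>G\<^esub> (inv\<^bsub>G\<^esub> a \<otimes>\<^bsub>G\<^esub> x) = x" "inv\<^bsub>G\<^esub> a \<otimes>\<^bsub>G\<^esub> (a \<otimes>\<^bsub>G\<^esub> x) = x"
  using group.r_inv[OF group, of a] group.l_inv[OF group, of a]
    monoid.m_assoc[OF group.is_monoid[OF group], of a "inv\<^bsub>G\<^esub> a" x]
    monoid.m_assoc[OF group.is_monoid[OF group], of "inv\<^bsub>G\<^esub> a" a x]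
    monoid.l_one[OF group.is_monoid[OF group], of x]
  by (simp_all add: carrier flip: monoid.m_assoc[OF group.is_monoid[OF group]])

text \<open>A translate of \<open>Z'\<^sub>j\<close> has the same constant components as \<open>Z'\<^sub>j\<close>. That the translate is a vector field can
be read off the invariance of \<open>\<phi>'\<^sup>j\<close>: a form vanishes on anything else, whereas \<open>\<phi>'\<^sup>j\<close> takes the value \<open>1\<close> here.\<close>

lemma left_invariant_frame:
  assumes J': "complex_structure A' J'" "left_inv_endo G A' J'"
    and frame: "global_coframe A' UNIV J' n \<phi>' Z'"
    and inv: "\<And>j. j < n \<Longrightarrow> left_inv_form G A' 1 (\<phi>' j)" and j: "j < n"
  shows "left_push G a (Z' j) = Z' j"
proof -
  interpret F: global_coframe A' UNIV J' n \<phi>' Z' by (rule frame)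
  let ?X = "left_push G a (Z' j)"
  have val: "\<phi>' k [?X] x = of_bool (k = j)" if "k < n" for k x
  proof -
    have "\<phi>' k (map (left_push G a) [Z' j]) (a \<otimes>\<^bsub>G\<^esub> (inv\<^bsub>G\<^esub> a \<otimes>\<^bsub>G\<^esub> x)) = \<phi>' k [Z' j] (inv\<^bsub>G\<^esub> a \<otimes>\<^bsub>G\<^esub> x)"
    proof -
      have "[Z' j] \<in> form_args A' 1" using F.Z_in[OF j] by simp
      then show ?thesis using inv[OF that] unfolding left_inv_form_def by blast
    qed
    then show ?thesis by (simp add: inv_mult F.coframe_Z[OF that j] up.const_def)
  qed
  have X: "?X \<in> vector_fields A'"
  proof (rule ccontr)
    assume "?X \<notin> vector_fields A'"
    then have "\<phi>' j [?X] = (\<lambda>p. 0)" by (intro up.form_outside[OF F.coframe_forms[OF j]]) auto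
    then show False using val[OF j] by simp
  qed
  have "J' ?X = left_push G a (J' (Z' j))"
    using J'(2) F.Z_in[OF j] by (simp add: left_inv_endo_def)
  also have "\<dots> = (\<lambda>h p. \<i> * ?X h p)"
    unfolding F.J_Z[OF j] by (simp add: left_push_def)
  finally have "?X \<in> vector_fields10 A' J'" using X by (simp add: vector_fields10_def)
  then have "?X = (\<lambda>h p. \<Sum>k<n. \<phi>' k [?X] p * Z' k h p)" by (rule F.expand10)
  also have "\<dots> = (\<lambda>h p. \<Sum>k<n. if k = j then Z' k h p else 0)"
    by (intro ext sum.cong) (auto simp: val)
  also have "\<dots> = Z' j" using j by simp
  finally show ?thesis .
qed

text \<open>A left-invariant field preserves \<open>\<Gamma>\<close>-invariance of functions, and the \<open>\<Gamma>\<close>-invariant smooth functions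
on \<open>G\<close> are the pull-backs of the smooth functions on the quotient.\<close>

lemma left_invariant_descends:
  assumes X: "X \<in> vector_fields A'" and inv: "\<And>a. left_push G a X = X"
  obtains Y where "vf_related A' A \<pi> X Y"
proof -
  \<comment> \<open>The choice of \<open>x\<close> over \<open>p\<close> is immaterial because \<open>X (h \<circ> \<pi>)\<close> is \<open>\<Gamma>\<close>-invariant.\<close>
  define Y where "Y h p = (if h \<in> A \<and> p \<in> M then X (h \<circ> \<pi>) (SOME x. \<pi> x = p) else 0)" for h p
  have lift: "h \<circ> \<pi> \<in> A'" if "h \<in> A" for h using that by (simp add: quotient_functions_def)
  have Y: "Y h (\<pi> x) = X (h \<circ> \<pi>) x" if h: "h \<in> A" for h x
  proof -
    have const: "X (h \<circ> \<pi>) (\<gamma> \<otimes>\<^bsub>G\<^esub> y) = X (h \<circ> \<pi>) y" if \<gamma>: "\<gamma> \<in> \<Gamma>" for \<gamma> y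
    proof -
      have "X (h \<circ> \<pi>) (\<gamma> \<otimes>\<^bsub>G\<^esub> y) = left_push G \<gamma> X (h \<circ> \<pi>) (\<gamma> \<otimes>\<^bsub>G\<^esub> y)" by (simp add: inv)
      also have "\<dots> = X (h \<circ> \<pi>) y"
        by (simp add: left_push_def inv_mult comp_def proj_mult[OF \<gamma>])
      finally show ?thesis .
    qed
    have "\<pi> (SOME y. \<pi> y = \<pi> x) = \<pi> x" by (rule someI) simp
    then obtain \<gamma> where "\<gamma> \<in> \<Gamma>" "x = \<gamma> \<otimes>\<^bsub>G\<^esub> (SOME y. \<pi> y = \<pi> x)" by (rule proj_eqD)
    then show ?thesis using const[of \<gamma> "SOME y. \<pi> y = \<pi> x"] h by (simp add: Y_def proj_in)
  qed
  have Y_in: "Y h \<in> A" if "h \<in> A" for h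
    using up.VF_in[OF X, of "h \<circ> \<pi>"] by (simp add: quotient_functions_iff Y[OF that]) (simp add: Y_def)
  have "Y \<in> vector_fields A"
  proof (rule down.VF_I)
    fix f g p assume f: "f \<in> A" and g: "g \<in> A"
    have "Y (\<lambda>p. f p + g p) = (\<lambda>p. Y f p + Y g p)"
      using up.VF_add[OF X lift[OF f] lift[OF g]]
      by (intro quotient_function_eqI Y_in down.add_in f g) (simp add: Y f g down.add_in comp_def)
    then show "Y (\<lambda>p. f p + g p) p = Y f p + Y g p" by simp
    have "Y (\<lambda>p. f p * g p) = (\<lambda>p. Y f p * g p + f p * Y g p)"
      using up.VF_mult[OF X lift[OF f] lift[OF g]]
      by (intro quotient_function_eqI Y_in down.add_in down.mult_in f g) (simp add: Y f g down.mult_in comp_def)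
    then show "Y (\<lambda>p. f p * g p) p = Y f p * g p + f p * Y g p" by simp
  next
    fix f c p assume f: "f \<in> A"
    have "Y (\<lambda>p. c * f p) = (\<lambda>p. c * Y f p)"
      using up.VF_scale[OF X lift[OF f], of c]
      by (intro quotient_function_eqI Y_in down.scale_in f) (simp add: Y f down.scale_in comp_def)
    then show "Y (\<lambda>p. c * f p) p = c * Y f p" by simp
  next
    show "Y f = (\<lambda>p. 0)" if "f \<notin> A" for f
      using that by (simp add: Y_def fun_eq_iff)
  qed (rule Y_in)
  then show ?thesis using that[of Y] X Y by (auto simp: vf_related_def fun_eq_iff)
qed

text \<open>The field to which \<open>Z'\<^sub>j\<close> descends is of type \<open>(1, 0)\<close> and has the components of \<open>Z\<^sub>j\<close>, since both the
complex structure and the coframe are induced from \<open>G\<close>.\<close>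

lemma vf_related_frame:
  assumes J: "complex_structure A J" "induces_endo A' A \<pi> J' J"
    and up_frame: "global_coframe A' UNIV J' n \<phi>' Z'" and down_frame: "global_coframe A M J n \<phi> Z"
    and ind: "\<And>j. j < n \<Longrightarrow> induces_form A' A \<pi> (\<phi>' j) (\<phi> j)"
    and inv: "\<And>a. left_push G a (Z' j) = Z' j" and j: "j < n"
  shows "vf_related A' A \<pi> (Z' j) (Z j)"
proof -
  interpret F': global_coframe A' UNIV J' n \<phi>' Z' by (rule up_frame)
  interpret F: global_coframe A M J n \<phi> Z by (rule down_frame)
  obtain Y where rel: "vf_related A' A \<pi> (Z' j) Y"
    using left_invariant_descends[OF F'.Z_in[OF j] inv] by blast
  then have Y: "Y \<in> vector_fields A" and lift: "\<And>h. h \<in> A \<Longrightarrow> Z' j (h \<circ> \<pi>) = Y h \<circ> \<pi>"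
    by (auto simp: vf_related_def)
  have JY: "vf_related A' A \<pi> (J' (Z' j)) (J Y)"
    using J(2) rel by (simp add: induces_endo_def)
  have "J Y h = (\<lambda>p. \<i> * Y h p)" for h
  proof (cases "h \<in> A")
    case True
    then have "\<i> * Z' j (h \<circ> \<pi>) x = J Y h (\<pi> x)" for x
      using JY unfolding vf_related_def F'.J_Z[OF j] by (auto simp: fun_eq_iff)
    then show ?thesis
      using lift[OF True] by (intro quotient_function_eqI down.scale_in down.VF_in F.J_in Y) simp
  next
    case False
    then show ?thesis using down.VF_outside[OF Y] down.VF_outside[OF F.J_in[OF Y]] by simp
  qed
  then have "Y \<in> vector_fields10 A J" using Y by (auto simp: vector_fields10_def)
  then have "Y = (\<lambda>h p. \<Sum>k<n. \<phi> k [Y] p * Z k h p)" by (rule F.expand10)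
  also have "\<dots> = (\<lambda>h p. \<Sum>k<n. if k = j then Z k h p else 0)"
  proof (intro ext sum.cong refl)
    fix h p k assume k: "k \<in> {..<n}"
    have "\<phi>' k [Z' j] = \<phi> k [Y] \<circ> \<pi>"
      using ind[of k] k rel unfolding induces_form_def by auto
    then have "\<phi> k [Y] (\<pi> x) = of_bool (k = j)" for x
      using F'.coframe_Z[of k j] k j by (auto simp: fun_eq_iff up.const_def)
    then have "\<phi> k [Y] = down.const (of_bool (k = j))"
      using k by (intro quotient_function_eqI down.form_in[OF F.coframe_forms] down.const_in)
        (auto simp: down_const_proj)
    then show "\<phi> k [Y] p * Z k h p = (if k = j then Z k h p else 0)"
      using k by (simp add: down.const_mult[OF down.VF_in[OF F.Z_in]] del: down.const_0)
  qed
  also have "\<dots> = Z j" using j by simp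
  finally show ?thesis using rel by simp
qed

lemma vf_related_cnj:
  assumes "vf_related A' A \<pi> X' X"
  shows "vf_related A' A \<pi> (vf_cnj X') (vf_cnj X)"
proof -
  have "vf_cnj X' (h \<circ> \<pi>) x = vf_cnj X h (\<pi> x)" if "h \<in> A" for h x
  proof -
    have "X' ((\<lambda>q. cnj (h q)) \<circ> \<pi>) x = X (\<lambda>q. cnj (h q)) (\<pi> x)"
      using assms down.cnj_in[OF that] by (simp add: vf_related_def)
    then show ?thesis by (simp add: vf_cnj_def comp_def)
  qed
  then show ?thesis
    using assms up.vf_cnj_in down.vf_cnj_in by (auto simp: vf_related_def fun_eq_iff)
qed

text \<open>For left-invariant fields \<open>g'(X', Y')\<close> is a left-invariant function on \<open>G\<close>, hence equal to its value at
the identity.\<close>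

lemma metric_constant:
  assumes g: "hermitian_metric A J g" and g': "left_inv_metric G A' g'" "induces_metric A' A \<pi> g' g"
    and rel: "vf_related A' A \<pi> X' X" "vf_related A' A \<pi> Y' Y"
    and inv: "\<And>a. left_push G a X' = X'" "\<And>a. left_push G a Y' = Y'"
  shows "\<exists>c. g X Y = down.const c"
proof
  have in_VF: "X' \<in> vector_fields A'" "Y' \<in> vector_fields A'" "X \<in> vector_fields A" "Y \<in> vector_fields A"
    using rel by (auto simp: vf_related_def)
  have "g' X' Y' (a \<otimes>\<^bsub>G\<^esub> \<one>\<^bsub>G\<^esub>) = g' X' Y' \<one>\<^bsub>G\<^esub>" for a
    using g'(1) in_VF unfolding left_inv_metric_def by (metis inv)
  then have const: "g' X' Y' a = g' X' Y' \<one>\<^bsub>G\<^esub>" for a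
    using monoid.r_one[OF group.is_monoid[OF group], of a] carrier by (metis UNIV_I)
  have "g' X' Y' = g X Y \<circ> \<pi>" using g'(2) rel unfolding induces_metric_def by blast
  then have "g X Y (\<pi> x) = g' X' Y' \<one>\<^bsub>G\<^esub>" for x using const[of x] by simp
  moreover have "g X Y \<in> A" using g in_VF unfolding hermitian_metric_def by blast
  ultimately show "g X Y = down.const (g' X' Y' \<one>\<^bsub>G\<^esub>)"
    by (intro quotient_function_eqI down.const_in) (simp_all add: down_const_proj)
qed

end

theorem theorem1p1:
  fixes G :: "'g::{t2_space,second_countable_topology} monoid"
    and T :: "('g, 'e::euclidean_space) atlas"
    and \<Gamma> :: "'g set"
    and n :: nat
    and J' :: "'g vf \<Rightarrow> 'g vf"
    and J :: "'g set vf \<Rightarrow> 'g set vf"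
    and \<phi> :: "nat \<Rightarrow> 'g set form"
  assumes "lie_group G T"
    and "connected (UNIV :: 'g set)"
    and "simply_connected (UNIV :: 'g set)"
    and "nilpotent_group G"
    and "DIM('e) = 2 * n"
    and "cocompact_lattice G \<Gamma>"
    and "quotient_left_inv_complex_structure G T \<Gamma> J' J"
    and "quotient_left_inv_coframe10 G T \<Gamma> J' J n \<phi>"
    and "\<And>j. j < n - 1 \<Longrightarrow> ext_d (quotient_functions G T \<Gamma>) (\<phi> j) = zero_form"
    and "ext_d (quotient_functions G T \<Gamma>) (\<phi> (n - 1))
           \<in> const_two_forms (\<phi> ` {..<n - 1} \<union> (form_cnj \<circ> \<phi>) ` {..<n - 1})"
  shows "(\<forall>g. quotient_left_inv_hermitian_metric G T \<Gamma> J' J g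
                \<longrightarrow> \<not> skt (quotient_functions G T \<Gamma>) J g) \<or>
         (\<forall>g. quotient_left_inv_hermitian_metric G T \<Gamma> J' J g \<longrightarrow>
            (let A = quotient_functions G T \<Gamma>; \<omega> = fundamental_form A J g in
               del_delbar A J 2 \<omega> = zero_form \<and>
               del_delbar A J 4 (wedge 2 2 \<omega> \<omega>) = zero_form))"
proof -
  interpret lattice_quotient G T \<Gamma>
    using assms(1,6) unfolding lie_group_def cocompact_lattice_def lattice_quotient_def by blast
  have J': "complex_structure A' J'" "left_inv_endo G A' J'"
    and J: "complex_structure A J" "induces_endo A' A \<pi> J' J"
    using assms(7) by (auto simp: quotient_left_inv_complex_structure_def Let_def)
  obtain \<phi>' where coframe: "coframe10 A J n \<phi>" "coframe10 A' J' n \<phi>'"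
    and \<phi>': "\<And>j. j < n \<Longrightarrow> left_inv_form G A' 1 (\<phi>' j)" "\<And>j. j < n \<Longrightarrow> induces_form A' A \<pi> (\<phi>' j) (\<phi> j)"
    using assms(8) by (auto simp: quotient_left_inv_coframe10_def Let_def)
  obtain Z where Z: "frame10 A J n Z"
      "\<And>X. X \<in> vector_fields10 A J \<Longrightarrow> X = (\<lambda>h p. \<Sum>j<n. \<phi> j [X] p * Z j h p)"
    using coframe(1) unfolding coframe10_def by blast
  obtain Z' where Z': "frame10 A' J' n Z'"
      "\<And>X. X \<in> vector_fields10 A' J' \<Longrightarrow> X = (\<lambda>h p. \<Sum>j<n. \<phi>' j [X] p * Z' j h p)"
    using coframe(2) unfolding coframe10_def by blast
  have up_frame: "global_coframe A' UNIV J' n \<phi>' Z'"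
    using J'(1) Z' coframe(2) by unfold_locales (auto simp: coframe10_def)
  have n: "0 < n" using assms(5) DIM_positive[where 'a = 'e] by simp
  interpret Q: invariant_coframe A M J n \<phi> Z "\<pi> \<one>\<^bsub>G\<^esub>"
    using J(1) Z coframe(1) n assms(9,10) proj_in by unfold_locales (auto simp: coframe10_def)
  have Z'_inv: "left_push G a (Z' j) = Z' j" if "j < n" for a j
    by (rule left_invariant_frame[OF J' up_frame \<phi>'(1) that])
  have Z_rel: "vf_related A' A \<pi> (Z' j) (Z j)" if "j < n" for j
    by (rule vf_related_frame[OF J up_frame Q.global_coframe_axioms \<phi>'(2) Z'_inv[OF that] that])
  \<comment> \<open>The frame on \<open>G\<close>, indexed in the same way as the frame on the quotient.\<close>
  define E' where "E' v = (if snd v < n then if fst v then Z' (snd v) else vf_cnj (Z' (snd v)) else (\<lambda>h p. 0))" for v :: index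
  have E'_inv: "left_push G a (E' v) = E' v" for a v
  proof -
    have "left_push G a (vf_cnj X) = vf_cnj (left_push G a X)" for X
      by (simp add: left_push_def vf_cnj_def)
    then show ?thesis by (simp add: E'_def Z'_inv) (simp add: left_push_def)
  qed
  have E_rel: "vf_related A' A \<pi> (E' v) (Q.frame v)" for v
    using Z_rel up.vf_zero_in down.vf_zero_in
    by (auto simp: E'_def Q.frame_def vf_related_cnj) (auto simp: vf_related_def)
  have metric: "hermitian_metric A J g" "\<And>u v. \<exists>c. g (Q.frame u) (Q.frame v) = down.const c"
    if "quotient_left_inv_hermitian_metric G T \<Gamma> J' J g" for g
  proof -
    obtain g' where g: "hermitian_metric A J g" "left_inv_metric G A' g'" "induces_metric A' A \<pi> g' g"
      using \<open>quotient_left_inv_hermitian_metric G T \<Gamma> J' J g\<close>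
      by (auto simp: quotient_left_inv_hermitian_metric_def Let_def)
    show "hermitian_metric A J g" by (rule g(1))
    show "\<exists>c. g (Q.frame u) (Q.frame v) = down.const c" for u v
      by (rule metric_constant[OF g E_rel E_rel E'_inv E'_inv])
  qed
  have "del_delbar A J 2 (fundamental_form A J g) = zero_form \<and>
      del_delbar A J 4 (wedge 2 2 (fundamental_form A J g) (fundamental_form A J g)) = zero_form"
    if "quotient_left_inv_hermitian_metric G T \<Gamma> J' J g0" "skt A J g0"
      and "quotient_left_inv_hermitian_metric G T \<Gamma> J' J g" for g0 g
    using Q.skt_dichotomy[OF metric[OF that(1)] that(2) metric[OF that(3)]] by blast
  then show ?thesis
    unfolding Let_def by blast
qed

end
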